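(* Let $1<p<\infty$, let $f\in L^p(T)$, and let $f_s$ be the symmetric part of $f$. Then $f_s\in L^p(T_1)$ (that is, the restriction of $f_s$ to $T_1$ lies in $L^p(T_1)$), and $S_N^{T_1}f_s\to f_s$ in $L^p(T_1)$ as $N\to\infty$.
   Context: $T\subset\mathbb{R}^2$ is the equilateral triangle with vertices $(-1/\sqrt3,0)$, $(1/\sqrt3,0)$, $(0,1)$, and $T_1$ is its right-hand half, the hemiequilateral triangle with vertices $(0,0)$, $(1/\sqrt3,0)$, $(0,1)$. Functions are real-valued and $L^p$ is with respect to Lebesgue measure. The symmetric part of $f$ is $$f_s(x,y):=\frac{f(x,y)+f(-x,y)}{2},\qquad (x,y)\in T.$$ For integers $0\leq m<n$ with $m\equiv n \pmod 2$ define $$\begin{aligned}v_{m,n}(x,y)&:=2\cos\left(\frac{\pi m x}{\sqrt{3}}\right)\sin(\pi n y)\\&\quad+2(-1)^{(m+n)/2}\cos\left(\frac{\pi x}{2\sqrt{3}}(m+3n)\right)\sin\left(\frac{\pi y}{2}(m-n)\right)\\&\quad-2(-1)^{(m-n)/2}\cos\left(\frac{\pi x}{2\sqrt{3}}(3n-m)\right)\sin\left(\frac{\pi y}{2}(m+n)\right).\end{aligned}$$ (These are the restrictions to $T_1$ of the eigenfunctions of the Dirichlet Laplacian on $T$ that are symmetric in $x$.) The coefficients are $$f_s^{\triangle}(m,n):=\frac{1}{\|v_{m,n}\|_{L^2(T_1)}^2}\int_{T_1}f_s\,v_{m,n},$$ the index sets are $\mathcal{V}_N:=\{(m,n)\in\mathbb{Z}^2: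 0\leq m<n\leq N,\ m\equiv n \pmod 2\}$, and the partial sums are $$S_N^{T_1}f_s:=\sum_{(m,n)\in\mathcal{V}_N}f_s^{\triangle}(m,n)\,v_{m,n}.$$ *)

theory Defs
  imports "HOL-Analysis.Analysis"
begin

text \<open>Elements of \<open>L\<^sup>p\<close> are represented by functions rather than by classes modulo null sets.\<close>

definition Lp_space :: "real \<Rightarrow> 'a measure \<Rightarrow> ('a \<Rightarrow> real) set" where
  "Lp_space p M = {f \<in> borel_measurable M. integrable M (\<lambda>x. \<bar>f x\<bar> powr p)}"

definition Lp_norm :: "real \<Rightarrow> 'a measure \<Rightarrow> ('a \<Rightarrow> real) \<Rightarrow> real" where
  "Lp_norm p M f = (\<integral>x. \<bar>f x\<bar> powr p \<partial>M) powr (1 / p)"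

text \<open>The membership conditions matter: the Bochner integral of a non-integrable function is 0, so
  the limit of the norms alone would not express convergence.\<close>

definition Lp_converges :: "real \<Rightarrow> 'a measure \<Rightarrow> (nat \<Rightarrow> 'a \<Rightarrow> real) \<Rightarrow> ('a \<Rightarrow> real) \<Rightarrow> bool" where
  "Lp_converges p M F g \<longleftrightarrow>
     (\<forall>N. F N \<in> Lp_space p M) \<and> g \<in> Lp_space p M \<and>
     (\<lambda>N. Lp_norm p M (\<lambda>x. F N x - g x)) \<longlonglongrightarrow> 0"

definition equi_triangle :: "(real \<times> real) set" where
  "equi_triangle = convex hull {(- 1 / sqrt 3, 0), (1 / sqrt 3, 0), (0, 1)}"

definition hemi_triangle :: "(real \<times> real) set" where
  "hemi_triangle = convex hull {(0, 0), (1 / sqrt 3, 0), (0, 1)}"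

text \<open>On the triangle this depends only on the values of \<open>f\<close> there, since the triangle is
  invariant under \<open>(x, y) \<mapsto> (- x, y)\<close>.\<close>

definition sym_part :: "(real \<times> real \<Rightarrow> real) \<Rightarrow> real \<times> real \<Rightarrow> real" where
  "sym_part f = (\<lambda>(x, y). (f (x, y) + f (- x, y)) / 2)"

text \<open>Only used for \<open>m\<close> and \<open>n\<close> of equal parity, where both divisions are exact. The exponent
  \<open>(m - n) div 2\<close> is negative for \<open>m < n\<close>, hence the integer power.\<close>

definition tri_eigfun :: "int \<Rightarrow> int \<Rightarrow> real \<times> real \<Rightarrow> real" where
  "tri_eigfun m n = (\<lambda>(x, y).
     2 * cos (pi * of_int m * x / sqrt 3) * sin (pi * of_int n * y)
     + 2 * (- 1) powi ((m + n) div 2)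
         * cos (pi * x / (2 * sqrt 3) * of_int (m + 3 * n)) * sin (pi * y / 2 * of_int (m - n))
     - 2 * (- 1) powi ((m - n) div 2)
         * cos (pi * x / (2 * sqrt 3) * of_int (3 * n - m)) * sin (pi * y / 2 * of_int (m + n)))"

definition tri_coeff :: "(real \<times> real \<Rightarrow> real) \<Rightarrow> int \<Rightarrow> int \<Rightarrow> real" where
  "tri_coeff g m n =
     1 / (Lp_norm 2 (lebesgue_on hemi_triangle) (tri_eigfun m n))\<^sup>2
       * (\<integral>z. g z * tri_eigfun m n z \<partial>lebesgue_on hemi_triangle)"

definition tri_index :: "nat \<Rightarrow> (int \<times> int) set" where
  "tri_index N = {(m, n). 0 \<le> m \<and> m < n \<and> n \<le> int N \<and> m mod 2 = n mod 2}"

definition tri_partial_sum :: "nat \<Rightarrow> (real \<times> real \<Rightarrow> real) \<Rightarrow> real \<times> real \<Rightarrow> real" where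
  "tri_partial_sum N g = (\<lambda>z. \<Sum>(m, n)\<in>tri_index N. tri_coeff g m n * tri_eigfun m n z)"

end

theory Submission
  imports Defs
begin

text \<open>
  In the coordinates \<open>\<xi> = \<pi> x / \<surd>3\<close>, \<open>\<eta> = \<pi> (1 - y)\<close>, centred at the vertex with angle \<open>\<pi>/6\<close>, each
  eigenfunction is up to sign a sum of exponentials over an orbit of the dihedral group of order 12 and
  extends to the torus \<open>[0, 2\<pi>]\<^sup>2\<close>, which consists of 24 reflected copies of the triangle. The
  condition \<open>n \<le> N\<close> on the fundamental chamber becomes the hexagon \<open>\<bar>n\<bar> \<le> N\<close>, \<open>\<bar>m + n\<bar> \<le> 2N\<close>,
  \<open>\<bar>m - n\<bar> \<le> 2N\<close> of frequencies, so on trigonometric polynomials the partial sum is a product of three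
  one-dimensional strip projections, bounded in \<open>L\<^sup>p\<close> by the theorem of M. Riesz. That theorem is
  obtained from the mean value inequality for \<open>K \<bar>u\<bar>\<^sup>p - \<bar>u + iv\<bar>\<^sup>p\<close> (\<open>p \<le> 2\<close>), respectively
  \<open>\<bar>u + iv\<bar>\<^sup>p - K \<bar>v\<bar>\<^sup>p\<close> (\<open>p \<ge> 2\<close>), regularised to be smooth and subharmonic.

  Finite combinations of eigenfunctions are dense in \<open>L\<^sup>p\<close>: multiplication by the symmetric cosine sums
  preserves them, these cosine sums separate the points of the triangle, and the eigenfunction with
  index \<open>(0, 2)\<close> vanishes only on the boundary, so the Stone-Weierstrass theorem applies to quotients by
  it. Uniform boundedness and density give convergence.
\<close>

section \<open>Mean values of subharmonic functions of an analytic polynomial\<close>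

text \<open>Estimates are kept as integrals of p-th powers, so triangle inequalities carry crude
  factors such as \<open>2 powr p\<close>; what matters is that the constants are free of
  \<open>N\<close> and of the degree of the polynomial. Two obstacles shape the Riesz part. For p >
  2 the Laplacian of |Re z|^p vanishes on the imaginary axis, while that of |z|^p is positive off
  the origin, so the real part cannot dominate directly: the imaginary part is bounded first, by a
  factor below 1 that permits absorption. And the mean value inequality involves the value at the
  centre, so the constant term is made real and carried along as an extra term on the left. The two
  coordinates are scaled differently on purpose: every frequency becomes an integer, at the price
  that some reflections in lines through the vertex are unimodular maps and not isometries. The
  uniform bound is first known for finite sums of modes only. It reaches all of L^p because each
  single partial sum operator is continuous; its \<open>N\<close>-dependent modulus of continuity
  disappears as the approximation error tends to 0.\<close>

definition C2_data ::
  "(complex \<Rightarrow> real) \<Rightarrow> (complex \<Rightarrow> real) \<Rightarrow> (complex \<Rightarrow> real) \<Rightarrow> (complex \<Rightarrow> real) \<Rightarrow>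
   (complex \<Rightarrow> real) \<Rightarrow> (complex \<Rightarrow> real) \<Rightarrow> bool" where
  "C2_data G Gu Gv Guu Guv Gvv \<longleftrightarrow>
    (\<forall>z. (G has_derivative (\<lambda>h. Gu z * Re h + Gv z * Im h)) (at z)) \<and>
    (\<forall>z. (Gu has_derivative (\<lambda>h. Guu z * Re h + Guv z * Im h)) (at z)) \<and>
    (\<forall>z. (Gv has_derivative (\<lambda>h. Guv z * Re h + Gvv z * Im h)) (at z)) \<and>
    continuous_on UNIV Guu \<and> continuous_on UNIV Guv \<and> continuous_on UNIV Gvv"

lemma C2_data_lincomb:
  assumes "C2_data G Gu Gv Guu Guv Gvv" "C2_data H Hu Hv Huu Huv Hvv"
  shows "C2_data (\<lambda>z. a * G z + b * H z) (\<lambda>z. a * Gu z + b * Hu z) (\<lambda>z. a * Gv z + b * Hv z)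
    (\<lambda>z. a * Guu z + b * Huu z) (\<lambda>z. a * Guv z + b * Huv z) (\<lambda>z. a * Gvv z + b * Hvv z)"
  using assms unfolding C2_data_def
  by (auto intro!: continuous_intros derivative_eq_intros simp: fun_eq_iff algebra_simps)

text \<open>With q = p/2 the choices (1, 0), (0, 1), (1, 1) for (l, m) regularise |Re z|^p, |Im z|^p
  and |z|^p. The term e > 0 keeps the base positive, hence the power smooth for every
  exponent.\<close>

lemma C2_data_quadratic_powr:
  fixes l m e q :: real
  assumes "l \<ge> 0" "m \<ge> 0" "e > 0"
  defines "X \<equiv> \<lambda>z. l * (Re z)\<^sup>2 + m * (Im z)\<^sup>2 + e"
  shows "C2_data (\<lambda>z. X z powr q)
    (\<lambda>z. 2 * q * l * Re z * X z powr (q - 1)) (\<lambda>z. 2 * q * m * Im z * X z powr (q - 1))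
    (\<lambda>z. 2 * q * l * X z powr (q - 1) + 4 * q * (q - 1) * l\<^sup>2 * (Re z)\<^sup>2 * X z powr (q - 2))
    (\<lambda>z. 4 * q * (q - 1) * l * m * Re z * Im z * X z powr (q - 2))
    (\<lambda>z. 2 * q * m * X z powr (q - 1) + 4 * q * (q - 1) * m\<^sup>2 * (Im z)\<^sup>2 * X z powr (q - 2))"
proof -
  have pos: "X z > 0" for z
    unfolding X_def using assms by (meson add_nonneg_pos mult_nonneg_nonneg zero_le_power2 add_nonneg_nonneg)
  have dX: "(X has_derivative (\<lambda>h. 2 * l * Re z * Re h + 2 * m * Im z * Im h)) (at z)" for z
    unfolding X_def by (auto intro!: derivative_eq_intros simp: fun_eq_iff)
  have contX: "continuous_on UNIV X"
    unfolding X_def by (intro continuous_intros)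
  have dP: "((\<lambda>z. X z powr r) has_derivative
      (\<lambda>h. (r * X z powr (r - 1)) * (2 * l * Re z * Re h + 2 * m * Im z * Im h))) (at z)" for r z
  proof -
    have "((\<lambda>x. x powr r) has_real_derivative r * X z powr (r - 1)) (at (X z))"
      by (rule has_real_derivative_powr) (rule pos)
    from has_derivative_compose[OF dX this[unfolded has_field_derivative_def]]
    show ?thesis by simp
  qed
  have dR: "((\<lambda>z. c * Re z * X z powr r) has_derivative (\<lambda>h. c * Re z *
      ((r * X z powr (r - 1)) * (2 * l * Re z * Re h + 2 * m * Im z * Im h)) + c * Re h * X z powr r)) (at z)"
    for c r z
    by (rule has_derivative_mult[OF _ dP]) (auto intro!: derivative_eq_intros)
  have dI: "((\<lambda>z. c * Im z * X z powr r) has_derivative (\<lambda>h. c * Im z *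
      ((r * X z powr (r - 1)) * (2 * l * Re z * Re h + 2 * m * Im z * Im h)) + c * Im h * X z powr r)) (at z)"
    for c r z
    by (rule has_derivative_mult[OF _ dP]) (auto intro!: derivative_eq_intros)
  have q2: "q - 1 - 1 = q - 2" by simp
  have nz: "X z \<noteq> 0" for z using pos[of z] by linarith
  show ?thesis
    unfolding C2_data_def
    apply (intro conjI allI)
         apply (rule has_derivative_eq_rhs[OF dP], simp add: fun_eq_iff algebra_simps)
        apply (rule has_derivative_eq_rhs[OF dR], simp add: q2 fun_eq_iff algebra_simps power2_eq_square)
       apply (rule has_derivative_eq_rhs[OF dI], simp add: q2 fun_eq_iff algebra_simps power2_eq_square)
    by (intro continuous_intros contX ballI; simp add: nz)+
qed

text \<open>The circle of radius \<open>e\<^sup>r\<close> is parametrised by \<open>t \<mapsto> r + it\<close>. Since the second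
  \<open>t\<close>-derivative has mean zero, the mean over \<open>t\<close> is a convex function of \<open>r\<close>; it is bounded as
  \<open>r \<rightarrow> -\<infinity>\<close>, hence nondecreasing.\<close>

lemma integral_mean_subharmonic:
  fixes k :: "'i \<Rightarrow> nat" and c :: "'i \<Rightarrow> complex"
  assumes C2: "C2_data G Gu Gv Guu Guv Gvv" and lap: "\<And>z. Guu z + Gvv z \<ge> 0"
    and I: "finite I"
  defines "f \<equiv> \<lambda>z. \<Sum>i\<in>I. c i * exp (of_nat (k i) * z)"
  defines "a \<equiv> \<Sum>i\<in>{i\<in>I. k i = 0}. c i"
  shows "2 * pi * G a \<le> integral {0..2*pi} (\<lambda>t. G (f (\<i> * of_real t)))"
proof -
  define f' where "f' = (\<lambda>z. \<Sum>i\<in>I. c i * of_nat (k i) * exp (of_nat (k i) * z))"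
  define f'' where "f'' = (\<lambda>z. \<Sum>i\<in>I. c i * of_nat (k i) * of_nat (k i) * exp (of_nat (k i) * z))"
  define w where "w = (\<lambda>r t. Complex r t)"
  have w_alt: "w r t = of_real r + \<i> * of_real t" for r t
    by (simp add: w_def complex_eq_iff)
  have df: "(f has_field_derivative f' z) (at z)" for z
    unfolding f_def f'_def by (auto intro!: derivative_eq_intros simp: algebra_simps)
  have df': "(f' has_field_derivative f'' z) (at z)" for z
    unfolding f'_def f''_def by (auto intro!: derivative_eq_intros simp: algebra_simps)
  have cf: "continuous_on A f" "continuous_on A f'" "continuous_on A f''" for A
    unfolding f_def f'_def f''_def by (intro continuous_intros)+
  have dG: "(G has_derivative (\<lambda>h. Gu z * Re h + Gv z * Im h)) (at z)"
    and dGu: "(Gu has_derivative (\<lambda>h. Guu z * Re h + Guv z * Im h)) (at z)"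
    and dGv: "(Gv has_derivative (\<lambda>h. Guv z * Re h + Gvv z * Im h)) (at z)" for z
    using C2 unfolding C2_data_def by blast+
  have cG: "continuous_on A G" "continuous_on A Gu" "continuous_on A Gv" for A
    using dG dGu dGv by (meson has_derivative_continuous continuous_at_imp_continuous_on)+
  have cG2: "continuous_on A Guu" "continuous_on A Guv" "continuous_on A Gvv" for A
    using C2 unfolding C2_data_def by (meson continuous_on_subset subset_UNIV)+
  have ray: "((\<lambda>x. H (g (e * of_real x + b))) has_real_derivative
      Hu (g (e * of_real x + b)) * Re (e * g' (e * of_real x + b)) +
      Hv (g (e * of_real x + b)) * Im (e * g' (e * of_real x + b))) (at x)"
    if H: "\<And>z. (H has_derivative (\<lambda>h. Hu z * Re h + Hv z * Im h)) (at z)"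
      and g: "\<And>z. (g has_field_derivative g' z) (at z)" for H Hu Hv :: "complex \<Rightarrow> real" and g g' :: "complex \<Rightarrow> complex" and e b x
  proof -
    let ?z = "e * of_real x + b"
    have 1: "((\<lambda>x. e * of_real x + b) has_derivative (\<lambda>h. e * of_real h)) (at x)"
      by (auto intro!: derivative_eq_intros)
    have 2: "((\<lambda>x. g (e * of_real x + b)) has_derivative (\<lambda>h. g' ?z * (e * of_real h))) (at x)"
      using has_derivative_compose[OF 1] g[of ?z] unfolding has_field_derivative_def by auto
    from has_derivative_compose[OF 2 H]
    show ?thesis unfolding has_field_derivative_def
      by (rule has_derivative_eq_rhs) (auto simp: fun_eq_iff algebra_simps)
  qed
  have ray1: "((\<lambda>x. H (g (w x t))) has_real_derivative
      Hu (g (w r t)) * Re (g' (w r t)) + Hv (g (w r t)) * Im (g' (w r t))) (at r)"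
    if "\<And>z. (H has_derivative (\<lambda>h. Hu z * Re h + Hv z * Im h)) (at z)"
      "\<And>z. (g has_field_derivative g' z) (at z)" for H Hu Hv :: "complex \<Rightarrow> real" and g g' :: "complex \<Rightarrow> complex" and r t
    using ray[OF that, where e = 1 and x = r and b = "\<i> * of_real t"] by (simp add: w_alt)
  have ray2: "((\<lambda>x. H (g (w r x))) has_real_derivative
      - Hu (g (w r t)) * Im (g' (w r t)) + Hv (g (w r t)) * Re (g' (w r t))) (at t)"
    if "\<And>z. (H has_derivative (\<lambda>h. Hu z * Re h + Hv z * Im h)) (at z)"
      "\<And>z. (g has_field_derivative g' z) (at z)" for H Hu Hv :: "complex \<Rightarrow> real" and g g' :: "complex \<Rightarrow> complex" and r t
    using ray[OF that, where e = \<i> and x = t and b = "of_real r"] by (simp add: w_alt add.commute)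
  have dRe: "(Re has_derivative (\<lambda>h. 1 * Re h + 0 * Im h)) (at z)"
    and dIm: "(Im has_derivative (\<lambda>h. 0 * Re h + 1 * Im h)) (at z)" for z
    by (auto intro!: derivative_eq_intros)
  \<comment> \<open>\<open>A1\<close>, \<open>A2\<close> are the first and second derivatives of
    \<open>G (f (w r t))\<close> in r, and \<open>B1\<close>, \<open>B2\<close> those in t.\<close>
  define A1 where "A1 = (\<lambda>r t. Gu (f (w r t)) * Re (f' (w r t)) + Gv (f (w r t)) * Im (f' (w r t)))"
  define A2 where "A2 = (\<lambda>r t.
    (Guu (f (w r t)) * Re (f' (w r t)) + Guv (f (w r t)) * Im (f' (w r t))) * Re (f' (w r t))
    + Gu (f (w r t)) * Re (f'' (w r t))
    + ((Guv (f (w r t)) * Re (f' (w r t)) + Gvv (f (w r t)) * Im (f' (w r t))) * Im (f' (w r t))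
    + Gv (f (w r t)) * Im (f'' (w r t))))"
  define B1 where "B1 = (\<lambda>r t. - Gu (f (w r t)) * Im (f' (w r t)) + Gv (f (w r t)) * Re (f' (w r t)))"
  define B2 where "B2 = (\<lambda>r t.
    - ((- Guu (f (w r t)) * Im (f' (w r t)) + Guv (f (w r t)) * Re (f' (w r t))) * Im (f' (w r t))
      + Gu (f (w r t)) * Re (f'' (w r t)))
    + ((- Guv (f (w r t)) * Im (f' (w r t)) + Gvv (f (w r t)) * Re (f' (w r t))) * Re (f' (w r t))
      - Gv (f (w r t)) * Im (f'' (w r t))))"
  have dA0: "((\<lambda>r. G (f (w r t))) has_real_derivative A1 r t) (at r)" for r t
    unfolding A1_def by (rule ray1[OF dG df])
  have dA1: "((\<lambda>r. A1 r t) has_real_derivative A2 r t) (at r)" for r t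
    unfolding A1_def A2_def
    by (rule DERIV_cong[OF DERIV_add[OF DERIV_mult[OF ray1[OF dGu df] ray1[OF dRe df']]
          DERIV_mult[OF ray1[OF dGv df] ray1[OF dIm df']]]]) (simp add: algebra_simps)
  have dB1: "((\<lambda>t. B1 r t) has_real_derivative B2 r t) (at t)" for r t
    unfolding B1_def B2_def
    by (rule DERIV_cong[OF DERIV_add[OF DERIV_mult[OF DERIV_minus[OF ray2[OF dGu df]] ray2[OF dIm df']]
          DERIV_mult[OF ray2[OF dGv df] ray2[OF dRe df']]]]) (simp add: algebra_simps)
  \<comment> \<open>By the Cauchy-Riemann equations the terms with \<open>f''\<close> and those with
    the mixed derivative cancel, which leaves the Laplacian of \<open>G\<close> times the Jacobian
    of \<open>f\<close>.\<close>
  have AB: "A2 r t + B2 r t = (Guu (f (w r t)) + Gvv (f (w r t))) * (cmod (f' (w r t)))\<^sup>2" for r t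
    unfolding A2_def B2_def cmod_power2 by (simp add: algebra_simps power2_eq_square)
  have contw: "continuous_on U (\<lambda>x. w (fst x) (snd x))" for U
    unfolding w_alt by (intro continuous_intros)
  have contw1: "continuous_on U (\<lambda>x. w r x)" for U r
    unfolding w_alt by (intro continuous_intros)
  note cont = cG[of UNIV, THEN continuous_on_compose2] cG2[of UNIV, THEN continuous_on_compose2]
    cf[of UNIV, THEN continuous_on_compose2]
  have cA1: "continuous_on U (\<lambda>(r, t). A1 r t)" for U
    unfolding A1_def case_prod_unfold by (intro continuous_intros cont contw subset_UNIV)
  have cA2: "continuous_on U (\<lambda>(r, t). A2 r t)" for U
    unfolding A2_def case_prod_unfold by (intro continuous_intros cont contw subset_UNIV)
  have cG1: "continuous_on U (\<lambda>t. G (f (w r t)))" for U r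
    by (intro continuous_intros cont contw1 subset_UNIV)
  have cA11: "continuous_on U (\<lambda>t. A1 r t)" and cA21: "continuous_on U (\<lambda>t. A2 r t)"
     and cB21: "continuous_on U (\<lambda>t. B2 r t)" for U r
    unfolding A1_def A2_def B2_def by (intro continuous_intros cont contw1 subset_UNIV)+
  define M where "M = (\<lambda>r. integral {0..2*pi} (\<lambda>t. G (f (w r t))))"
  define D where "D = (\<lambda>r. integral {0..2*pi} (A1 r))"
  define E where "E = (\<lambda>r. integral {0..2*pi} (A2 r))"
  have dM: "(M has_real_derivative D r) (at r)" for r
    unfolding M_def D_def cbox_interval[symmetric]
    by (rule leibniz_rule_field_derivative[where U=UNIV])
       (rule dA0 cA1 integrable_continuous cG1 UNIV_I convex_UNIV)+
  have dD: "(D has_real_derivative E r) (at r)" for r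
    unfolding E_def D_def cbox_interval[symmetric]
    by (rule leibniz_rule_field_derivative[where U=UNIV])
       (rule dA1 cA2 integrable_continuous cA11 UNIV_I convex_UNIV)+
  have periodic: "f (w r (2 * pi)) = f (w r 0)" "f' (w r (2 * pi)) = f' (w r 0)" for r
  proof -
    have "exp (of_nat n * w r (2 * pi)) = exp (of_nat n * w r 0)" for n
      using exp_integer_2pi[of "of_nat n"] unfolding w_alt
      by (simp add: algebra_simps exp_add)
    then show "f (w r (2 * pi)) = f (w r 0)" "f' (w r (2 * pi)) = f' (w r 0)"
      unfolding f_def f'_def by simp_all
  qed
  have E0: "E r \<ge> 0" for r
  proof -
    have "(B2 r has_integral (B1 r (2 * pi) - B1 r 0)) {0..2*pi}"
      by (rule fundamental_theorem_of_calculus)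
         (auto intro!: has_real_derivative_iff_has_vector_derivative[THEN iffD1] DERIV_subset[OF dB1])
    then have "integral {0..2*pi} (B2 r) = 0"
      by (simp add: B1_def periodic integral_unique)
    then have "E r = integral {0..2*pi} (\<lambda>t. A2 r t + B2 r t)"
      unfolding E_def by (subst integral_add) (auto intro!: integrable_continuous_real cA21 cB21)
    also have "\<dots> \<ge> 0"
      unfolding AB by (rule integral_nonneg)
        (auto intro!: mult_nonneg_nonneg lap integrable_continuous_real continuous_on_add continuous_on_mult continuous_on_power continuous_on_norm cont contw1)
    finally show ?thesis .
  qed
  have Dmono: "D r \<le> D s" if "r \<le> s" for r s
    using DERIV_nonneg_imp_nondecreasing[OF that, of D] dD E0 by blast
  have flim: "cmod (f (w r t) - a) \<le> (\<Sum>i\<in>I. cmod (c i)) * exp r" if "r \<le> 0" for r t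
  proof -
    have a: "a = (\<Sum>i\<in>I. if k i = 0 then c i else 0)"
      unfolding a_def using I by (simp add: sum.inter_filter)
    have "cmod (f (w r t) - a) \<le> (\<Sum>i\<in>I. cmod (c i * exp (of_nat (k i) * w r t) - (if k i = 0 then c i else 0)))"
      unfolding f_def a sum_subtractf[symmetric] by (rule norm_sum)
    also have "\<dots> \<le> (\<Sum>i\<in>I. cmod (c i) * exp r)"
    proof (rule sum_mono)
      fix i
      have "real (k i) * r \<le> r" if "k i > 0"
        using mult_right_mono_neg[of 1 "real (k i)" r] \<open>r \<le> 0\<close> that by simp
      then show "cmod (c i * exp (of_nat (k i) * w r t) - (if k i = 0 then c i else 0)) \<le> cmod (c i) * exp r"
        by (auto simp: norm_mult w_alt intro!: mult_left_mono)
    qed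
    finally show ?thesis by (simp add: sum_distrib_right)
  qed
  have Mlim: "(M \<longlongrightarrow> 2 * pi * G a) at_bot"
  proof (rule tendstoI)
    fix \<epsilon> :: real assume "\<epsilon> > 0"
    \<comment> \<open>The interval of integration has length 2 pi < 8.\<close>
    define \<epsilon>' where "\<epsilon>' = \<epsilon> / 8"
    have "\<epsilon>' > 0" using \<open>\<epsilon> > 0\<close> by (simp add: \<epsilon>'_def)
    then obtain d where d: "d > 0" "\<And>z. dist z a < d \<Longrightarrow> dist (G z) (G a) < \<epsilon>'"
      using cG(1)[of UNIV] unfolding continuous_on_iff by (metis UNIV_I)
    have "((\<lambda>r. (\<Sum>i\<in>I. cmod (c i)) * exp r) \<longlongrightarrow> (\<Sum>i\<in>I. cmod (c i)) * 0) at_bot"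
      by (intro tendsto_intros exp_at_bot)
    then have "eventually (\<lambda>r. (\<Sum>i\<in>I. cmod (c i)) * exp r < d) at_bot"
      using d(1) by (simp add: order_tendsto_iff)
    moreover have "eventually (\<lambda>r::real. r \<le> 0) at_bot" by (rule eventually_le_at_bot)
    ultimately show "eventually (\<lambda>r. dist (M r) (2 * pi * G a) < \<epsilon>) at_bot"
    proof eventually_elim
      case (elim r)
      have "norm (integral (cbox 0 (2*pi)) (\<lambda>t. G (f (w r t)) - G a)) \<le> \<epsilon>' * measure lborel (cbox 0 (2*pi))"
      proof (rule integrable_bound)
        fix t
        have "dist (f (w r t)) a < d" using flim[OF elim(2), of t] elim(1) by (simp add: dist_norm)
        then show "norm (G (f (w r t)) - G a) \<le> \<epsilon>'" using d(2) by (force simp: dist_norm)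
      qed (use \<open>\<epsilon>' > 0\<close> in \<open>auto intro!: integrable_continuous_real continuous_intros cG1\<close>)
      also have "integral (cbox 0 (2*pi)) (\<lambda>t. G (f (w r t)) - G a) = M r - 2 * pi * G a"
        unfolding M_def by (simp add: integral_diff integrable_continuous_real cG1)
      also have "\<epsilon>' * measure lborel (cbox 0 (2*pi)) < \<epsilon>"
        using pi_less_4 \<open>\<epsilon> > 0\<close> unfolding \<epsilon>'_def by (simp add: field_simps)
      finally show ?case by (simp add: dist_norm)
    qed
  qed
  have D0: "D r \<ge> 0" for r
  proof (rule ccontr)
    assume "\<not> D r \<ge> 0"
    then have neg: "D r < 0" by simp
    have lb: "M s \<ge> M r + (s - r) * D r" if "s \<le> r" for s
    proof (cases "s = r")
      case False
      then have "s < r" using that by simp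
      then obtain x where x: "x > s" "x < r" "M r - M s = (r - s) * D x"
        using MVT2[of s r M D] dM by blast
      have "(r - s) * D x \<le> (r - s) * D r" using Dmono[of x r] x that by (intro mult_left_mono) auto
      with x show ?thesis by (simp add: algebra_simps)
    qed auto
    define L where "L = 2 * pi * G a + 1"
    have "eventually (\<lambda>s. M s < L) at_bot"
      using order_tendstoD(2)[OF Mlim, of L] by (simp add: L_def)
    then obtain s0 where s0: "\<And>s. s \<le> s0 \<Longrightarrow> M s < L"
      by (auto simp: eventually_at_bot_linorder)
    \<comment> \<open>Far enough to the left for the line in \<open>lb\<close>, which has negative
      slope, to have risen to \<open>L\<close>.\<close>
    define s where "s = min (min s0 r) (r + (L - M r) / D r)"
    have "s - r \<le> (L - M r) / D r" unfolding s_def by simp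
    then have "(s - r) * D r \<ge> L - M r" using neg by (simp add: field_simps)
    moreover have "M s \<ge> M r + (s - r) * D r" by (rule lb) (simp add: s_def)
    moreover have "M s < L" by (rule s0) (simp add: s_def)
    ultimately show False by simp
  qed
  have Mmono: "M s \<le> M 0" if "s \<le> 0" for s
    using DERIV_nonneg_imp_nondecreasing[OF that, of M] dM D0 by blast
  have "2 * pi * G a \<le> M 0"
    by (rule tendsto_upperbound[OF Mlim])
       (auto intro: eventually_mono[OF eventually_le_at_bot[of 0]] Mmono)
  then show ?thesis by (simp add: M_def w_alt)
qed

section \<open>The theorem of M. Riesz on the circle\<close>

lemma cmod_square_powr_half: "(cmod z)\<^sup>2 powr (p / 2) = cmod z powr p"
proof -
  have "(cmod z)\<^sup>2 = cmod z powr 2" by (simp add: powr_numeral)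
  then show ?thesis by (simp only: powr_powr) simp
qed

lemma square_powr_half: "(x\<^sup>2) powr (p / 2) = \<bar>x :: real\<bar> powr p"
  using cmod_square_powr_half[of "of_real x" p] by simp

lemma integral_lincomb:
  fixes f g :: "real \<Rightarrow> real"
  assumes "f integrable_on S" "g integrable_on S"
  shows "integral S (\<lambda>t. a * f t + b * g t) = a * integral S f + b * integral S g"
  by (subst integral_add) (auto intro!: integrable_on_mult_right assms)

text \<open>Continuity up to e = 0, where the base may vanish, is what allows the regularisation to
  be removed at the end.\<close>

lemma continuous_on_quadratic_powr_param:
  fixes g :: "real \<Rightarrow> complex" and q a b :: real
  assumes "q > 0" "l \<ge> 0" "m \<ge> 0" "continuous_on {a..b} g"
  shows "continuous_on {0..1::real} (\<lambda>e. integral {a..b}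
    (\<lambda>t. (l * (Re (g t))\<^sup>2 + m * (Im (g t))\<^sup>2 + e) powr q))"
  unfolding cbox_interval[symmetric, of a b]
proof (rule integral_continuous_on_param)
  show "continuous_on ({0..1} \<times> cbox a b) (\<lambda>(e, t). (l * (Re (g t))\<^sup>2 + m * (Im (g t))\<^sup>2 + e) powr q)"
    unfolding case_prod_unfold using assms
    by (intro continuous_on_powr' continuous_intros ballI continuous_on_compose2[OF assms(4)])
      (auto intro!: add_nonneg_nonneg mult_nonneg_nonneg)
qed

text \<open>Here x and y stand for the squares of Re z and Im z. At e = 0 the comparison rests on
  |Re z|^(p-2) >= |z|^(p-2), true since the exponent is nonpositive. Taking 2 / (p - 1) where p / (p
  - 1) would be the limiting constant leaves room to drop the nonpositive second summand of the
  subtracted Laplacian.\<close>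

lemma subharmonic_laplacian_small:
  fixes p :: real
  assumes "1 < p" "p \<le> 2" "e > 0" and that: "x \<ge> 0" "y \<ge> 0"
  defines "q \<equiv> p / 2"
  shows "0 \<le> 2 / (p - 1) * (2 * q * (x + e) powr (q - 1) + 4 * q * (q - 1) * x * (x + e) powr (q - 2))
    - (4 * q * (x + y + e) powr (q - 1) + 4 * q * (q - 1) * (x + y) * (x + y + e) powr (q - 2))"
proof -
  have q: "q \<le> 1" "q > 0" "p - 1 = 2 * q - 1" "2 * q - 1 > 0" using assms by (auto simp: q_def)
  have r: "X powr (q - 1) = X * X powr (q - 2)" if "X > 0" for X
    using that powr_add[of X 1 "q - 2"] by simp
  have "(2 * q - 1) * (2 * q * (x + e) powr (q - 1)) \<le>
    2 * q * (x + e) powr (q - 1) + 4 * q * (q - 1) * x * (x + e) powr (q - 2)"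
  proof -
    have "(q - 1) * (x + e) * (x + e) powr (q - 2) \<le> (q - 1) * x * (x + e) powr (q - 2)"
      using q \<open>e > 0\<close> by (intro mult_right_mono mult_left_mono_neg) auto
    then have "4 * q * ((q - 1) * (x + e) powr (q - 1)) \<le> 4 * q * ((q - 1) * x * (x + e) powr (q - 2))"
      using q \<open>e > 0\<close> \<open>x \<ge> 0\<close> r[of "x + e"] by (intro mult_left_mono) (auto simp: algebra_simps)
    then show ?thesis by (simp add: algebra_simps)
  qed
  then have 1: "4 * q * (x + e) powr (q - 1) \<le> 2 / (p - 1) *
    (2 * q * (x + e) powr (q - 1) + 4 * q * (q - 1) * x * (x + e) powr (q - 2))"
    using q by (simp add: field_simps)
  have 2: "(x + y + e) powr (q - 1) \<le> (x + e) powr (q - 1)"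
    using q \<open>e > 0\<close> that by (intro powr_mono2') auto
  have 3: "4 * q * (q - 1) * (x + y) * (x + y + e) powr (q - 2) \<le> 0"
    using q that by (intro mult_nonpos_nonneg mult_nonneg_nonpos) auto
  have "4 * q * (x + y + e) powr (q - 1) \<le> 4 * q * (x + e) powr (q - 1)"
    using 2 q by (intro mult_left_mono) auto
  with 1 3 show ?thesis by linarith
qed

text \<open>Now p - 2 >= 0, and |Im z|^(p-2) <= |z|^(p-2) gives the comparison at e = 0, with
  equality on the imaginary axis. There is thus no slack for the terms of order e produced by the
  regularisation; they are compared between \<open>X\<close> and \<open>Y\<close> separately, using
  e <= \<open>Y\<close>.\<close>

lemma subharmonic_laplacian_large:
  fixes p :: real
  assumes "2 \<le> p" "e > 0" and that: "x \<ge> 0" "y \<ge> 0"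
  defines "q \<equiv> p / 2"
  shows "0 \<le> (4 * q * (x + y + e) powr (q - 1) + 4 * q * (q - 1) * (x + y) * (x + y + e) powr (q - 2))
    - p / (p - 1) * (2 * q * (y + e) powr (q - 1) + 4 * q * (q - 1) * y * (y + e) powr (q - 2))"
proof -
  define X Y where "X = x + y + e" and "Y = y + e"
  have XY: "0 < Y" "e \<le> Y" "Y \<le> X" using that assms by (auto simp: X_def Y_def)
  have q: "q \<ge> 1" "p - 1 = 2 * q - 1" "p = 2 * q" using assms by (auto simp: q_def)
  have r: "Z powr (q - 1) = Z * Z powr (q - 2)" if "Z > 0" for Z
    using that powr_add[of Z 1 "q - 2"] by simp
  have K: "2 * q / (2 * q - 1) * (4 * q * (q - 1) * e * Y powr (q - 2)) \<ge> 4 * q * (q - 1) * e * Y powr (q - 2)"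
  proof -
    have "1 \<le> 2 * q / (2 * q - 1)" using q by (simp add: field_simps)
    moreover have "0 \<le> 4 * q * (q - 1) * e * Y powr (q - 2)" using q \<open>e > 0\<close> by simp
    ultimately show ?thesis by (metis mult_right_mono mult_1)
  qed
  have e1: "4 * q * X powr (q - 1) + 4 * q * (q - 1) * (X - e) * X powr (q - 2)
    = 4 * q\<^sup>2 * (X powr (q - 1)) - 4 * q * (q - 1) * e * X powr (q - 2)"
    using r[of X] XY by (simp add: algebra_simps power2_eq_square)
  have e2: "2 * q * Y powr (q - 1) + 4 * q * (q - 1) * (Y - e) * Y powr (q - 2)
    = (2 * q - 1) * (2 * q * Y powr (q - 1)) - 4 * q * (q - 1) * e * Y powr (q - 2)"
    using r[of Y] XY by (simp add: algebra_simps power2_eq_square)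
  have e3: "2 * q / (2 * q - 1) * (2 * q * Y powr (q - 1) + 4 * q * (q - 1) * (Y - e) * Y powr (q - 2))
    = 4 * q\<^sup>2 * (Y powr (q - 1)) - 2 * q / (2 * q - 1) * (4 * q * (q - 1) * e * Y powr (q - 2))"
    unfolding e2 using q by (simp add: right_diff_distrib power2_eq_square)
  have "(q - 1) * e * (X powr (q - 2) - Y powr (q - 2)) \<le> q * (X powr (q - 1) - Y powr (q - 1))"
  proof (cases "X powr (q - 2) \<le> Y powr (q - 2)")
    case True
    have "(q - 1) * e * (X powr (q - 2) - Y powr (q - 2)) \<le> 0"
      using True q \<open>e > 0\<close> by (intro mult_nonneg_nonpos) auto
    moreover have "0 \<le> q * (X powr (q - 1) - Y powr (q - 1))"
      using q XY by (auto intro!: mult_nonneg_nonneg powr_mono2)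
    ultimately show ?thesis by linarith
  next
    case False
    have "e * (X powr (q - 2) - Y powr (q - 2)) \<le> Y * (X powr (q - 2) - Y powr (q - 2))"
      using False XY by (intro mult_right_mono) auto
    also have "\<dots> \<le> X * X powr (q - 2) - Y * Y powr (q - 2)"
      using XY by (auto simp: right_diff_distrib intro!: mult_right_mono)
    finally have "e * (X powr (q - 2) - Y powr (q - 2)) \<le> X powr (q - 1) - Y powr (q - 1)"
      using r XY by simp
    moreover have "0 \<le> X powr (q - 1) - Y powr (q - 1)"
      using q XY by (auto intro!: powr_mono2)
    ultimately have "(q - 1) * (e * (X powr (q - 2) - Y powr (q - 2))) \<le> q * (X powr (q - 1) - Y powr (q - 1))"
      using q by (intro mult_mono') (use False \<open>e > 0\<close> in auto)
    then show ?thesis by (simp add: algebra_simps)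
  qed
  from mult_left_mono[OF this, of "4 * q"] q have
    "4 * q * (q - 1) * e * X powr (q - 2) - 4 * q * (q - 1) * e * Y powr (q - 2)
      \<le> 4 * q\<^sup>2 * X powr (q - 1) - 4 * q\<^sup>2 * Y powr (q - 1)"
    by (simp add: algebra_simps power2_eq_square)
  with K e1 e3 have "0 \<le> (4 * q * X powr (q - 1) + 4 * q * (q - 1) * (X - e) * X powr (q - 2))
    - 2 * q / (2 * q - 1) * (2 * q * Y powr (q - 1) + 4 * q * (q - 1) * (Y - e) * Y powr (q - 2))"
    by linarith
  then show ?thesis by (simp add: X_def Y_def q(3))
qed


lemma continuous_le_at_left_endpoint:
  fixes f g :: "real \<Rightarrow> real"
  assumes "continuous_on {a..b} f" "continuous_on {a..b} g" "a < b"
    and "\<And>x. a < x \<Longrightarrow> f x \<le> g x"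
  shows "f a \<le> g a"
proof (rule tendsto_le)
  show "(f \<longlongrightarrow> f a) (at_right a)" "(g \<longlongrightarrow> g a) (at_right a)"
    using assms by (auto intro: continuous_on_Icc_at_rightD)
  show "\<forall>\<^sub>F x in at_right a. f x \<le> g x"
    using eventually_at_right_less by (rule eventually_mono) (rule assms(4))
qed auto

text \<open>The point is that \<kappa> may be as close to 1 as desired. Where |Re z| <= d |Im z|,
  one has |z| <= (1 + d) |Im z| with (1 + d)^p = \<kappa>; elsewhere |z| is at most a multiple of
  |Re z|.\<close>

lemma quadratic_powr_le:
  fixes p \<kappa> :: real
  assumes "p > 0" "\<kappa> > 1"
  shows "\<exists>C\<ge>0. \<forall>z. cmod z powr p \<le> \<kappa> * \<bar>Im z\<bar> powr p + C * \<bar>Re z\<bar> powr p"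
proof -
  define d where "d = \<kappa> powr (1 / p) - 1"
  have d: "d > 0" using assms powr_less_mono[of 0 "1 / p" \<kappa>] by (simp add: d_def)
  define C where "C = (1 / d + 1) powr p"
  have "cmod z powr p \<le> \<kappa> * \<bar>Im z\<bar> powr p + C * \<bar>Re z\<bar> powr p" for z
  proof (cases "\<bar>Re z\<bar> \<le> d * \<bar>Im z\<bar>")
    case True
    have "cmod z \<le> \<kappa> powr (1 / p) * \<bar>Im z\<bar>"
      using cmod_le[of z] True by (simp add: d_def algebra_simps)
    then have "cmod z powr p \<le> (\<kappa> powr (1 / p) * \<bar>Im z\<bar>) powr p"
      using assms by (intro powr_mono2) auto
    also have "\<dots> = \<kappa> * \<bar>Im z\<bar> powr p"
      using assms by (simp add: powr_mult powr_powr)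
    finally show ?thesis by (simp add: C_def add_increasing2)
  next
    case False
    then have "\<bar>Im z\<bar> \<le> \<bar>Re z\<bar> / d" using d by (simp add: field_simps)
    then have "cmod z \<le> (1 / d + 1) * \<bar>Re z\<bar>" using cmod_le[of z] by (simp add: algebra_simps)
    then have "cmod z powr p \<le> ((1 / d + 1) * \<bar>Re z\<bar>) powr p"
      using assms by (intro powr_mono2) auto
    also have "\<dots> = C * \<bar>Re z\<bar> powr p"
      using d by (simp add: powr_mult C_def)
    finally show ?thesis using assms by (simp add: add_increasing)
  qed
  then show ?thesis by (intro exI[of _ C]) (simp add: C_def)
qed

text \<open>Mean value inequality for the regularised K |Re z|^p - |z|^p, with e tending to 0. At
  the real point \<open>a\<close> its limit is (K - 1) |a|^p, and K = 2 / (p - 1) >= 2 leaves at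
  least |a|^p on the left.\<close>

lemma riesz_real_part_small:
  fixes k :: "'i \<Rightarrow> nat" and c :: "'i \<Rightarrow> complex" and p :: real
  assumes p: "1 < p" "p \<le> 2" and I: "finite I"
  defines "f \<equiv> \<lambda>t. \<Sum>i\<in>I. c i * cis (real (k i) * t)"
  defines "a \<equiv> \<Sum>i\<in>{i\<in>I. k i = 0}. c i"
  assumes a: "Im a = 0"
  shows "2 * pi * cmod a powr p + integral {0..2*pi} (\<lambda>t. cmod (f t) powr p)
    \<le> 2 / (p - 1) * integral {0..2*pi} (\<lambda>t. \<bar>Re (f t)\<bar> powr p)"
proof -
  define q K where "q = p / 2" and "K = 2 / (p - 1)"
  have q: "q > 0" and K: "K \<ge> 2" using p by (auto simp: q_def K_def field_simps)
  have f_eq: "(\<Sum>i\<in>I. c i * exp (of_nat (k i) * (\<i> * of_real t))) = f t" for t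
    unfolding f_def by (intro sum.cong) (auto simp: cis_conv_exp mult_ac)
  have contf: "continuous_on A f" for A
    unfolding f_def by (intro continuous_intros)
  let ?J = "\<lambda>l m e. integral {0..2*pi} (\<lambda>t. (l * (Re (f t))\<^sup>2 + m * (Im (f t))\<^sup>2 + e) powr q)"
  have cJ: "continuous_on {0..1} (?J l m)" if "l \<ge> 0" "m \<ge> 0" for l m
    using continuous_on_quadratic_powr_param[OF q that contf] by simp
  have int: "(\<lambda>t. (l * (Re (f t))\<^sup>2 + m * (Im (f t))\<^sup>2 + e) powr q) integrable_on {0..2*pi}"
    if "l \<ge> 0" "m \<ge> 0" "e > 0" for l m e
    using q that by (intro integrable_continuous_real continuous_on_powr' continuous_intros contf)
      (auto intro!: add_nonneg_nonneg mult_nonneg_nonneg)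
  have main: "2 * pi * ((K - 1) * ((Re a)\<^sup>2 + e) powr q) \<le> K * ?J 1 0 e - ?J 1 1 e" if "0 < e" for e
  proof -
    note C2 = C2_data_lincomb[OF C2_data_quadratic_powr[of 1 0 e q] C2_data_quadratic_powr[of 1 1 e q], of K "-1"]
    have "2 * pi * (K * (1 * (Re a)\<^sup>2 + 0 * (Im a)\<^sup>2 + e) powr q + - 1 * (1 * (Re a)\<^sup>2 + 1 * (Im a)\<^sup>2 + e) powr q)
       \<le> integral {0..2*pi} (\<lambda>t. K * (1 * (Re (f t))\<^sup>2 + 0 * (Im (f t))\<^sup>2 + e) powr q
          + - 1 * (1 * (Re (f t))\<^sup>2 + 1 * (Im (f t))\<^sup>2 + e) powr q)"
      unfolding a_def f_eq[symmetric]
      apply (rule integral_mean_subharmonic[OF C2 _ I])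
      using that apply (simp_all)
      subgoal for z
        using subharmonic_laplacian_small[OF p that, of "(Re z)\<^sup>2" "(Im z)\<^sup>2"]
        by (simp add: K_def q_def algebra_simps)
      done
    also have "\<dots> = K * ?J 1 0 e - ?J 1 1 e"
      using integral_lincomb[OF int[of 1 0 e] int[of 1 1 e], of K "-1"] that by simp
    finally show ?thesis using a by (simp add: algebra_simps)
  qed
  have "2 * pi * ((K - 1) * ((Re a)\<^sup>2 + 0) powr q) \<le> K * ?J 1 0 0 - ?J 1 1 0"
    by (rule continuous_le_at_left_endpoint[where a=0 and b=1, OF _ _ _ main])
       (use q in \<open>auto intro!: continuous_intros cJ[simplified] continuous_on_powr'\<close>, use cJ[of 1 0] cJ[of 1 1] in auto)
  then have 1: "2 * pi * ((K - 1) * cmod a powr p) + integral {0..2*pi} (\<lambda>t. cmod (f t) powr p)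
    \<le> K * integral {0..2*pi} (\<lambda>t. \<bar>Re (f t)\<bar> powr p)"
    using a by (simp add: q_def cmod_power2[symmetric] cmod_square_powr_half square_powr_half cmod_eq_Re)
  have "1 * cmod a powr p \<le> (K - 1) * cmod a powr p"
    using K by (intro mult_right_mono) auto
  then have "2 * pi * cmod a powr p \<le> 2 * pi * ((K - 1) * cmod a powr p)"
    by (intro mult_left_mono) auto
  with 1 show ?thesis unfolding K_def[symmetric] by linarith
qed

text \<open>Mean value inequality for the regularised |z|^p - K |Im z|^p, whose limit at the real
  point \<open>a\<close> is |a|^p. What counts later is K = p / (p - 1) > 1: the imaginary part is
  bounded with a constant below 1.\<close>

lemma riesz_imaginary_part_large:
  fixes k :: "'i \<Rightarrow> nat" and c :: "'i \<Rightarrow> complex" and p :: real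
  assumes p: "2 \<le> p" and I: "finite I"
  defines "f \<equiv> \<lambda>t. \<Sum>i\<in>I. c i * cis (real (k i) * t)"
  defines "a \<equiv> \<Sum>i\<in>{i\<in>I. k i = 0}. c i"
  assumes a: "Im a = 0"
  shows "2 * pi * cmod a powr p + p / (p - 1) * integral {0..2*pi} (\<lambda>t. \<bar>Im (f t)\<bar> powr p)
    \<le> integral {0..2*pi} (\<lambda>t. cmod (f t) powr p)"
proof -
  define q K where "q = p / 2" and "K = p / (p - 1)"
  have q: "q > 0" using p by (auto simp: q_def)
  have f_eq: "(\<Sum>i\<in>I. c i * exp (of_nat (k i) * (\<i> * of_real t))) = f t" for t
    unfolding f_def by (intro sum.cong) (auto simp: cis_conv_exp mult_ac)
  have contf: "continuous_on A f" for A
    unfolding f_def by (intro continuous_intros)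
  let ?J = "\<lambda>l m e. integral {0..2*pi} (\<lambda>t. (l * (Re (f t))\<^sup>2 + m * (Im (f t))\<^sup>2 + e) powr q)"
  have cJ: "continuous_on {0..1} (?J l m)" if "l \<ge> 0" "m \<ge> 0" for l m
    using continuous_on_quadratic_powr_param[OF q that contf] by simp
  have int: "(\<lambda>t. (l * (Re (f t))\<^sup>2 + m * (Im (f t))\<^sup>2 + e) powr q) integrable_on {0..2*pi}"
    if "l \<ge> 0" "m \<ge> 0" "e > 0" for l m e
    using q that by (intro integrable_continuous_real continuous_on_powr' continuous_intros contf)
      (auto intro!: add_nonneg_nonneg mult_nonneg_nonneg)
  have main: "2 * pi * (((Re a)\<^sup>2 + e) powr q - K * e powr q) \<le> ?J 1 1 e - K * ?J 0 1 e" if "0 < e" for e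
  proof -
    note C2 = C2_data_lincomb[OF C2_data_quadratic_powr[of 1 1 e q] C2_data_quadratic_powr[of 0 1 e q], of 1 "-K"]
    have "2 * pi * (1 * (1 * (Re a)\<^sup>2 + 1 * (Im a)\<^sup>2 + e) powr q + - K * (0 * (Re a)\<^sup>2 + 1 * (Im a)\<^sup>2 + e) powr q)
       \<le> integral {0..2*pi} (\<lambda>t. 1 * (1 * (Re (f t))\<^sup>2 + 1 * (Im (f t))\<^sup>2 + e) powr q
          + - K * (0 * (Re (f t))\<^sup>2 + 1 * (Im (f t))\<^sup>2 + e) powr q)"
      unfolding a_def f_eq[symmetric]
      apply (rule integral_mean_subharmonic[OF C2 _ I])
      using that apply (simp_all)
      subgoal for z
        using subharmonic_laplacian_large[OF p that, of "(Re z)\<^sup>2" "(Im z)\<^sup>2"]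
        by (simp add: K_def q_def algebra_simps)
      done
    also have "\<dots> = ?J 1 1 e - K * ?J 0 1 e"
      using integral_lincomb[OF int[of 1 1 e] int[of 0 1 e], of 1 "-K"] that by simp
    finally show ?thesis using a by (simp add: algebra_simps)
  qed
  have "2 * pi * (((Re a)\<^sup>2 + 0) powr q - K * 0 powr q) \<le> ?J 1 1 0 - K * ?J 0 1 0"
    by (rule continuous_le_at_left_endpoint[where a=0 and b=1, OF _ _ _ main])
       (use q in \<open>auto intro!: continuous_intros cJ[simplified] continuous_on_powr'\<close>, use cJ[of 1 1] cJ[of 0 1] in auto)
  then show ?thesis
    using a by (simp add: q_def K_def cmod_power2[symmetric] cmod_square_powr_half square_powr_half cmod_eq_Re)
qed

text \<open>For p > 2 two inequalities are combined: \<open>A + K * V <= F\<close>, and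
  \<open>F <= \<kappa> * V + C * U\<close> with 1 < \<kappa> < K, where \<open>F\<close>,
  \<open>U\<close>, \<open>V\<close> integrate the p-th powers of |f|, |Re f|, |Im f| and
  \<open>A\<close> is the constant term. Eliminating \<open>V\<close> leaves a positive multiple of
  \<open>F\<close> on the left because \<kappa> < K.\<close>

lemma riesz_real_part:
  assumes p: "1 < (p :: real)"
  shows "\<exists>C\<ge>0. \<forall>(I :: 'i set) (k :: 'i \<Rightarrow> nat) c. finite I \<longrightarrow> Im (\<Sum>i\<in>{i\<in>I. k i = 0}. c i) = 0 \<longrightarrow>
    2 * pi * cmod (\<Sum>i\<in>{i\<in>I. k i = 0}. c i) powr p
      + integral {0..2*pi} (\<lambda>t. cmod (\<Sum>i\<in>I. c i * cis (real (k i) * t)) powr p)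
    \<le> C * integral {0..2*pi} (\<lambda>t. \<bar>Re (\<Sum>i\<in>I. c i * cis (real (k i) * t))\<bar> powr p)"
proof (cases "p \<le> 2")
  case True
  show ?thesis
    by (rule exI[of _ "2 / (p - 1)"]) (use riesz_real_part_small[OF p True] p in auto)
next
  case False
  then have p2: "2 \<le> p" by simp
  define K where "K = p / (p - 1)"
  define \<kappa> where "\<kappa> = (1 + K) / 2"
  have "K > 1" using p by (simp add: K_def)
  then have k: "\<kappa> > 1" "\<kappa> < K" by (auto simp: \<kappa>_def)
  then obtain C where C: "C \<ge> 0" "\<And>z. cmod z powr p \<le> \<kappa> * \<bar>Im z\<bar> powr p + C * \<bar>Re z\<bar> powr p"
    using quadratic_powr_le[of p \<kappa>] p by auto
  \<comment> \<open>The smaller of the coefficients of \<open>F\<close> and \<open>A\<close> that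
    remain once \<open>V\<close> is eliminated.\<close>
  define \<delta> where "\<delta> = min (1 - \<kappa> / K) (\<kappa> / K)"
  have \<delta>: "\<delta> > 0" using k by (simp add: \<delta>_def)
  have "2 * pi * cmod (\<Sum>i\<in>{i\<in>I. k i = 0}. c i) powr p
      + integral {0..2*pi} (\<lambda>t. cmod (\<Sum>i\<in>I. c i * cis (real (k i) * t)) powr p)
    \<le> C / \<delta> * integral {0..2*pi} (\<lambda>t. \<bar>Re (\<Sum>i\<in>I. c i * cis (real (k i) * t))\<bar> powr p)"
    if I: "finite I" and a: "Im (\<Sum>i\<in>{i\<in>I. k i = 0}. c i) = 0" for I :: "'i set" and k :: "'i \<Rightarrow> nat" and c
  proof -
    define f where "f = (\<lambda>t. \<Sum>i\<in>I. c i * cis (real (k i) * t))"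
    define A where "A = 2 * pi * cmod (\<Sum>i\<in>{i\<in>I. k i = 0}. c i) powr p"
    define F where "F = integral {0..2*pi} (\<lambda>t. cmod (f t) powr p)"
    define U where "U = integral {0..2*pi} (\<lambda>t. \<bar>Re (f t)\<bar> powr p)"
    define V where "V = integral {0..2*pi} (\<lambda>t. \<bar>Im (f t)\<bar> powr p)"
    have contf: "continuous_on A f" for A
      unfolding f_def by (intro continuous_intros)
    have int: "(\<lambda>t. \<bar>Re (f t)\<bar> powr p) integrable_on {0..2*pi}" "(\<lambda>t. \<bar>Im (f t)\<bar> powr p) integrable_on {0..2*pi}"
      "(\<lambda>t. cmod (f t) powr p) integrable_on {0..2*pi}"
      using p by (intro integrable_continuous_real continuous_on_powr' continuous_intros contf; simp)+
    have 1: "A + K * V \<le> F"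
      using riesz_imaginary_part_large[OF p2 I a] by (simp add: A_def K_def V_def F_def f_def)
    have "F \<le> integral {0..2*pi} (\<lambda>t. \<kappa> * \<bar>Im (f t)\<bar> powr p + C * \<bar>Re (f t)\<bar> powr p)"
      unfolding F_def by (intro integral_le C(2) int integrable_add integrable_on_mult_right)
    also have "\<dots> = \<kappa> * V + C * U"
      unfolding U_def V_def by (subst integral_add) (auto intro!: int integrable_on_mult_right)
    finally have 2: "F \<le> \<kappa> * V + C * U" .
    have A: "0 \<le> A" by (simp add: A_def)
    have F: "0 \<le> F" unfolding F_def by (intro integral_nonneg int) auto
    have V: "V \<le> (F - A) / K" using 1 \<open>K > 1\<close> by (simp add: field_simps)
    have "\<kappa> * V \<le> \<kappa> * ((F - A) / K)" using V \<open>\<kappa> > 1\<close> by (intro mult_left_mono) auto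
    also have "\<kappa> * ((F - A) / K) = \<kappa> / K * F - \<kappa> / K * A"
      by (simp add: right_diff_distrib diff_divide_distrib)
    finally have "F \<le> (\<kappa> / K * F - \<kappa> / K * A) + C * U" using 2 by linarith
    moreover have "(1 - \<kappa> / K) * F + \<kappa> / K * A = F - (\<kappa> / K * F - \<kappa> / K * A)"
      by (simp add: left_diff_distrib)
    ultimately have "(1 - \<kappa> / K) * F + \<kappa> / K * A \<le> C * U"
      by (metis add.commute diff_le_eq)
    moreover have "\<delta> * F \<le> (1 - \<kappa> / K) * F" "\<delta> * A \<le> \<kappa> / K * A"
      by (rule mult_right_mono[OF _ F], simp add: \<delta>_def) (rule mult_right_mono[OF _ A], simp add: \<delta>_def)
    ultimately have "\<delta> * (A + F) \<le> C * U" by (simp add: distrib_left)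
    then have "A + F \<le> C / \<delta> * U" using \<delta> by (simp add: field_simps)
    then show ?thesis by (simp add: A_def F_def U_def f_def)
  qed
  then show ?thesis using C(1) \<delta> by (intro exI[of _ "C / \<delta>"]) auto
qed

lemma continuous_on_norm_powr:
  fixes g :: "'a::topological_space \<Rightarrow> 'b::real_normed_vector"
  assumes "continuous_on S g" "p > 0"
  shows "continuous_on S (\<lambda>t. norm (g t) powr p)"
  by (intro continuous_on_powr' continuous_on_norm continuous_on_const assms ballI) (use assms in auto)

lemma integrable_norm_powr:
  fixes g :: "'a::euclidean_space \<Rightarrow> 'b::real_normed_vector"
  assumes "continuous_on (cbox a b) g" "p > 0"
  shows "(\<lambda>t. norm (g t) powr p) integrable_on cbox a b"
  by (intro integrable_continuous continuous_on_norm_powr assms)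

lemma norm_add4_powr_le:
  assumes "p > 0"
  shows "cmod (a + b + c + d) powr p \<le> 4 powr p * (cmod a powr p + cmod b powr p + cmod c powr p + cmod d powr p)"
proof -
  define M where "M = max (max (cmod a) (cmod b)) (max (cmod c) (cmod d))"
  have M: "cmod a \<le> M" "cmod b \<le> M" "cmod c \<le> M" "cmod d \<le> M" by (auto simp: M_def)
  have "cmod (a + b + c + d) \<le> cmod a + cmod b + cmod c + cmod d"
    using norm_triangle_ineq[of "a + b + c" d] norm_triangle_ineq[of "a + b" c] norm_triangle_ineq[of a b]
    by linarith
  also have "\<dots> \<le> 4 * M" using M by simp
  finally have "cmod (a + b + c + d) powr p \<le> (4 * M) powr p"
    using assms by (intro powr_mono2) auto
  also have "\<dots> = 4 powr p * M powr p" by (simp add: M_def powr_mult max_def)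
  also have "M powr p \<le> cmod a powr p + cmod b powr p + cmod c powr p + cmod d powr p"
  proof -
    have "M = cmod a \<or> M = cmod b \<or> M = cmod c \<or> M = cmod d" by (auto simp: M_def max_def)
    moreover have "0 \<le> cmod x powr p" for x by simp
    ultimately show ?thesis by (smt (verit))
  qed
  finally show ?thesis by simp
qed

definition powr_int :: "real \<Rightarrow> (real \<Rightarrow> complex) \<Rightarrow> real" where
  "powr_int p g = integral {0..2*pi} (\<lambda>t. cmod (g t) powr p)"

text \<open>Replacing P by the polynomial with nonnegative frequencies and the same real part is
  only a real-linear operation. Applied to P and to -iP and recombined, it isolates the part
  \<open>A\<close> of P, up to the constant term, whose real and imaginary parts are controlled by
  the extra term in \<open>riesz_real_part\<close>.\<close>

lemma riesz_halfline_nonneg: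
  assumes p: "1 < (p :: real)"
  shows "\<exists>C\<ge>0. \<forall>(I :: 'i set) (k :: 'i \<Rightarrow> int) c. finite I \<longrightarrow>
    powr_int p (\<lambda>t::real. \<Sum>i\<in>{i\<in>I. 0 \<le> k i}. c i * cis (of_int (k i) * t)) \<le> C * powr_int p (\<lambda>t::real. \<Sum>i\<in>I. c i * cis (of_int (k i) * t))"
proof -
  from riesz_real_part[OF p] obtain C where C: "C \<ge> 0"
    and R: "\<And>(I :: 'i set) (k :: 'i \<Rightarrow> nat) c. finite I \<Longrightarrow> Im (\<Sum>i\<in>{i\<in>I. k i = 0}. c i) = 0 \<Longrightarrow>
    2 * pi * cmod (\<Sum>i\<in>{i\<in>I. k i = 0}. c i) powr p
      + integral {0..2*pi} (\<lambda>t. cmod (\<Sum>i\<in>I. c i * cis (real (k i) * t)) powr p)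
    \<le> C * integral {0..2*pi} (\<lambda>t. \<bar>Re (\<Sum>i\<in>I. c i * cis (real (k i) * t))\<bar> powr p)"
    by blast
  have "powr_int p (\<lambda>t::real. \<Sum>i\<in>{i\<in>I. 0 \<le> k i}. c i * cis (of_int (k i) * t))
     \<le> 4 powr p * (2 * C) * powr_int p (\<lambda>t::real. \<Sum>i\<in>I. c i * cis (of_int (k i) * t))"
    if I: "finite I" for I :: "'i set" and k :: "'i \<Rightarrow> int" and c
  proof -
    define P where "P = (\<lambda>t::real. \<Sum>i\<in>I. c i * cis (of_int (k i) * t))"
    define A where "A = (\<lambda>t::real. \<Sum>i\<in>{i\<in>I. 0 \<le> k i}. c i * cis (of_int (k i) * t))"
    define B where "B = (\<lambda>t::real. \<Sum>i\<in>{i\<in>I. k i < 0}. c i * cis (of_int (k i) * t))"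
    define a where "a = (\<Sum>i\<in>{i\<in>I. k i = 0}. c i)"
    \<comment> \<open>\<open>F w\<close> has only nonnegative frequencies, real part \<open>Re (w P)\<close>, and a real constant term.\<close>
    define d where "d = (\<lambda>w i. if k i < 0 then cnj (w * c i) else if k i = 0 then of_real (Re (w * c i)) else w * c i)"
    define n where "n = (\<lambda>i. nat \<bar>k i\<bar>)"
    define F where "F = (\<lambda>w t. \<Sum>i\<in>I. d w i * cis (real (n i) * t))"
    have contP: "continuous_on S P" and contF: "continuous_on S (F w)" and contA: "continuous_on S A" for w S
      unfolding P_def F_def A_def by (intro continuous_intros)+
    have F: "F w t = w * A t - \<i> * of_real (Im (w * a)) + cnj (w * B t)" for w and t :: real
    proof -
      have "F w t = (\<Sum>i\<in>I. (if 0 \<le> k i then w * (c i * cis (of_int (k i) * t)) else 0)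
        - (if k i = 0 then \<i> * of_real (Im (w * c i)) else 0)
        + (if k i < 0 then cnj (w * (c i * cis (of_int (k i) * t))) else 0))"
        unfolding F_def
      proof (intro sum.cong refl)
        fix i
        show "d w i * cis (real (n i) * t) = (if 0 \<le> k i then w * (c i * cis (of_int (k i) * t)) else 0)
          - (if k i = 0 then \<i> * of_real (Im (w * c i)) else 0)
          + (if k i < 0 then cnj (w * (c i * cis (of_int (k i) * t))) else 0)"
        proof (cases "k i" "0 :: int" rule: linorder_cases)
          case less
          then show ?thesis by (simp add: d_def n_def cis_cnj)
        next
          case equal
          then show ?thesis by (simp add: d_def n_def complex_eq_iff)
        next
          case greater
          then show ?thesis by (simp add: d_def n_def)
        qed
      qed
      also have "\<dots> = w * A t - \<i> * of_real (Im (w * a)) + cnj (w * B t)"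
      proof -
        have "w * A t = (\<Sum>i\<in>I. if 0 \<le> k i then w * (c i * cis (of_int (k i) * t)) else 0)"
          unfolding A_def sum_distrib_left using I by (rule sum.inter_filter)
        moreover have "cnj (w * B t) = (\<Sum>i\<in>I. if k i < 0 then cnj (w * (c i * cis (of_int (k i) * t))) else 0)"
          unfolding B_def sum_distrib_left cnj_sum using I by (rule sum.inter_filter)
        moreover have "\<i> * of_real (Im (w * a)) = (\<Sum>i\<in>I. if k i = 0 then \<i> * of_real (Im (w * c i)) else 0)"
          unfolding a_def sum_distrib_left Im_sum of_real_sum using I by (rule sum.inter_filter)
        ultimately show ?thesis by (simp only: sum.distrib sum_subtractf)
      qed
      finally show ?thesis .
    qed
    have P: "P t = A t + B t" for t
    proof -
      have "I = {i\<in>I. 0 \<le> k i} \<union> {i\<in>I. k i < 0}" by auto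
      then have "P t = sum (\<lambda>i. c i * cis (of_int (k i) * t)) ({i\<in>I. 0 \<le> k i} \<union> {i\<in>I. k i < 0})"
        unfolding P_def by simp
      also have "\<dots> = A t + B t"
        unfolding A_def B_def using I by (intro sum.union_disjoint) auto
      finally show ?thesis .
    qed
    have ReF: "Re (F w t) = Re (w * P t)" for w and t :: real
      unfolding F P by (simp add: algebra_simps)
    have d0: "(\<Sum>i\<in>{i\<in>I. n i = 0}. d w i) = of_real (Re (w * a))" for w
      unfolding a_def sum_distrib_left Re_sum of_real_sum
      by (intro sum.cong) (auto simp: n_def d_def)
    have bound: "2 * pi * \<bar>Re (w * a)\<bar> powr p + powr_int p (F w) \<le> C * powr_int p P" if "cmod w = 1" for w
    proof -
      have "2 * pi * \<bar>Re (w * a)\<bar> powr p + powr_int p (F w)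
        \<le> C * integral {0..2*pi} (\<lambda>t. \<bar>Re (F w t)\<bar> powr p)"
      proof -
        have "Im (\<Sum>i\<in>{i\<in>I. n i = 0}. d w i) = 0" unfolding d0 by simp
        from R[OF I this] show ?thesis unfolding d0 norm_of_real powr_int_def F_def .
      qed
      moreover have "integral {0..2*pi} (\<lambda>t. \<bar>Re (F w t)\<bar> powr p) \<le> powr_int p P"
        unfolding powr_int_def
      proof (intro integral_le)
        show "\<bar>Re (F w t)\<bar> powr p \<le> cmod (P t) powr p" for t
          unfolding ReF using abs_Re_le_cmod[of "w * P t"] that p
          by (intro powr_mono2) (auto simp: norm_mult)
        show "(\<lambda>t. \<bar>Re (F w t)\<bar> powr p) integrable_on {0..2*pi}"
          using integrable_norm_powr[of 0 "2*pi" "\<lambda>t. Re (F w t)" p] p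
          by (simp add: continuous_on_Re contF)
        show "(\<lambda>t. cmod (P t) powr p) integrable_on {0..2*pi}"
          using integrable_norm_powr[of 0 "2*pi" P p] p by (simp add: contP)
      qed
      then have "C * integral {0..2*pi} (\<lambda>t. \<bar>Re (F w t)\<bar> powr p) \<le> C * powr_int p P"
        using C by (rule mult_left_mono)
      ultimately show ?thesis by linarith
    qed
    \<comment> \<open>The conjugates of \<open>B t\<close> enter with opposite signs and
      cancel.\<close>
    have A2: "2 * A t = F 1 t + \<i> * F (-\<i>) t + of_real (Re a) + \<i> * of_real (Im a)" for t
      unfolding F by (simp add: algebra_simps complex_eq_iff)
    have pw: "cmod (A t) powr p \<le> 4 powr p * (cmod (F 1 t) powr p + cmod (F (-\<i>) t) powr p
        + (\<bar>Re a\<bar> powr p + \<bar>Im a\<bar> powr p))" for t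
    proof -
      have "cmod (A t) powr p \<le> cmod (2 * A t) powr p"
        using p by (intro powr_mono2) (auto simp: norm_mult)
      also have "\<dots> \<le> 4 powr p * (cmod (F 1 t) powr p + cmod (\<i> * F (-\<i>) t) powr p
        + cmod (of_real (Re a)) powr p + cmod (\<i> * of_real (Im a)) powr p)"
        unfolding A2 using p by (intro norm_add4_powr_le) simp
      finally show ?thesis by (simp add: norm_mult add.assoc)
    qed
    have i: "(\<lambda>t. cmod (F w t) powr p) integrable_on {0..2*pi}" for w
      using integrable_norm_powr[of 0 "2*pi" "F w" p] p by (simp add: contF)
    have iA: "(\<lambda>t. cmod (A t) powr p) integrable_on {0..2*pi}"
      using integrable_norm_powr[of 0 "2*pi" A p] p by (simp add: contA)
    have "powr_int p A \<le> integral {0..2*pi} (\<lambda>t. 4 powr p * (cmod (F 1 t) powr p + cmod (F (-\<i>) t) powr p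
        + (\<bar>Re a\<bar> powr p + \<bar>Im a\<bar> powr p)))"
      unfolding powr_int_def
      by (intro integral_le iA pw integrable_on_mult_right integrable_add i integrable_const_ivl)
    also have "\<dots> = 4 powr p * (powr_int p (F 1) + powr_int p (F (-\<i>)) + 2 * pi * (\<bar>Re a\<bar> powr p + \<bar>Im a\<bar> powr p))"
      unfolding powr_int_def integral_mult_right
      by (simp add: integral_add i integrable_add integrable_const_ivl)
    also have "\<dots> \<le> 4 powr p * (2 * C * powr_int p P)"
    proof (rule mult_left_mono)
      have "2 * pi * \<bar>Re a\<bar> powr p + powr_int p (F 1) \<le> C * powr_int p P"
        using bound[of 1] by simp
      moreover have "2 * pi * \<bar>Im a\<bar> powr p + powr_int p (F (-\<i>)) \<le> C * powr_int p P"
        using bound[of "-\<i>"] by simp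
      ultimately show "powr_int p (F 1) + powr_int p (F (-\<i>)) + 2 * pi * (\<bar>Re a\<bar> powr p + \<bar>Im a\<bar> powr p)
        \<le> 2 * C * powr_int p P"
        unfolding distrib_left by linarith
    qed simp
    finally show ?thesis by (simp add: A_def P_def mult.assoc)
  qed
  then show ?thesis using C by (intro exI[of _ "4 powr p * (2 * C)"]) simp
qed

text \<open>Multiplication by \<open>cis (- j t)\<close>, of modulus 1, shifts the half line to the
  nonnegative one, so one \<open>C\<close> serves every \<open>j\<close>.\<close>

lemma riesz_halfline:
  assumes p: "1 < (p :: real)"
  shows "\<exists>C\<ge>0. \<forall>(I :: 'i set) (k :: 'i \<Rightarrow> int) c (j :: int). finite I \<longrightarrow>
    powr_int p (\<lambda>t::real. \<Sum>i\<in>{i\<in>I. j \<le> k i}. c i * cis (of_int (k i) * t)) \<le> C * powr_int p (\<lambda>t::real. \<Sum>i\<in>I. c i * cis (of_int (k i) * t))"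
proof -
  from riesz_halfline_nonneg[OF p] obtain C where C: "C \<ge> 0"
    and R: "\<And>(I :: 'i set) (k :: 'i \<Rightarrow> int) c. finite I \<Longrightarrow>
      powr_int p (\<lambda>t::real. \<Sum>i\<in>{i\<in>I. 0 \<le> k i}. c i * cis (of_int (k i) * t)) \<le> C * powr_int p (\<lambda>t::real. \<Sum>i\<in>I. c i * cis (of_int (k i) * t))"
    by blast
  have shift: "powr_int p (\<lambda>t::real. \<Sum>i\<in>J. c i * cis (of_int (k i - j) * t)) = powr_int p (\<lambda>t::real. \<Sum>i\<in>J. c i * cis (of_int (k i) * t))"
    for J :: "'i set" and k :: "'i \<Rightarrow> int" and c and j :: int
  proof -
    have "(\<Sum>i\<in>J. c i * cis (of_int (k i - j) * t)) = cis (- of_int j * t) * (\<Sum>i\<in>J. c i * cis (of_int (k i) * t))" for t :: real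
      unfolding sum_distrib_left
      by (intro sum.cong) (auto simp: cis_mult algebra_simps)
    then show ?thesis by (simp add: powr_int_def norm_mult)
  qed
  have "powr_int p (\<lambda>t::real. \<Sum>i\<in>{i\<in>I. j \<le> k i}. c i * cis (of_int (k i) * t)) \<le> C * powr_int p (\<lambda>t::real. \<Sum>i\<in>I. c i * cis (of_int (k i) * t))"
    if "finite I" for I :: "'i set" and k :: "'i \<Rightarrow> int" and c and j :: int
    using R[OF that, of c "\<lambda>i. k i - j"] unfolding shift diff_ge_0_iff_ge .
  then show ?thesis using C by blast
qed

section \<open>Truncation to a hexagon of frequencies on the torus\<close>

text \<open>A strip is the intersection of two half lines. Conjugation negates the frequencies and
  keeps the modulus, so it turns the upper bound into a lower one.\<close>

lemma riesz_strip:
  assumes p: "1 < (p :: real)"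
  shows "\<exists>C\<ge>0. \<forall>(I :: 'i set) (k :: 'i \<Rightarrow> int) c (N :: int). finite I \<longrightarrow>
    powr_int p (\<lambda>t. \<Sum>i\<in>{i\<in>I. \<bar>k i\<bar> \<le> N}. c i * cis (of_int (k i) * t))
      \<le> C * powr_int p (\<lambda>t. \<Sum>i\<in>I. c i * cis (of_int (k i) * t))"
proof -
  from riesz_halfline[OF p] obtain C where C: "C \<ge> 0"
    and R: "\<And>(I :: 'i set) (k :: 'i \<Rightarrow> int) c (j :: int). finite I \<Longrightarrow>
      powr_int p (\<lambda>t. \<Sum>i\<in>{i\<in>I. j \<le> k i}. c i * cis (of_int (k i) * t))
      \<le> C * powr_int p (\<lambda>t. \<Sum>i\<in>I. c i * cis (of_int (k i) * t))"
    by blast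
  have "powr_int p (\<lambda>t. \<Sum>i\<in>{i\<in>I. \<bar>k i\<bar> \<le> N}. c i * cis (of_int (k i) * t))
      \<le> C * C * powr_int p (\<lambda>t. \<Sum>i\<in>I. c i * cis (of_int (k i) * t))"
    if I: "finite I" for I :: "'i set" and k :: "'i \<Rightarrow> int" and c and N :: int
  proof -
    have conj: "powr_int p (\<lambda>t. \<Sum>i\<in>J. cnj (c i) * cis (of_int (- k i) * t))
        = powr_int p (\<lambda>t. \<Sum>i\<in>J. c i * cis (of_int (k i) * t))" for J
    proof -
      have "(\<Sum>i\<in>J. cnj (c i) * cis (of_int (- k i) * t)) = cnj (\<Sum>i\<in>J. c i * cis (of_int (k i) * t))" for t
        by (simp add: cnj_sum cis_cnj)
      then show ?thesis by (simp only: powr_int_def complex_mod_cnj)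
    qed
    have set: "{i\<in>I. \<bar>k i\<bar> \<le> N} = {i\<in>{i\<in>I. - N \<le> k i}. - N \<le> - k i}" by auto
    have "powr_int p (\<lambda>t. \<Sum>i\<in>{i\<in>I. \<bar>k i\<bar> \<le> N}. c i * cis (of_int (k i) * t))
       \<le> C * powr_int p (\<lambda>t. \<Sum>i\<in>{i\<in>I. - N \<le> k i}. cnj (c i) * cis (of_int (- k i) * t))"
      unfolding conj[symmetric] set by (rule R) (use I in auto)
    also have "\<dots> \<le> C * (C * powr_int p (\<lambda>t. \<Sum>i\<in>I. c i * cis (of_int (k i) * t)))"
      unfolding conj using C I by (intro mult_left_mono R)
    finally show ?thesis by (simp add: mult.assoc)
  qed
  then show ?thesis using C by (intro exI[of _ "C * C"]) simp
qed

lemma integral_periodic_shift: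
  fixes \<phi> :: "real \<Rightarrow> 'a::euclidean_space"
  assumes cont: "continuous_on UNIV \<phi>" and per: "\<And>y. \<phi> (y + T) = \<phi> y" and b: "0 \<le> b" "b \<le> T"
  shows "integral {0..T} (\<lambda>y. \<phi> (y + b)) = integral {0..T} \<phi>"
proof -
  have int: "\<phi> integrable_on {u..v}" for u v
    by (intro integrable_continuous_real continuous_on_subset[OF cont]) auto
  have sh: "integral {u..v} (\<lambda>y. \<phi> (y + w)) = integral {u + w..v + w} \<phi>" for u v w
    using integral_shift_cbox_plus[of u v \<phi> w] by (simp add: o_def add.commute)
  have "integral {0..T} (\<lambda>y. \<phi> (y + b)) = integral {b..T + b} \<phi>"
    using sh[of 0 T b] by simp
  also have "\<dots> = integral {b..T} \<phi> + integral {T..T + b} \<phi>"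
    using b by (intro Henstock_Kurzweil_Integration.integral_combine[symmetric] int) auto
  also have "integral {T..T + b} \<phi> = integral {0..b} \<phi>"
    using sh[of 0 b T] by (simp add: per add.commute)
  also have "integral {b..T} \<phi> + integral {0..b} \<phi> = integral {0..T} \<phi>"
    using b by (subst add.commute) (intro Henstock_Kurzweil_Integration.integral_combine int; simp)
  finally show ?thesis .
qed

definition powr_int2 :: "real \<Rightarrow> (real \<Rightarrow> real \<Rightarrow> complex) \<Rightarrow> real" where
  "powr_int2 p g = integral {0..2*pi} (\<lambda>x. powr_int p (g x))"

text \<open>Frequencies are attached to arbitrary indices and may coincide, so the exponentials in a
  sum of modes can be indexed by their origin without collecting equal ones.\<close>

definition trig_poly2 :: "'i set \<Rightarrow> ('i \<Rightarrow> complex) \<Rightarrow> ('i \<Rightarrow> int) \<Rightarrow> ('i \<Rightarrow> int) \<Rightarrow> real \<Rightarrow> real \<Rightarrow> complex" where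
  "trig_poly2 I c m n x y = (\<Sum>i\<in>I. c i * cis (of_int (m i) * x + of_int (n i) * y))"

lemma continuous_on_trig_poly2 [continuous_intros]:
  "continuous_on S f \<Longrightarrow> continuous_on S g \<Longrightarrow> continuous_on S (\<lambda>z. trig_poly2 I c m n (f z) (g z))"
  unfolding trig_poly2_def by (intro continuous_intros)

lemma continuous_on_powr_int:
  assumes "p > 0" "continuous_on ({a..b} \<times> {0..2*pi}) (\<lambda>(x, y). g x y)"
  shows "continuous_on {a..b} (\<lambda>x. powr_int p (g x))"
proof -
  have "continuous_on ({a..b} \<times> cbox 0 (2*pi)) (\<lambda>(x, y). cmod (g x y) powr p)"
    using continuous_on_norm_powr[OF assms(2,1)] by (simp add: case_prod_unfold)
  from integral_continuous_on_param[OF this] show ?thesis by (simp add: powr_int_def)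
qed

lemma trig_poly2_integrable:
  assumes "p > 0"
  shows "(\<lambda>x. powr_int p (trig_poly2 I c m n x)) integrable_on {0..2*pi}"
  unfolding powr_int_def[symmetric] using assms
  by (intro integrable_continuous_real continuous_on_powr_int)
     (auto simp: case_prod_unfold intro!: continuous_intros)

lemma powr_int2_swap:
  assumes "p > 0"
  shows "powr_int2 p (\<lambda>y x. trig_poly2 I c m n x y) = powr_int2 p (trig_poly2 I c m n)"
  unfolding powr_int2_def powr_int_def cbox_interval[symmetric]
  by (rule integral_swap_continuous)
     (auto simp: case_prod_unfold intro!: continuous_on_norm_powr continuous_intros assms)

lemma trig_poly2_swap: "trig_poly2 I c n m y x = trig_poly2 I c m n x y"
  by (simp add: trig_poly2_def add.commute)

lemma cis_int_periodic: "cis (x + of_int k * (y + 2 * pi)) = cis (x + of_int k * y)"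
proof -
  have "cis (x + of_int k * (y + 2 * pi)) = cis (x + of_int k * y) * cis (2 * pi * of_int k)"
    by (simp add: cis_mult algebra_simps)
  then show ?thesis by (simp add: cis_multiple_2pi)
qed

text \<open>The substitution \<open>y \<mapsto> y + s x\<close>, which turns a strip in \<open>m + s n\<close> into one in \<open>m\<close>.\<close>

lemma powr_int2_shear:
  assumes p: "p > 0" and s: "s \<in> {1, -1 :: int}"
  shows "powr_int2 p (trig_poly2 I c (\<lambda>i. m i + s * n i) n) = powr_int2 p (trig_poly2 I c m n)"
  unfolding powr_int2_def
proof (rule Henstock_Kurzweil_Integration.integral_cong)
  fix x assume x: "x \<in> {0..2*pi}"
  \<comment> \<open>The shift s x, reduced modulo 2 pi into [0, 2 pi].\<close>
  define b where "b = (if s = 1 then x else 2 * pi - x)"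
  have per: "trig_poly2 I c m n x (y + 2 * pi) = trig_poly2 I c m n x y" for y
    unfolding trig_poly2_def cis_int_periodic ..
  have "trig_poly2 I c (\<lambda>i. m i + s * n i) n x y = trig_poly2 I c m n x (y + b)" for y
  proof -
    have "trig_poly2 I c (\<lambda>i. m i + s * n i) n x y = trig_poly2 I c m n x (y + s * x)"
      unfolding trig_poly2_def by (intro sum.cong refl) (simp add: algebra_simps)
    also have "\<dots> = trig_poly2 I c m n x (y + b)"
      using s per[of "y - x"] by (auto simp: b_def algebra_simps)
    finally show ?thesis .
  qed
  moreover have "integral {0..2*pi} (\<lambda>y. cmod (trig_poly2 I c m n x (y + b)) powr p)
    = integral {0..2*pi} (\<lambda>y. cmod (trig_poly2 I c m n x y) powr p)"
    by (rule integral_periodic_shift[where \<phi>="\<lambda>y. cmod (trig_poly2 I c m n x y) powr p"])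
       (use x p in \<open>auto simp: per b_def intro!: continuous_on_norm_powr continuous_intros\<close>)
  ultimately show "powr_int p (trig_poly2 I c (\<lambda>i. m i + s * n i) n x) = powr_int p (trig_poly2 I c m n x)"
    by (simp add: powr_int_def)
qed

text \<open>Three strips applied in turn. The strip in \<open>n\<close> acts in y for fixed x; the
  one in \<open>m\<close> follows by exchanging the variables, and those in m + n and m - n follow
  from it by a shear. Each costs the same factor, whatever \<open>N\<close> is.\<close>

lemma riesz_hexagon:
  assumes p: "1 < (p :: real)"
  shows "\<exists>C\<ge>0. \<forall>(I :: 'i set) c m n (N :: int). finite I \<longrightarrow>
    powr_int2 p (trig_poly2 {i\<in>I. \<bar>n i\<bar> \<le> N \<and> \<bar>m i + n i\<bar> \<le> 2 * N \<and> \<bar>m i - n i\<bar> \<le> 2 * N} c m n)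
      \<le> C * powr_int2 p (trig_poly2 I c m n)"
proof -
  have p0: "p > 0" using p by simp
  from riesz_strip[OF p] obtain C where C: "C \<ge> 0"
    and R: "\<And>(I :: 'i set) (k :: 'i \<Rightarrow> int) c (N :: int). finite I \<Longrightarrow>
      powr_int p (\<lambda>t. \<Sum>i\<in>{i\<in>I. \<bar>k i\<bar> \<le> N}. c i * cis (of_int (k i) * t))
      \<le> C * powr_int p (\<lambda>t. \<Sum>i\<in>I. c i * cis (of_int (k i) * t))"
    by blast
  have strip_n: "powr_int2 p (trig_poly2 {i\<in>I. \<bar>n i\<bar> \<le> N} c m n) \<le> C * powr_int2 p (trig_poly2 I c m n)"
    if I: "finite I" for I :: "'i set" and c m n N
  proof -
    have "powr_int2 p (trig_poly2 {i\<in>I. \<bar>n i\<bar> \<le> N} c m n)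
        \<le> integral {0..2*pi} (\<lambda>x. C * powr_int p (trig_poly2 I c m n x))"
      unfolding powr_int2_def
    proof (rule integral_le)
      fix x
      have e: "trig_poly2 J c m n x = (\<lambda>y. \<Sum>i\<in>J. (c i * cis (of_int (m i) * x)) * cis (of_int (n i) * y))" for J
        by (auto simp: trig_poly2_def cis_mult mult.assoc fun_eq_iff)
      show "powr_int p (trig_poly2 {i\<in>I. \<bar>n i\<bar> \<le> N} c m n x) \<le> C * powr_int p (trig_poly2 I c m n x)"
        unfolding e by (rule R[OF I])
    qed (intro trig_poly2_integrable integrable_on_mult_right p0)+
    then show ?thesis by (simp add: powr_int2_def)
  qed
  have strip_m: "powr_int2 p (trig_poly2 {i\<in>I. \<bar>m i\<bar> \<le> N} c m n) \<le> C * powr_int2 p (trig_poly2 I c m n)"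
    if I: "finite I" for I :: "'i set" and c m n N
    using strip_n[OF I, of m N c n] powr_int2_swap[OF p0, of _ c m n]
    by (simp add: trig_poly2_swap[of _ c n m, abs_def] cong: sum.cong)
  have strip_s: "powr_int2 p (trig_poly2 {i\<in>I. \<bar>m i + s * n i\<bar> \<le> N} c m n) \<le> C * powr_int2 p (trig_poly2 I c m n)"
    if "finite I" "s \<in> {1, -1}" for I :: "'i set" and c m n N s
    using strip_m[OF that(1), of "\<lambda>i. m i + s * n i" N c n]
    unfolding powr_int2_shear[OF p0 that(2)] .
  have "powr_int2 p (trig_poly2 {i\<in>I. \<bar>n i\<bar> \<le> N \<and> \<bar>m i + n i\<bar> \<le> 2 * N \<and> \<bar>m i - n i\<bar> \<le> 2 * N} c m n)
      \<le> C * C * C * powr_int2 p (trig_poly2 I c m n)"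
    if I: "finite I" for I :: "'i set" and c m n N
  proof -
    let ?J = "{i\<in>I. \<bar>n i\<bar> \<le> N}"
    let ?K = "{i\<in>?J. \<bar>m i + 1 * n i\<bar> \<le> 2 * N}"
    have set: "{i\<in>I. \<bar>n i\<bar> \<le> N \<and> \<bar>m i + n i\<bar> \<le> 2 * N \<and> \<bar>m i - n i\<bar> \<le> 2 * N}
      = {i\<in>?K. \<bar>m i + (-1) * n i\<bar> \<le> 2 * N}" by auto
    have "powr_int2 p (trig_poly2 {i\<in>?K. \<bar>m i + (-1) * n i\<bar> \<le> 2 * N} c m n) \<le> C * powr_int2 p (trig_poly2 ?K c m n)"
      by (rule strip_s) (use I in auto)
    also have "\<dots> \<le> C * (C * powr_int2 p (trig_poly2 ?J c m n))"
      by (intro mult_left_mono strip_s) (use I C in auto)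
    also have "\<dots> \<le> C * (C * (C * powr_int2 p (trig_poly2 I c m n)))"
      by (intro mult_left_mono strip_n) (use I C in auto)
    finally show ?thesis unfolding set by (simp add: mult.assoc)
  qed
  then show ?thesis using C by (intro exI[of _ "C * C * C"]) simp
qed

section \<open>Folding the torus onto the triangle\<close>

text \<open>Two one-dimensional substitutions joined by Fubini, as in Gaussian elimination: first in
  x with pivot \<open>a\<close>, then in y with the second pivot \<open>D\<close>. \<open>F\<close>
  is the integrand between the two.\<close>

lemma nn_integral_affine_plane:
  fixes a b c d e h :: real
  assumes f[measurable]: "f \<in> borel_measurable borel" and a: "a \<noteq> 0" and det: "a * d - b * c \<noteq> 0"
  shows "(\<integral>\<^sup>+z. f z \<partial>lborel) = ennreal \<bar>a * d - b * c\<bar> *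
    (\<integral>\<^sup>+z. f (a * fst z + b * snd z + e, c * fst z + d * snd z + h) \<partial>lborel)"
proof -
  define D where "D = d - b * c / a"
  have D: "D \<noteq> 0" using a det by (simp add: D_def field_simps)
  have aD: "\<bar>a * d - b * c\<bar> = \<bar>D\<bar> * \<bar>a\<bar>" using a by (simp add: D_def abs_mult[symmetric] field_simps)
  have fm: "(\<lambda>t. f (u t)) \<in> borel_measurable borel"
    if "continuous_on UNIV u" for u :: "'t::topological_space \<Rightarrow> real \<times> real"
    by (rule measurable_compose[OF borel_measurable_continuous_onI[OF that] f])
  have fm2: "(\<lambda>t. f (u t)) \<in> borel_measurable (lborel \<Otimes>\<^sub>M lborel)"
    if "continuous_on UNIV u" for u :: "real \<times> real \<Rightarrow> real \<times> real"
    using fm[OF that] by (simp add: lborel_prod)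
  define F where "F = (\<lambda>x y. f (x, (c / a) * x + D * y + (h - e * c / a)))"
  have 1: "(\<integral>\<^sup>+z. f (a * fst z + b * snd z + e, c * fst z + d * snd z + h) \<partial>lborel)
     = (\<integral>\<^sup>+y. \<integral>\<^sup>+x. f (a * x + b * y + e, c * x + d * y + h) \<partial>lborel \<partial>lborel)"
    unfolding lborel_prod[symmetric]
    by (subst lborel_pair.nn_integral_snd[symmetric])
       (auto simp: case_prod_unfold intro!: fm2 continuous_intros)
  have 2: "(\<integral>\<^sup>+y. \<integral>\<^sup>+x. F x y \<partial>lborel \<partial>lborel) = ennreal \<bar>a\<bar> *
    (\<integral>\<^sup>+y. \<integral>\<^sup>+x. f (a * x + b * y + e, c * x + d * y + h) \<partial>lborel \<partial>lborel)"
  proof -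
    have i: "(\<integral>\<^sup>+x. F x y \<partial>lborel)
       = ennreal \<bar>a\<bar> * (\<integral>\<^sup>+x. f (a * x + b * y + e, c * x + d * y + h) \<partial>lborel)" for y
    proof -
      have eq: "(c / a) * (b * y + e + a * x) + D * y + (h - e * c / a) = c * x + d * y + h" for x
        using a by (simp add: D_def field_simps)
      have "(\<lambda>x. f (x, (c / a) * x + D * y + (h - e * c / a))) \<in> borel_measurable borel"
        by (intro fm continuous_intros)
      from nn_integral_real_affine[OF this a, of "b * y + e"] show ?thesis
        unfolding eq F_def by (simp add: add_ac)
    qed
    show ?thesis unfolding i
      by (rule nn_integral_cmult, rule lborel.borel_measurable_nn_integral)
         (auto simp: case_prod_unfold intro!: fm2 continuous_intros)
  qed
  have 3: "(\<integral>\<^sup>+y. \<integral>\<^sup>+x. F x y \<partial>lborel \<partial>lborel) = (\<integral>\<^sup>+x. \<integral>\<^sup>+y. F x y \<partial>lborel \<partial>lborel)"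
  proof (rule lborel_pair.Fubini')
    have "continuous_on UNIV (\<lambda>z. (fst z, (c / a) * fst z + D * snd z + (h - e * c / a)))"
      by (intro continuous_intros)
    from fm2[OF this] show "case_prod F \<in> borel_measurable (lborel \<Otimes>\<^sub>M lborel)"
      by (simp add: F_def case_prod_unfold)
  qed
  have 4: "(\<integral>\<^sup>+x. \<integral>\<^sup>+y. f (x, y) \<partial>lborel \<partial>lborel) = ennreal \<bar>D\<bar> * (\<integral>\<^sup>+x. \<integral>\<^sup>+y. F x y \<partial>lborel \<partial>lborel)"
  proof -
    have i: "(\<integral>\<^sup>+y. f (x, y) \<partial>lborel) = ennreal \<bar>D\<bar> * (\<integral>\<^sup>+y. F x y \<partial>lborel)" for x
    proof -
      have "(\<lambda>y. f (x, y)) \<in> borel_measurable borel"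
        by (intro fm continuous_intros)
      from nn_integral_real_affine[OF this D, of "(c / a) * x + (h - e * c / a)"] show ?thesis
        by (simp add: add_ac F_def)
    qed
    have "continuous_on UNIV (\<lambda>z. (fst z, (c / a) * fst z + D * snd z + (h - e * c / a)))"
      by (intro continuous_intros)
    from fm2[OF this] have "case_prod F \<in> borel_measurable (lborel \<Otimes>\<^sub>M lborel)"
      by (simp add: F_def case_prod_unfold)
    then show ?thesis unfolding i
      by (intro nn_integral_cmult lborel.borel_measurable_nn_integral)
  qed
  have 5: "(\<integral>\<^sup>+x. \<integral>\<^sup>+y. f (x, y) \<partial>lborel \<partial>lborel) = (\<integral>\<^sup>+z. f z \<partial>lborel)"
    unfolding lborel_prod[symmetric] using fm2[of "\<lambda>z. z"]
    by (subst lborel.nn_integral_fst[symmetric]) (auto intro: continuous_on_id)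
  show ?thesis
    unfolding 5[symmetric] 4 3[symmetric] 2 1 aD by (simp add: ennreal_mult mult.assoc)
qed

lemma lborel_affine_plane:
  fixes a b c d e h :: real
  assumes a: "a \<noteq> 0" and det: "a * d - b * c \<noteq> 0"
  defines "g \<equiv> \<lambda>z. (a * fst z + b * snd z + e, c * fst z + d * snd z + h)"
  shows "lborel = density (distr lborel borel g) (\<lambda>_. ennreal \<bar>a * d - b * c\<bar>)"
proof (rule measure_eqI)
  have g[measurable]: "g \<in> borel_measurable borel"
    unfolding g_def by (intro borel_measurable_continuous_onI continuous_intros)
  fix A :: "(real \<times> real) set" assume "A \<in> sets lborel"
  then have A[measurable]: "A \<in> sets borel" by simp
  have "emeasure lborel A = (\<integral>\<^sup>+z. indicator A z \<partial>lborel)" by simp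
  also have "\<dots> = ennreal \<bar>a * d - b * c\<bar> * (\<integral>\<^sup>+z. indicator A (g z) \<partial>lborel)"
    unfolding g_def by (rule nn_integral_affine_plane[OF _ a det]) simp
  also have "(\<integral>\<^sup>+z. indicator A (g z) \<partial>lborel) = (\<integral>\<^sup>+z. indicator A z \<partial>distr lborel borel g)"
    by (rule nn_integral_distr[symmetric]) auto
  also have "ennreal \<bar>a * d - b * c\<bar> * \<dots> = emeasure (density (distr lborel borel g) (\<lambda>_. ennreal \<bar>a * d - b * c\<bar>)) A"
    by (simp add: emeasure_density nn_integral_cmult)
  finally show "emeasure lborel A = emeasure (density (distr lborel borel g) (\<lambda>_. ennreal \<bar>a * d - b * c\<bar>)) A" .
qed simp

lemma integral_affine_plane:
  fixes a b c d e h :: real and f :: "real \<times> real \<Rightarrow> real"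
  assumes a: "a \<noteq> 0" and det: "a * d - b * c \<noteq> 0" and f[measurable]: "f \<in> borel_measurable borel"
  defines "g \<equiv> \<lambda>z. (a * fst z + b * snd z + e, c * fst z + d * snd z + h)"
  shows "integral\<^sup>L lborel f = \<bar>a * d - b * c\<bar> * integral\<^sup>L lborel (\<lambda>z. f (g z))"
    and "integrable lborel f \<longleftrightarrow> integrable lborel (\<lambda>z. f (g z))"
proof -
  have g[measurable]: "g \<in> borel_measurable borel"
    unfolding g_def by (intro borel_measurable_continuous_onI continuous_intros)
  note L = lborel_affine_plane[OF a det, of e h, folded g_def]
  show "integral\<^sup>L lborel f = \<bar>a * d - b * c\<bar> * integral\<^sup>L lborel (\<lambda>z. f (g z))"
    by (subst L) (simp add: integral_density integral_distr)
  show "integrable lborel f \<longleftrightarrow> integrable lborel (\<lambda>z. f (g z))"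
    using det by (subst L) (simp add: integrable_density integrable_distr_eq)
qed

lemma AE_not_on_line:
  assumes "a \<noteq> 0 \<or> b \<noteq> (0 :: real)"
  shows "AE z in lborel. a * fst z + b * snd z \<noteq> c"
proof -
  have "negligible {z. (a, b) \<bullet> z = c}"
    using assms by (intro negligible_hyperplane) (auto simp: zero_prod_def)
  then have "{z. (a, b) \<bullet> z = c} \<in> null_sets lborel"
    by (simp add: negligible_iff_null_sets null_sets_completion_iff borel_closed closed_hyperplane)
  then show ?thesis
    by (rule AE_I'[of "{z. (a, b) \<bullet> z = c}"]) (auto simp: inner_prod_def)
qed

definition unimodular_affine :: "(real \<times> real \<Rightarrow> real \<times> real) \<Rightarrow> bool" where
  "unimodular_affine g \<longleftrightarrow> (\<exists>a b c d e h. a \<noteq> 0 \<and> \<bar>a * d - b * c\<bar> = 1 \<and>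
     (\<forall>x y. g (x, y) = (a * x + b * y + e, c * x + d * y + h)))"

lemma unimodular_affineI:
  assumes "\<And>x y. g (x, y) = (a * x + b * y + e, c * x + d * y + h)" "a \<noteq> 0" "\<bar>a * d - b * c\<bar> = 1"
  shows "unimodular_affine g"
  using assms unfolding unimodular_affine_def by blast

text \<open>Each preimage of \<open>B\<close> under a measure-preserving map that fixes f carries
  the same integral, and n such preimages tile \<open>A\<close> up to a null set.\<close>

lemma integral_fold_step:
  fixes f :: "real \<times> real \<Rightarrow> real" and g :: "nat \<Rightarrow> real \<times> real \<Rightarrow> real \<times> real"
  assumes aff: "\<And>i. i < n \<Longrightarrow> unimodular_affine (g i)"
    and inv: "\<And>i z. i < n \<Longrightarrow> f (g i z) = f z"
    and part: "AE z in lborel. (indicator A z :: real) = (\<Sum>i<n. indicator B (g i z))"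
    and [measurable]: "f \<in> borel_measurable borel" "A \<in> sets borel" "B \<in> sets borel"
    and int: "integrable lborel (\<lambda>z. indicator B z * f z)"
  shows "(\<integral>z. indicator A z * f z \<partial>lborel) = n * (\<integral>z. indicator B z * f z \<partial>lborel)"
    and "integrable lborel (\<lambda>z. indicator A z * f z)"
proof -
  have one: "integrable lborel (\<lambda>z. indicator B (g i z) * f z) \<and>
     (\<integral>z. indicator B (g i z) * f z \<partial>lborel) = (\<integral>z. indicator B z * f z \<partial>lborel)" if i: "i < n" for i
  proof -
    obtain a b c d e h where *: "a \<noteq> 0" "\<bar>a * d - b * c\<bar> = 1"
      "\<And>x y. g i (x, y) = (a * x + b * y + e, c * x + d * y + h)"
      using aff[OF i] unfolding unimodular_affine_def by blast
    have gi: "(\<lambda>z. (a * fst z + b * snd z + e, c * fst z + d * snd z + h)) = g i"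
      by (auto simp: *(3))
    from * have det: "a * d - b * c \<noteq> 0" by auto
    have m: "(\<lambda>z. indicator B z * f z) \<in> borel_measurable borel" by measurable
    note I = integral_affine_plane[OF *(1) det m, of e h, unfolded fun_cong[OF gi] *(2)]
    show ?thesis
      using I int by (simp add: inv[OF i])
  qed
  have ae: "AE z in lborel. indicator A z * f z = (\<Sum>i<n. indicator B (g i z) * f z)"
    using part by eventually_elim (simp add: sum_distrib_right)
  have m1: "(\<lambda>z. indicator A z * f z) \<in> borel_measurable lborel"
    by measurable
  have m2: "(\<lambda>z. \<Sum>i<n. indicator B (g i z) * f z) \<in> borel_measurable lborel"
  proof (rule borel_measurable_sum)
    fix i assume "i \<in> {..<n}"
    then show "(\<lambda>z. indicator B (g i z) * f z) \<in> borel_measurable lborel"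
      using one[of i] borel_measurable_integrable by blast
  qed
  have "(\<integral>z. indicator A z * f z \<partial>lborel) = (\<integral>z. (\<Sum>i<n. indicator B (g i z) * f z) \<partial>lborel)"
    by (rule integral_cong_AE[OF m1 m2 ae])
  also have "\<dots> = n * (\<integral>z. indicator B z * f z \<partial>lborel)"
    using one by (subst Bochner_Integration.integral_sum) auto
  finally show "(\<integral>z. indicator A z * f z \<partial>lborel) = n * (\<integral>z. indicator B z * f z \<partial>lborel)" .
  show "integrable lborel (\<lambda>z. indicator A z * f z)"
    unfolding integrable_cong_AE[OF m1 m2 ae] using one by (intro Bochner_Integration.integrable_sum) auto
qed

text \<open>The image of the triangle under \<open>tri_coord\<close>, with corners (0, 0), (0, pi)
  and (pi/3, pi); the hypotenuse lies on the line y = 3 x.\<close>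

definition chamber :: "(real \<times> real) set" where
  "chamber = {z. 0 \<le> fst z \<and> 3 * fst z \<le> snd z \<and> snd z \<le> pi}"

lemma compact_chamber: "compact chamber"
proof -
  have "chamber \<subseteq> cbox (0, 0) (pi, pi)"
    by (auto simp: chamber_def)
  moreover have "closed chamber"
    unfolding chamber_def by (intro closed_Collect_conj closed_Collect_le continuous_intros)
  ultimately show ?thesis
    by (meson bounded_cbox bounded_subset compact_eq_bounded_closed)
qed

text \<open>24 = 3 * 2 * 4. The lines y = 3 x and 3 x + y = 2 pi cut the triangle \<open>H\<close>
  into three copies of the chamber, the half turn about (pi/2, pi/2) joins two copies of
  \<open>H\<close> to the square \<open>Q\<close>, and the reflections in x = pi and y = pi extend
  \<open>Q\<close> to the whole torus. The map \<open>?r3\<close> is \<open>?r2\<close> followed by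
  the reflection in y = pi.\<close>

lemma integral_cbox_eq_chamber:
  fixes f :: "real \<times> real \<Rightarrow> real"
  assumes cont: "continuous_on UNIV f"
    and inv: "\<And>x y. f (2 * pi - x, y) = f (x, y)" "\<And>x y. f (x, 2 * pi - y) = f (x, y)"
      "\<And>x y. f (pi - x, pi - y) = f (x, y)" "\<And>x y. f ((y - x) / 2, (3 * x + y) / 2) = f (x, y)"
  shows "integral (cbox (0, 0) (2*pi, 2*pi)) f = 24 * (\<integral>z. indicator chamber z * f z \<partial>lborel)"
proof -
  have fm[measurable]: "f \<in> borel_measurable borel"
    using cont by (rule borel_measurable_continuous_onI)
  define H where "H = {z :: real \<times> real. 0 \<le> fst z \<and> fst z \<le> snd z \<and> snd z \<le> pi}"
  define Q where "Q = cbox (0, 0) (pi, pi)"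
  define W where "W = cbox (0, 0) (2*pi, 2*pi)"
  have [measurable]: "H \<in> sets borel" "chamber \<in> sets borel" "Q \<in> sets borel" "W \<in> sets borel"
  proof -
    have "closed H"
      unfolding H_def by (intro closed_Collect_conj closed_Collect_le continuous_intros)
    then show "H \<in> sets borel" by (rule borel_closed)
    show "chamber \<in> sets borel" by (rule borel_closed[OF compact_imp_closed[OF compact_chamber]])
  qed (simp_all add: Q_def W_def)
  have int0: "integrable lborel (\<lambda>z. indicator chamber z * f z)"
    using borel_integrable_compact[OF compact_chamber continuous_on_subset[OF cont]]
    by simp
  let ?r2 = "\<lambda>(x, y). ((y - x) / 2, (3 * x + y) / 2) :: real \<times> real"
  let ?r3 = "\<lambda>(x, y). ((y - x) / 2, 2 * pi - (3 * x + y) / 2) :: real \<times> real"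
  let ?i = "\<lambda>z. z :: real \<times> real"
  let ?p = "\<lambda>(x, y). (pi - x, pi - y) :: real \<times> real"
  let ?x = "\<lambda>(x, y). (2*pi - x, y) :: real \<times> real"
  let ?y = "\<lambda>(x, y). (x, 2*pi - y) :: real \<times> real"
  let ?xy = "\<lambda>(x, y). (2*pi - x, 2*pi - y) :: real \<times> real"
  have aff: "unimodular_affine ?i" "unimodular_affine ?r2" "unimodular_affine ?r3" "unimodular_affine ?p"
    "unimodular_affine ?x" "unimodular_affine ?y" "unimodular_affine ?xy"
    apply (rule unimodular_affineI[of _ 1 0 0 0 1 0]; simp add: field_simps)
    apply (rule unimodular_affineI[of _ "-1/2" "1/2" 0 "3/2" "1/2" 0]; simp add: field_simps)
    apply (rule unimodular_affineI[of _ "-1/2" "1/2" 0 "-3/2" "-1/2" "2*pi"]; simp add: field_simps)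
    apply (rule unimodular_affineI[of _ "-1" 0 pi 0 "-1" pi]; simp add: field_simps)
    apply (rule unimodular_affineI[of _ "-1" 0 "2*pi" 0 1 0]; simp add: field_simps)
    apply (rule unimodular_affineI[of _ 1 0 0 0 "-1" "2*pi"]; simp add: field_simps)
    apply (rule unimodular_affineI[of _ "-1" 0 "2*pi" 0 "-1" "2*pi"]; simp add: field_simps)
    done
  have lt3: "i = 0 \<or> i = 1 \<or> i = 2" if "i < 3" for i :: nat using that by auto
  have lt2: "i = 0 \<or> i = 1" if "i < 2" for i :: nat using that by auto
  have lt4: "i = 0 \<or> i = 1 \<or> i = 2 \<or> i = 3" if "i < 4" for i :: nat using that by auto
  have step1: "(\<integral>z. indicator H z * f z \<partial>lborel) = real 3 * (\<integral>z. indicator chamber z * f z \<partial>lborel)"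
    "integrable lborel (\<lambda>z. indicator H z * f z)"
  proof -
    have part: "AE z in lborel. (indicator H z :: real) = (\<Sum>i<3. indicator chamber (([?i, ?r2, ?r3] ! i) z))"
      using AE_not_on_line[of 3 "-1" 0, OF disjI1[OF zero_neq_numeral[symmetric]]] AE_not_on_line[of 3 1 "2*pi", OF disjI2[OF one_neq_zero]]
    proof eventually_elim
      case (elim z)
      show ?case using elim
        by (cases z) (auto simp: chamber_def H_def indicator_def field_simps eval_nat_numeral)
    qed
    show "(\<integral>z. indicator H z * f z \<partial>lborel) = real 3 * (\<integral>z. indicator chamber z * f z \<partial>lborel)"
      by (rule integral_fold_step(1)[OF _ _ part]) (use int0 inv aff in \<open>auto dest!: lt3\<close>)
    show "integrable lborel (\<lambda>z. indicator H z * f z)"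
      by (rule integral_fold_step(2)[OF _ _ part]) (use int0 inv aff in \<open>auto dest!: lt3\<close>)
  qed
  have step2: "(\<integral>z. indicator Q z * f z \<partial>lborel) = real 2 * (\<integral>z. indicator H z * f z \<partial>lborel)"
    "integrable lborel (\<lambda>z. indicator Q z * f z)"
  proof -
    have part: "AE z in lborel. (indicator Q z :: real) = (\<Sum>i<2. indicator H (([?i, ?p] ! i) z))"
      using AE_not_on_line[of 1 "-1" 0, OF disjI1[OF one_neq_zero]]
    proof eventually_elim
      case (elim z)
      show ?case using elim
        by (cases z) (auto simp: Q_def H_def indicator_def field_simps eval_nat_numeral)
    qed
    show "(\<integral>z. indicator Q z * f z \<partial>lborel) = real 2 * (\<integral>z. indicator H z * f z \<partial>lborel)"
      by (rule integral_fold_step(1)[OF _ _ part]) (use step1(2) inv aff in \<open>auto dest!: lt2\<close>)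
    show "integrable lborel (\<lambda>z. indicator Q z * f z)"
      by (rule integral_fold_step(2)[OF _ _ part]) (use step1(2) inv aff in \<open>auto dest!: lt2\<close>)
  qed
  have step3: "(\<integral>z. indicator W z * f z \<partial>lborel) = real 4 * (\<integral>z. indicator Q z * f z \<partial>lborel)"
    "integrable lborel (\<lambda>z. indicator W z * f z)"
  proof -
    have part: "AE z in lborel. (indicator W z :: real) = (\<Sum>i<4. indicator Q (([?i, ?x, ?y, ?xy] ! i) z))"
      using AE_not_on_line[of 1 0 pi, OF disjI1[OF one_neq_zero]] AE_not_on_line[of 0 1 pi, OF disjI2[OF one_neq_zero]]
    proof eventually_elim
      case (elim z)
      obtain x y where z: "z = (x, y)" by (cases z)
      let ?I = "\<lambda>a t. indicator {0..a} t :: real"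
      have half: "?I (2 * pi) t = ?I pi t + ?I pi (2 * pi - t)" if "t \<noteq> pi" for t
        using that by (auto simp: indicator_def)
      have box: "indicator (cbox (0, 0) (a, a)) (u, v) = ?I a u * ?I a v" for a u v :: real
        by (auto simp: indicator_def)
      have xy: "x \<noteq> pi" "y \<noteq> pi" using elim by (auto simp: z)
      have "indicator W z = (?I pi x + ?I pi (2 * pi - x)) * (?I pi y + ?I pi (2 * pi - y))"
        unfolding z W_def box half[OF xy(1)] half[OF xy(2)] ..
      also have "\<dots> = (\<Sum>i<4. indicator Q (([?i, ?x, ?y, ?xy] ! i) z))"
      proof -
        have "(\<Sum>i<4. h i) = h 0 + h 1 + h 2 + h 3" for h :: "nat \<Rightarrow> real"
          by (simp add: eval_nat_numeral)
        then show ?thesis by (simp add: z Q_def box distrib_left distrib_right del: cbox_Pair_eq)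
      qed
      finally show ?case .
    qed
    show "(\<integral>z. indicator W z * f z \<partial>lborel) = real 4 * (\<integral>z. indicator Q z * f z \<partial>lborel)"
      by (rule integral_fold_step(1)[OF _ _ part]) (use step2(2) inv aff in \<open>auto dest!: lt4\<close>)
    show "integrable lborel (\<lambda>z. indicator W z * f z)"
      by (rule integral_fold_step(2)[OF _ _ part]) (use step2(2) inv aff in \<open>auto dest!: lt4\<close>)
  qed
  have "integral W f = (\<integral>z. indicator W z * f z \<partial>lborel)"
    using set_borel_integral_eq_integral(2)[of W f] step3(2)
    by (simp add: set_lebesgue_integral_def set_integrable_def)
  then show ?thesis using step1 step2 step3 by (simp add: W_def)
qed

section \<open>The algebra of the eigenfunctions\<close>

text \<open>Up to a constant factor, the eigenfunction in the coordinates centred at the vertex.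
  Real indices keep the halved indices of the reflections admissible throughout.\<close>

definition wave :: "real \<Rightarrow> real \<Rightarrow> real \<Rightarrow> real \<Rightarrow> real" where
  "wave m n x y = cos (m * x) * sin (n * y) + cos ((m + 3 * n) / 2 * x) * sin ((m - n) / 2 * y)
     - cos ((3 * n - m) / 2 * x) * sin ((m + n) / 2 * y)"

lemma sin_int_pi_one_minus: "sin (pi * of_int k * (1 - t)) = - ((-1) powi k) * sin (of_int k * (pi * t))"
proof -
  have "sin (pi * of_int k * (1 - t)) = sin (pi * of_int k - of_int k * (pi * t))"
    by (simp add: algebra_simps)
  also have "\<dots> = sin (pi * of_int k) * cos (of_int k * (pi * t)) - cos (pi * of_int k) * sin (of_int k * (pi * t))"
    by (rule sin_diff)
  also have "cos (pi * of_int k) = (-1) powi k"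
    by (simp add: cos_npi_int power_int_minus_left)
  finally show ?thesis by (simp add: sin_npi_int mult.commute)
qed

text \<open>Moving the origin from the base to the apex gives each sine a sign. With k = (m - n) / 2
  these signs and the alternating factors of \<open>tri_eigfun\<close> are products of (-1)^n and
  (-1)^k; the latter appears only squared, which leaves one common factor.\<close>

lemma tri_eigfun_wave:
  assumes "m mod 2 = n mod 2"
  shows "tri_eigfun m n (x, y) = - 2 * (-1) powi n * wave m n (pi * x / sqrt 3) (pi * (1 - y))"
proof -
  from assms obtain k where k: "m = n + 2 * k"
    by (metis mod_eq_dvd_iff dvdE add.commute diff_add_cancel)
  have h: "(m + n) div 2 = n + k" "(m - n) div 2 = k" using k by auto
  have s: "sin (pi * y * of_int j) = - ((-1) powi j) * sin (of_int j * (pi * (1 - y)))" for j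
    using sin_int_pi_one_minus[of j "1 - y"] by (simp add: mult_ac)
  have c: "(-1::real) powi n * (-1) powi n = 1" "(-1::real) powi k * (-1) powi k = 1"
    by (simp_all add: power_int_minus_left)
  have e1: "sin (pi * of_int n * y) = - ((-1) powi n) * sin (of_int n * (pi * (1 - y)))"
    using s[of n] by (simp add: mult_ac)
  have e2: "sin (pi * y / 2 * of_int (m - n)) = - ((-1) powi k) * sin (of_int k * (pi * (1 - y)))"
    using s[of k] k by (simp add: mult_ac)
  have e3: "sin (pi * y / 2 * of_int (m + n)) = - ((-1) powi (n + k)) * sin (of_int (n + k) * (pi * (1 - y)))"
  proof -
    have "pi * y / 2 * of_int (m + n) = pi * y * of_int (n + k)" using k by (simp add: field_simps)
    then show ?thesis using s[of "n + k"] by (simp only:)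
  qed
  have pw: "(-1::real) powi (n + k) = (-1) powi n * (-1) powi k" by (simp add: power_int_add)
  have a1: "(of_int m + 3 * of_int n) / 2 * (pi * x / sqrt 3) = pi * x / (2 * sqrt 3) * of_int (m + 3 * n)"
    "(3 * of_int n - of_int m) / 2 * (pi * x / sqrt 3) = pi * x / (2 * sqrt 3) * of_int (3 * n - m)"
    "of_int m * (pi * x / sqrt 3) = pi * of_int m * x / sqrt 3"
    "(of_int m - of_int n) / 2 = (of_int k :: real)" "(of_int m + of_int n) / 2 = (of_int (n + k) :: real)"
    using k by (simp_all add: field_simps)
  have alg: "2 * C1 * (- u * S1) + 2 * (u * w) * C2 * (- w * S2) - 2 * w * C3 * (- (u * w) * S3)
     = - 2 * u * (C1 * S1 + C2 * S2 - C3 * S3)" if "w * w = 1" for u w C1 C2 C3 S1 S2 S3 :: real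
    using that by algebra
  show ?thesis
    unfolding tri_eigfun_def wave_def case_prod_conv h e1 e2 e3 pw a1 by (rule alg) (rule c)
qed

lemma two_cos_sin: "2 * (cos a * sin b) = sin (a + b) + sin (b - a :: real)"
  by (simp add: sin_add sin_diff)

text \<open>As a sum of single sines, the form in which the reflection in the line y = 3 x merely
  permutes the six terms up to sign.\<close>

lemma two_wave: "2 * wave m n x y = sin (m * x + n * y) + sin (n * y - m * x)
  + (sin ((m + 3 * n) / 2 * x + (m - n) / 2 * y) + sin ((m - n) / 2 * y - (m + 3 * n) / 2 * x))
  - (sin ((3 * n - m) / 2 * x + (m + n) / 2 * y) + sin ((m + n) / 2 * y - (3 * n - m) / 2 * x))"
  unfolding wave_def distrib_left right_diff_distrib two_cos_sin by simp

text \<open>The two sign changes and the last map generate the dihedral group of order 12 acting on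
  indices. The last one reflects in the line m = n, in agreement with the vanishing there.\<close>

lemma wave_index_symmetries:
  "wave (- m) n x y = wave m n x y" "wave m (- n) x y = - wave m n x y" "wave m m x y = 0"
  "wave ((3 * n - m) / 2) ((m + n) / 2) x y = - wave m n x y"
proof -
  have s: "sin ((- a - b) / 2 * t) = - sin ((a + b) / 2 * t)" "sin ((- a + b) / 2 * t) = - sin ((a - b) / 2 * t)"
     "cos ((- a - b) / 2 * t) = cos ((a + b) / 2 * t)" "cos ((- a + b) / 2 * t) = cos ((a - b) / 2 * t)" for a b t :: real
  proof -
    have "(- a - b) / 2 * t = - ((a + b) / 2 * t)" "(- a + b) / 2 * t = - ((a - b) / 2 * t)"
      by (simp_all add: field_simps)
    then show "sin ((- a - b) / 2 * t) = - sin ((a + b) / 2 * t)" "sin ((- a + b) / 2 * t) = - sin ((a - b) / 2 * t)"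
     "cos ((- a - b) / 2 * t) = cos ((a + b) / 2 * t)" "cos ((- a + b) / 2 * t) = cos ((a - b) / 2 * t)"
      by (simp_all only: sin_minus cos_minus)
  qed
  show "wave (- m) n x y = wave m n x y"
    unfolding wave_def using s(3)[of m "- 3 * n" x] s(1,2)[of m n y] s(4)[of m "3 * n"]
    by (simp add: add.commute)
  have d: "(m - - n) / 2 = (m + n) / 2" "(m + - n) / 2 = (m - n) / 2" by simp_all
  have c: "cos ((3 * - n - m) / 2 * x) = cos ((m + 3 * n) / 2 * x)"
    "cos ((m + 3 * - n) / 2 * x) = cos ((3 * n - m) / 2 * x)"
  proof -
    have "(3 * - n - m) / 2 * x = - ((m + 3 * n) / 2 * x)" "(m + 3 * - n) / 2 * x = - ((3 * n - m) / 2 * x)"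
      by (simp_all add: field_simps)
    then show "cos ((3 * - n - m) / 2 * x) = cos ((m + 3 * n) / 2 * x)"
      "cos ((m + 3 * - n) / 2 * x) = cos ((3 * n - m) / 2 * x)"
      by (simp_all only: cos_minus)
  qed
  show "wave m (- n) x y = - wave m n x y"
    unfolding wave_def d c by simp
  show "wave m m x y = 0" unfolding wave_def by simp
  have f: "((3 * n - m) / 2 + 3 * ((m + n) / 2)) / 2 = (m + 3 * n) / 2"
     "((3 * n - m) / 2 - (m + n) / 2) / 2 = - ((m - n) / 2)"
     "(3 * ((m + n) / 2) - (3 * n - m) / 2) / 2 = m" "((3 * n - m) / 2 + (m + n) / 2) / 2 = n"
    by (simp_all add: field_simps)
  show "wave ((3 * n - m) / 2) ((m + n) / 2) x y = - wave m n x y"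
    unfolding wave_def f by simp
qed

text \<open>Half the sum of the exponentials over the orbit of the frequency (2d, 0), namely (2d,
  0), (-2d, 0) and the four pairs with entries d or -d up to sign; hence invariant under the
  dihedral group.\<close>

definition orbit_cos :: "real \<Rightarrow> real \<Rightarrow> real \<Rightarrow> real" where
  "orbit_cos d x y = cos (2 * d * x) + 2 * cos (d * x) * cos (d * y)"

lemma orbit_cos_cos_sin:
  "2 * (orbit_cos d x y * (cos (m * x) * sin (n * y))) =
    cos ((m + 2 * d) * x) * sin (n * y) + cos ((m - 2 * d) * x) * sin (n * y)
    + cos ((m + d) * x) * sin ((n + d) * y) + cos ((m + d) * x) * sin ((n - d) * y)
    + cos ((m - d) * x) * sin ((n + d) * y) + cos ((m - d) * x) * sin ((n - d) * y)"
  unfolding orbit_cos_def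
  by (simp add: distrib_right left_diff_distrib cos_add cos_diff sin_add sin_diff) (simp add: algebra_simps)

text \<open>The product shifts the index by each of the six frequencies of \<open>orbit_cos\<close>.
  The group permutes these shifts, so the shifted terms of the three products in \<open>wave\<close>
  regroup into whole waves.\<close>

lemma orbit_cos_wave: "2 * (orbit_cos d x y * wave m n x y) = wave (m + 2 * d) n x y + wave (m - 2 * d) n x y
  + wave (m + d) (n + d) x y + wave (m + d) (n - d) x y + wave (m - d) (n + d) x y + wave (m - d) (n - d) x y"
proof -
  define cos_sin where "cos_sin = (\<lambda>m n. cos (m * x) * sin (n * y))"
  have VT: "wave m n x y = cos_sin m n + cos_sin ((m + 3 * n) / 2) ((m - n) / 2) - cos_sin ((3 * n - m) / 2) ((m + n) / 2)" for m n
    by (simp add: wave_def cos_sin_def)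
  have ET: "2 * (orbit_cos d x y * cos_sin m n) = cos_sin (m + 2 * d) n + cos_sin (m - 2 * d) n + cos_sin (m + d) (n + d) + cos_sin (m + d) (n - d)
     + cos_sin (m - d) (n + d) + cos_sin (m - d) (n - d)" for m n
    unfolding cos_sin_def by (rule orbit_cos_cos_sin)
  have "2 * (orbit_cos d x y * wave m n x y) = 2 * (orbit_cos d x y * cos_sin m n) + 2 * (orbit_cos d x y * cos_sin ((m + 3 * n) / 2) ((m - n) / 2))
     - 2 * (orbit_cos d x y * cos_sin ((3 * n - m) / 2) ((m + n) / 2))"
    by (simp add: VT algebra_simps)
  also have "\<dots> = wave (m + 2 * d) n x y + wave (m - 2 * d) n x y
  + wave (m + d) (n + d) x y + wave (m + d) (n - d) x y + wave (m - d) (n + d) x y + wave (m - d) (n - d) x y"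
    unfolding ET VT by (simp add: add_divide_distrib diff_divide_distrib algebra_simps)
  finally show ?thesis .
qed

lemma wave_point_symmetries:
  "wave m n (- x) y = wave m n x y" "wave m n x (- y) = - wave m n x y"
  "wave m n ((y - x) / 2) ((3 * x + y) / 2) = - wave m n x y"
proof -
  show "wave m n (- x) y = wave m n x y" "wave m n x (- y) = - wave m n x y" by (simp_all add: wave_def)
  have f: "a * ((y - x) / 2) + b * ((3 * x + y) / 2) = (3 * b - a) / 2 * x + (a + b) / 2 * y"
   "b * ((3 * x + y) / 2) - a * ((y - x) / 2) = (a + 3 * b) / 2 * x - (a - b) / 2 * y" for a b
    by (simp_all add: field_simps)
  have g: "(3 * ((m - n) / 2) - (m + 3 * n) / 2) / 2 = - ((3 * n - m) / 2)"
    "((m + 3 * n) / 2 + (m - n) / 2) / 2 = (m + n) / 2"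
    "((m + 3 * n) / 2 + 3 * ((m - n) / 2)) / 2 = m" "((m + 3 * n) / 2 - (m - n) / 2) / 2 = n"
    "(3 * ((m + n) / 2) - (3 * n - m) / 2) / 2 = m" "((3 * n - m) / 2 + (m + n) / 2) / 2 = n"
    "((3 * n - m) / 2 + 3 * ((m + n) / 2)) / 2 = (m + 3 * n) / 2"
    "((3 * n - m) / 2 - (m + n) / 2) / 2 = - ((m - n) / 2)"
    by (simp_all add: field_simps)
  have "2 * wave m n ((y - x) / 2) ((3 * x + y) / 2) = 2 * (- wave m n x y)"
    unfolding mult_minus_right two_wave f g
    using sin_minus[of "n * y - m * x"] sin_minus[of "(m - n) / 2 * y - (m + 3 * n) / 2 * x"]
    by (simp add: algebra_simps)
  then show "wave m n ((y - x) / 2) ((3 * x + y) / 2) = - wave m n x y" by simp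
qed

section \<open>The span of the modes and its multipliers\<close>

lemma finite_tri_index: "finite (tri_index N)"
  by (rule finite_subset[of _ "{0..int N} \<times> {0..int N}"]) (auto simp: tri_index_def)

lemma tri_index_mono: "M \<le> N \<Longrightarrow> tri_index M \<subseteq> tri_index N"
  by (auto simp: tri_index_def)

definition mode :: "int \<times> int \<Rightarrow> real \<times> real \<Rightarrow> real" where
  "mode l z = wave (of_int (fst l)) (of_int (snd l)) (fst z) (snd z)"

lemma continuous_on_mode: "continuous_on S (mode l)"
  unfolding mode_def wave_def by (intro continuous_intros)

definition mode_span :: "(real \<times> real \<Rightarrow> real) set" where
  "mode_span = {\<lambda>z. \<Sum>l\<in>tri_index M. a l * mode l z | M a. True}"

lemma mode_spanI: "f = (\<lambda>z. \<Sum>l\<in>tri_index M. a l * mode l z) \<Longrightarrow> f \<in> mode_span"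
  unfolding mode_span_def by blast

lemma mode_span_extend:
  assumes "M \<le> N"
  shows "(\<Sum>l\<in>tri_index M. a l * mode l z) = (\<Sum>l\<in>tri_index N. (if l \<in> tri_index M then a l else 0) * mode l z)"
  using tri_index_mono[OF assms] finite_tri_index
  by (intro sum.mono_neutral_cong_left) auto

lemma mode_span_add:
  assumes "f \<in> mode_span" "g \<in> mode_span"
  shows "(\<lambda>z. f z + g z) \<in> mode_span"
proof -
  from assms obtain M a N b where f: "f = (\<lambda>z. \<Sum>l\<in>tri_index M. a l * mode l z)"
    and g: "g = (\<lambda>z. \<Sum>l\<in>tri_index N. b l * mode l z)" unfolding mode_span_def by blast
  show ?thesis
    by (rule mode_spanI[where M="max M N" and a="\<lambda>l. (if l \<in> tri_index M then a l else 0) + (if l \<in> tri_index N then b l else 0)"])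
       (simp add: f g mode_span_extend[of M "max M N"] mode_span_extend[of N "max M N"] sum.distrib distrib_right)
qed

lemma mode_span_cmult: "f \<in> mode_span \<Longrightarrow> (\<lambda>z. c * f z) \<in> mode_span"
proof -
  assume "f \<in> mode_span"
  then obtain M a where f: "f = (\<lambda>z. \<Sum>l\<in>tri_index M. a l * mode l z)" unfolding mode_span_def by blast
  show "(\<lambda>z. c * f z) \<in> mode_span"
    by (rule mode_spanI[where M=M and a="\<lambda>l. c * a l"]) (simp add: f sum_distrib_left mult.assoc)
qed

lemma mode_span_zero: "(\<lambda>z. 0) \<in> mode_span"
  by (rule mode_spanI[where M=0 and a="\<lambda>_. 0"]) simp

lemma mode_span_sum: "(\<And>i. i \<in> A \<Longrightarrow> f i \<in> mode_span) \<Longrightarrow> (\<lambda>z. \<Sum>i\<in>A. f i z) \<in> mode_span"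
  by (induction A rule: infinite_finite_induct) (auto intro: mode_span_zero mode_span_add)

text \<open>Reflections move every index into the chamber \<open>0 \<le> m < n\<close>, or onto a wall, where the function
  vanishes; the latter case is absorbed by \<open>s = 0\<close>.\<close>

lemma wave_int_reduce:
  assumes "m mod 2 = n mod (2 :: int)"
  shows "\<exists>s m' n'. 0 \<le> m' \<and> m' < n' \<and> m' mod 2 = n' mod 2 \<and>
    (\<forall>x y. wave (of_int m) (of_int n) x y = s * wave (of_int m') (of_int n') x y)"
proof -
  have zero: ?thesis if "\<And>x y. wave (of_int m) (of_int n) x y = 0"
    by (intro exI[of _ 0] exI[of _ 0] exI[of _ 2]) (use that in auto)
  have abs_m: "wave (of_int \<bar>m\<bar>) n x y = wave (of_int m) n x y" for m n x y
    by (cases "m \<ge> 0") (auto simp: wave_index_symmetries)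
  define t :: real where "t = (if n \<ge> 0 then 1 else -1)"
  have abs_n: "wave (of_int m) (of_int n) x y = t * wave (of_int \<bar>m\<bar>) (of_int \<bar>n\<bar>) x y" for x y
    unfolding abs_m by (cases "n \<ge> 0") (auto simp: wave_index_symmetries t_def)
  have par: "\<bar>m\<bar> mod 2 = \<bar>n\<bar> mod 2"
  proof -
    have "\<bar>x\<bar> mod 2 = x mod (2 :: int)" for x by presburger
    then show ?thesis using assms by simp
  qed
  consider "\<bar>m\<bar> < \<bar>n\<bar>" | "\<bar>m\<bar> = \<bar>n\<bar>" | "\<bar>n\<bar> < \<bar>m\<bar>" by linarith
  then show ?thesis
  proof cases
    case 1
    then show ?thesis using abs_n par by (intro exI[of _ t] exI[of _ "\<bar>m\<bar>"] exI[of _ "\<bar>n\<bar>"]) auto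
  next
    case 2
    show ?thesis by (rule zero) (simp only: abs_n 2 wave_index_symmetries(3) mult_zero_right)
  next
    case 3
    have "a = b + 2 * ((a - b) div 2)" if "a mod 2 = b mod (2 :: int)" for a b
      using that by presburger
    from this[OF par] obtain k where k: "\<bar>m\<bar> = \<bar>n\<bar> + 2 * k" by blast
    define b where "b = \<bar>n\<bar>"
    have b: "b \<ge> 0" and "k > 0" using 3 k by (auto simp: b_def)
    \<comment> \<open>The reflection in the diagonal takes (|m|, |n|) to (\<open>M\<close>,
      \<open>N\<close>). \<open>M\<close> may be negative, so an absolute value is taken once more
      below.\<close>
    define M N where "M = b - k" and "N = b + k"
    have e': "(3 * real_of_int \<bar>n\<bar> - real_of_int \<bar>m\<bar>) / 2 = of_int M" "(real_of_int \<bar>m\<bar> + of_int \<bar>n\<bar>) / 2 = of_int N"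
      unfolding M_def N_def b_def of_int_add[symmetric] of_int_diff[symmetric]
      using arg_cong[OF k, of real_of_int] by (simp_all add: b_def)
    have VV: "wave (of_int m) (of_int n) x y = - t * wave (of_int M) (of_int N) x y" for x y
      using wave_index_symmetries(4)[of "of_int \<bar>n\<bar>" "of_int \<bar>m\<bar>" x y] unfolding e' abs_n by simp
    have parMN: "\<bar>M\<bar> mod 2 = N mod 2" and le: "\<bar>M\<bar> \<le> N"
    proof -
      have "\<bar>x\<bar> mod 2 = x mod (2 :: int)" for x by presburger
      moreover have "M mod 2 = N mod 2" unfolding M_def N_def by presburger
      ultimately show "\<bar>M\<bar> mod 2 = N mod 2" by simp
      show "\<bar>M\<bar> \<le> N" using b \<open>k > 0\<close> by (simp add: M_def N_def)
    qed
    show ?thesis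
    proof (cases "\<bar>M\<bar> < N")
      case True
      then show ?thesis using VV parMN by (intro exI[of _ "- t"] exI[of _ "\<bar>M\<bar>"] exI[of _ N]) (auto simp: abs_m simp del: of_int_abs)
    next
      case False
      then have "N = \<bar>M\<bar>" using le by simp
      show ?thesis
        by (rule zero) (simp only: VV abs_m[symmetric, of M] \<open>N = \<bar>M\<bar>\<close> wave_index_symmetries(3) mult_zero_right)
    qed
  qed
qed

lemma wave_in_mode_span:
  assumes "m mod 2 = n mod (2 :: int)"
  shows "(\<lambda>z. wave (of_int m) (of_int n) (fst z) (snd z)) \<in> mode_span"
proof -
  from wave_int_reduce[OF assms] obtain s m' n' where *: "0 \<le> m'" "m' < n'" "m' mod 2 = n' mod 2"
    "\<And>x y. wave (of_int m) (of_int n) x y = s * wave (of_int m') (of_int n') x y" by blast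
  have mem: "(m', n') \<in> tri_index (nat n')" using * by (auto simp: tri_index_def)
  have "(\<Sum>l\<in>tri_index (nat n'). (if l = (m', n') then s else 0) * mode l z) = s * mode (m', n') z" for z
    using mem finite_tri_index[of "nat n'"]
    by (simp add: if_distrib[of "\<lambda>x. x * _"] cong: if_cong)
  then show ?thesis
    by (intro mode_spanI[where M="nat n'" and a="\<lambda>l. if l = (m', n') then s else 0"]) (simp add: fun_eq_iff *(4) mode_def)
qed

lemma mode_in_mode_span: "l \<in> tri_index N \<Longrightarrow> mode l \<in> mode_span"
  using wave_in_mode_span[of "fst l" "snd l"] unfolding mode_def[abs_def] by (auto simp: tri_index_def)

text \<open>An algebra by construction, which makes the Stone-Weierstrass theorem applicable.\<close>

definition multipliers :: "(real \<times> real \<Rightarrow> real) set" where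
  "multipliers = {q. continuous_on UNIV q \<and> (\<forall>g\<in>mode_span. (\<lambda>z. q z * g z) \<in> mode_span)}"

lemma orbit_cos_multiplier: "(\<lambda>z. orbit_cos (of_nat d) (fst z) (snd z)) \<in> multipliers"
  unfolding multipliers_def mem_Collect_eq
proof (intro conjI ballI)
  show "continuous_on UNIV (\<lambda>z. orbit_cos (real d) (fst z) (snd z))"
    unfolding orbit_cos_def by (intro continuous_intros)
  fix g assume "g \<in> mode_span"
  then obtain M a where g: "g = (\<lambda>z. \<Sum>l\<in>tri_index M. a l * mode l z)" unfolding mode_span_def by blast
  have step: "(\<lambda>z. orbit_cos (real d) (fst z) (snd z) * mode l z) \<in> mode_span" if "l \<in> tri_index M" for l
  proof -
    obtain m n where l: "l = (m, n)" by (cases l)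
    have par: "m mod 2 = n mod 2" using that by (simp add: l tri_index_def)
    have par': "(m + 2 * d) mod 2 = n mod 2" "(m - 2 * d) mod 2 = n mod 2" "(m + d) mod 2 = (n + d) mod 2"
       "(m + d) mod 2 = (n - d) mod 2" "(m - d) mod 2 = (n + d) mod 2" "(m - d) mod 2 = (n - d) mod 2"
      using par by presburger+
    have "orbit_cos (real d) x y * wave (of_int m) (of_int n) x y = 1 / 2 *
      (wave (of_int (m + 2 * d)) (of_int n) x y + wave (of_int (m - 2 * d)) (of_int n) x y
      + wave (of_int (m + d)) (of_int (n + d)) x y + wave (of_int (m + d)) (of_int (n - d)) x y
      + wave (of_int (m - d)) (of_int (n + d)) x y + wave (of_int (m - d)) (of_int (n - d)) x y)" for x y
      using orbit_cos_wave[of "real d" x y m n] by simp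
    then show ?thesis unfolding mode_def[abs_def] l fst_conv snd_conv
      by (simp only:) (intro mode_span_cmult mode_span_add wave_in_mode_span par')
  qed
  have "(\<lambda>z. orbit_cos (real d) (fst z) (snd z) * g z) = (\<lambda>z. \<Sum>l\<in>tri_index M. a l * (orbit_cos (real d) (fst z) (snd z) * mode l z))"
    by (simp add: g sum_distrib_left mult_ac)
  then show "(\<lambda>z. orbit_cos (real d) (fst z) (snd z) * g z) \<in> mode_span"
    by (simp only:) (intro mode_span_sum mode_span_cmult step)
qed

section \<open>Integer frequencies: periodicity and orthogonality on the torus\<close>

definition cos_sin :: "int \<Rightarrow> int \<Rightarrow> real \<times> real \<Rightarrow> real" where
  "cos_sin a b z = cos (of_int a * fst z) * sin (of_int b * snd z)"

text \<open>Equal parity of m and n makes all the halved frequencies integers, which places the wave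
  on the torus; within each product the two frequencies again have equal parity.\<close>

lemma wave_eq_cos_sin:
  assumes "m mod 2 = n mod (2 :: int)"
  obtains k where "m = n + 2 * k"
    "\<And>x y. wave (of_int m) (of_int n) x y = cos_sin m n (x, y) + cos_sin (2 * n + k) k (x, y) - cos_sin (n - k) (n + k) (x, y)"
proof -
  have "m = n + 2 * ((m - n) div 2)" using assms by presburger
  then obtain k where k: "m = n + 2 * k" by blast
  have "wave (of_int m) (of_int n) x y = cos_sin m n (x, y) + cos_sin (2 * n + k) k (x, y) - cos_sin (n - k) (n + k) (x, y)" for x y
  proof -
    have "(real_of_int m + 3 * of_int n) / 2 = of_int (2 * n + k)" "(real_of_int m - of_int n) / 2 = of_int k"
      "(3 * of_int n - real_of_int m) / 2 = of_int (n - k)" "(real_of_int m + of_int n) / 2 = of_int (n + k)"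
      by (simp_all add: k)
    then show ?thesis unfolding wave_def cos_sin_def fst_conv snd_conv by (simp only:)
  qed
  with k show ?thesis by (rule that)
qed

lemma cos_sin_translate:
  assumes "even (a + b)"
  shows "cos_sin a b (x + pi, y + pi) = cos_sin a b (x, y)"
proof -
  have c: "cos (of_int a * (x + pi)) = (if even a then 1 else -1) * cos (of_int a * x)"
    using cos_npi_int[of a] sin_npi_int[of a] by (simp add: distrib_left cos_add mult.commute)
  have s: "sin (of_int b * (y + pi)) = (if even b then 1 else -1) * sin (of_int b * y)"
    using cos_npi_int[of b] sin_npi_int[of b] by (simp add: distrib_left sin_add mult.commute)
  show ?thesis using assms by (auto simp: cos_sin_def c s)
qed

text \<open>A half period in both variables multiplies the cosine and the sine of each product by
  the same sign. Together with the parities in x and y this gives the half turn of the square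
  [0, pi]^2.\<close>

lemma wave_translate:
  assumes "m mod 2 = n mod (2 :: int)"
  shows "wave (of_int m) (of_int n) (x + pi) (y + pi) = wave (of_int m) (of_int n) x y"
proof -
  obtain k where k: "m = n + 2 * k" "\<And>x y. wave (of_int m) (of_int n) x y = cos_sin m n (x, y) + cos_sin (2 * n + k) k (x, y) - cos_sin (n - k) (n + k) (x, y)"
    using wave_eq_cos_sin[OF assms] by blast
  show ?thesis unfolding k(2) by (subst (1 2 3) cos_sin_translate) (simp_all add: k(1))
qed

lemma wave_periodic:
  assumes "m mod 2 = n mod (2 :: int)"
  shows "wave (of_int m) (of_int n) (2 * pi - x) y = wave (of_int m) (of_int n) x y"
    "wave (of_int m) (of_int n) x (2 * pi - y) = - wave (of_int m) (of_int n) x y"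
    "wave (of_int m) (of_int n) (pi - x) (pi - y) = - wave (of_int m) (of_int n) x y"
proof -
  obtain k where k: "\<And>x y. wave (of_int m) (of_int n) x y = cos_sin m n (x, y) + cos_sin (2 * n + k) k (x, y) - cos_sin (n - k) (n + k) (x, y)"
    using wave_eq_cos_sin[OF assms] by blast
  have c: "cos (of_int a * (2 * pi - x)) = cos (of_int a * x)" for a x
    using cos_int_2pin[of a] sin_int_2pin[of a] by (simp add: right_diff_distrib cos_diff mult_ac)
  have s: "sin (of_int a * (2 * pi - x)) = - sin (of_int a * x)" for a x
    using cos_int_2pin[of a] sin_int_2pin[of a] by (simp add: right_diff_distrib sin_diff mult_ac)
  show "wave (of_int m) (of_int n) (2 * pi - x) y = wave (of_int m) (of_int n) x y"
    "wave (of_int m) (of_int n) x (2 * pi - y) = - wave (of_int m) (of_int n) x y"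
    unfolding k by (simp_all add: cos_sin_def c s del: of_int_add of_int_diff of_int_mult)
  show "wave (of_int m) (of_int n) (pi - x) (pi - y) = - wave (of_int m) (of_int n) x y"
    using wave_translate[OF assms, of "- x" "- y"] wave_point_symmetries(1)[of m n x "- y"] wave_point_symmetries(2)[of m n x y]
    by (simp add: add.commute)
qed

lemma integral_cos_int: "k \<noteq> 0 \<Longrightarrow> integral {0..2*pi} (\<lambda>x. cos (of_int k * x)) = 0"
proof -
  assume k: "k \<noteq> 0"
  have "((\<lambda>x. cos (of_int k * x)) has_integral (sin (of_int k * (2 * pi)) / of_int k - sin (of_int k * 0) / of_int k)) {0..2*pi}"
    by (rule fundamental_theorem_of_calculus)
       (use k in \<open>auto intro!: derivative_eq_intros simp: has_real_derivative_iff_has_vector_derivative[symmetric]\<close>)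
  moreover have "sin (of_int k * (2 * pi)) = 0" using sin_int_2pin[of k] by (simp add: mult_ac)
  ultimately show ?thesis by (simp add: integral_unique)
qed

lemma integral_trig_product:
  assumes "\<bar>a\<bar> \<noteq> \<bar>b :: int\<bar>"
  shows "integral {0..2*pi} (\<lambda>x. cos (of_int a * x) * cos (of_int b * x)) = 0"
    "integral {0..2*pi} (\<lambda>x. sin (of_int a * x) * sin (of_int b * x)) = 0"
proof -
  have ne: "a - b \<noteq> 0" "a + b \<noteq> 0" using assms by auto
  have int: "(\<lambda>x. cos (of_int k * x) / 2) integrable_on {0..2*pi}" for k :: int
    by (intro integrable_continuous_real continuous_intros) auto
  have "(\<lambda>x :: real. cos (of_int a * x) * cos (of_int b * x)) = (\<lambda>x. cos (of_int (a - b) * x) / 2 + cos (of_int (a + b) * x) / 2)"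
    by (simp add: cos_times_cos algebra_simps add_divide_distrib)
  then show "integral {0..2*pi} (\<lambda>x. cos (of_int a * x) * cos (of_int b * x)) = 0"
    using integral_cos_int[OF ne(1)] integral_cos_int[OF ne(2)] by (simp only: integral_add[OF int int] integral_divide)
  have "(\<lambda>x :: real. sin (of_int a * x) * sin (of_int b * x)) = (\<lambda>x. cos (of_int (a - b) * x) / 2 - cos (of_int (a + b) * x) / 2)"
    by (simp add: sin_times_sin algebra_simps diff_divide_distrib)
  then show "integral {0..2*pi} (\<lambda>x. sin (of_int a * x) * sin (of_int b * x)) = 0"
    using integral_cos_int[OF ne(1)] integral_cos_int[OF ne(2)] by (simp only: integral_diff[OF int int] integral_divide)
qed

lemma cos_sin_orthogonal:
  assumes "\<bar>a\<bar> \<noteq> \<bar>a'\<bar> \<or> \<bar>b\<bar> \<noteq> \<bar>b'\<bar>"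
  shows "((\<lambda>z. cos_sin a b z * cos_sin a' b' z) has_integral 0) (cbox (0, 0) (2*pi, 2*pi))"
proof -
  have cont: "continuous_on S (\<lambda>z. cos_sin a b z * cos_sin a' b' z)" for S
    unfolding cos_sin_def by (intro continuous_intros)
  have "integral (cbox (0, 0) (2*pi, 2*pi)) (\<lambda>z. cos_sin a b z * cos_sin a' b' z)
     = integral {0..2*pi} (\<lambda>x. integral {0..2*pi} (\<lambda>y. (cos (of_int a * x) * cos (of_int a' * x)) * (sin (of_int b * y) * sin (of_int b' * y))))"
    unfolding integral_prod_continuous[OF cont] by (simp add: cos_sin_def mult_ac)
  also have "\<dots> = integral {0..2*pi} (\<lambda>x. cos (of_int a * x) * cos (of_int a' * x)) * integral {0..2*pi} (\<lambda>y. sin (of_int b * y) * sin (of_int b' * y))"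
    by simp
  also have "\<dots> = 0" using assms integral_trig_product by auto
  finally show ?thesis using integrable_integral[OF integrable_continuous[OF cont]] by metis
qed

text \<open>In terms of n and k the chamber reads k < 0 <= n + 2k. There, distinct indices have no
  frequency pair in common even up to signs, so all nine products integrate to 0.\<close>

lemma wave_orthogonal:
  assumes "0 \<le> m" "m < n" "m mod 2 = n mod 2" "0 \<le> m'" "m' < n'" "m' mod 2 = n' mod (2 :: int)" "(m, n) \<noteq> (m', n')"
  shows "integral (cbox (0, 0) (2*pi, 2*pi))
    (\<lambda>z. wave (of_int m) (of_int n) (fst z) (snd z) * wave (of_int m') (of_int n') (fst z) (snd z)) = 0"
proof -
  obtain k where k: "m = n + 2 * k" "\<And>x y. wave (of_int m) (of_int n) x y = cos_sin m n (x, y) + cos_sin (2 * n + k) k (x, y) - cos_sin (n - k) (n + k) (x, y)"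
    using wave_eq_cos_sin[OF assms(3)] by blast
  obtain k' where k': "m' = n' + 2 * k'" "\<And>x y. wave (of_int m') (of_int n') x y = cos_sin m' n' (x, y) + cos_sin (2 * n' + k') k' (x, y) - cos_sin (n' - k') (n' + k') (x, y)"
    using wave_eq_cos_sin[OF assms(6)] by blast
  have c: "k < 0" "0 \<le> n + 2 * k" "k' < 0" "0 \<le> n' + 2 * k'" "n \<noteq> n' \<or> k \<noteq> k'"
    using assms k(1) k'(1) by auto
  have "((\<lambda>z. (cos_sin m n z * cos_sin m' n' z + cos_sin m n z * cos_sin (2 * n' + k') k' z - cos_sin m n z * cos_sin (n' - k') (n' + k') z)
     + (cos_sin (2 * n + k) k z * cos_sin m' n' z + cos_sin (2 * n + k) k z * cos_sin (2 * n' + k') k' z - cos_sin (2 * n + k) k z * cos_sin (n' - k') (n' + k') z)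
     - (cos_sin (n - k) (n + k) z * cos_sin m' n' z + cos_sin (n - k) (n + k) z * cos_sin (2 * n' + k') k' z - cos_sin (n - k) (n + k) z * cos_sin (n' - k') (n' + k') z))
     has_integral ((0 + 0 - 0) + (0 + 0 - 0) - (0 + 0 - 0))) (cbox (0, 0) (2*pi, 2*pi))"
    by (intro has_integral_add has_integral_diff cos_sin_orthogonal; use c k(1) k'(1) in arith)
  then show ?thesis unfolding k(2) k'(2) prod.collapse
    by (intro integral_unique) (simp add: algebra_simps)
qed

section \<open>Density of the eigenfunctions\<close>

text \<open>Both triples have the same elementary symmetric functions, hence are the roots of one
  cubic. Evaluating it at the largest root of either triple identifies the largest roots; the
  remaining quadratic is treated in the same way.\<close>

lemma sorted_triple_determined:
  fixes a b c a' b' c' :: real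
  assumes ord: "b \<le> a" "c \<le> b" "b' \<le> a'" "c' \<le> b'"
    and s: "a + b + c = a' + b' + c'" and q: "a\<^sup>2 + b\<^sup>2 + c\<^sup>2 = a'\<^sup>2 + b'\<^sup>2 + c'\<^sup>2" and t: "a * b * c = a' * b' * c'"
  shows "a = a'" "b = b'"
proof -
  have e2: "a * b + b * c + a * c = a' * b' + b' * c' + a' * c'"
  proof -
    have "(a + b + c)\<^sup>2 = (a' + b' + c')\<^sup>2" using s by simp
    then show ?thesis using q by (simp add: power2_eq_square algebra_simps)
  qed
  have poly: "(x - a) * (x - b) * (x - c) = (x - a') * (x - b') * (x - c')" for x
  proof -
    have "(x - u) * (x - v) * (x - w) = x^3 - (u + v + w) * x\<^sup>2 + (u * v + v * w + u * w) * x - u * v * w" for u v w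
      by (simp add: power2_eq_square power3_eq_cube algebra_simps)
    then show ?thesis using s e2 t by simp
  qed
  have "a \<le> a'" using poly[of a] ord by auto
  moreover have "a' \<le> a" using poly[of a'] ord by auto
  ultimately show a: "a = a'" by simp
  have bc: "b + c = b' + c'" "b\<^sup>2 + c\<^sup>2 = b'\<^sup>2 + c'\<^sup>2" using s q a by auto
  have bcp: "b * c = b' * c'"
  proof -
    have "(b + c)\<^sup>2 = (b' + c')\<^sup>2" using bc(1) by simp
    then show ?thesis using bc(2) by (simp add: power2_eq_square algebra_simps)
  qed
  have poly2: "(x - b) * (x - c) = (x - b') * (x - c')" for x
  proof -
    have "(x - u) * (x - v) = x\<^sup>2 - (u + v) * x + u * v" for u v
      by (simp add: power2_eq_square algebra_simps)
    then show ?thesis using bc(1) bcp by simp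
  qed
  have "b \<le> b'" using poly2[of b] ord by auto
  moreover have "b' \<le> b" using poly2[of b'] ord by auto
  ultimately show "b = b'" by simp
qed

text \<open>With this relation the sum and the sum of squares of the three cosines determine their product,
  hence the three cosines as a multiset.\<close>

lemma cos_triple_relation:
  "2 * (cos a * cos b * cos (a + b)) = (cos a)\<^sup>2 + (cos b)\<^sup>2 + (cos (a + b))\<^sup>2 - (1 :: real)"
proof -
  have "(cos a * cos b - cos (a + b))\<^sup>2 = (sin a)\<^sup>2 * (sin b)\<^sup>2"
    by (simp add: cos_add power_mult_distrib)
  also have "\<dots> = (1 - (cos a)\<^sup>2) * (1 - (cos b)\<^sup>2)" by (simp add: sin_squared_eq)
  finally show ?thesis by (simp add: power2_eq_square algebra_simps)
qed

lemma orbit_cos_angles: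
  "orbit_cos 1 x y = cos (2 * x) + cos (y - x) + cos (y + x)"
  "orbit_cos 2 x y = 2 * ((cos (2 * x))\<^sup>2 + (cos (y - x))\<^sup>2 + (cos (y + x))\<^sup>2) - 3"
proof -
  show "orbit_cos 1 x y = cos (2 * x) + cos (y - x) + cos (y + x)"
    by (simp add: orbit_cos_def cos_add cos_diff)
  have "cos (2 * (y - x)) + cos (2 * (y + x)) = 2 * cos (2 * x) * cos (2 * y)"
    unfolding distrib_left right_diff_distrib cos_add cos_diff by simp
  then have "orbit_cos 2 x y = cos (2 * (2 * x)) + cos (2 * (y - x)) + cos (2 * (y + x))"
    unfolding orbit_cos_def by simp
  then show "orbit_cos 2 x y = 2 * ((cos (2 * x))\<^sup>2 + (cos (y - x))\<^sup>2 + (cos (y + x))\<^sup>2) - 3"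
    unfolding cos_double_cos[of "2 * x"] cos_double_cos[of "y - x"] cos_double_cos[of "y + x"] by simp
qed

text \<open>The two values are the sum of cos 2x, cos (y - x), cos (y + x) and, up to constants, the
  sum of their squares. On the chamber these cosines are already sorted, so the multiset determines
  each of them. The angle y + x can exceed pi, but 2x and y - x stay in [0, pi], where the cosine is
  injective.\<close>

lemma orbit_cos_separates_chamber:
  assumes "(x, y) \<in> chamber" "(x', y') \<in> chamber"
    and E1: "orbit_cos 1 x y = orbit_cos 1 x' y'" and E2: "orbit_cos 2 x y = orbit_cos 2 x' y'"
  shows "x = x' \<and> y = y'"
proof -
  have ord: "cos (y - x) \<le> cos (2 * x)" "cos (y + x) \<le> cos (y - x)" if "(x, y) \<in> chamber" for x y
  proof -
    have c: "0 \<le> x" "3 * x \<le> y" "y \<le> pi" using that by (auto simp: chamber_def)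
    show "cos (y - x) \<le> cos (2 * x)" using c by (intro cos_monotone_0_pi_le) auto
    show "cos (y + x) \<le> cos (y - x)"
    proof (cases "y + x \<le> pi")
      case True
      then show ?thesis using c by (intro cos_monotone_0_pi_le) auto
    next
      case False
      have "cos (y + x) = cos (2 * pi - (y + x))" by (simp add: cos_diff)
      also have "\<dots> \<le> cos (y - x)" using False c by (intro cos_monotone_0_pi_le) auto
      finally show ?thesis .
    qed
  qed
  have prod: "2 * (cos (2 * x) * cos (y - x) * cos (y + x))
     = (cos (2 * x))\<^sup>2 + (cos (y - x))\<^sup>2 + (cos (y + x))\<^sup>2 - 1" for x y :: real
    using cos_triple_relation[of "2 * x" "y - x"] by (simp add: add.commute)
  have eq: "cos (2 * x) = cos (2 * x')" "cos (y - x) = cos (y' - x')"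
    by (rule sorted_triple_determined[of "cos (y - x)" "cos (2 * x)" "cos (y + x)" "cos (y' - x')" "cos (2 * x')" "cos (y' + x')"];
        use ord[OF assms(1)] ord[OF assms(2)] E1 E2 prod[of x y] prod[of x' y'] in \<open>simp add: orbit_cos_angles\<close>)+
  have "2 * x = 2 * x'" using eq(1) by (rule cos_inj_pi[rotated 4]) (use assms in \<open>auto simp: chamber_def\<close>)
  moreover have "y - x = y' - x'" using eq(2) by (rule cos_inj_pi[rotated 4]) (use assms in \<open>auto simp: chamber_def\<close>)
  ultimately show ?thesis by simp
qed

lemma multipliers_dense:
  assumes "continuous_on chamber f" "e > 0"
  shows "\<exists>q\<in>multipliers. \<forall>z\<in>chamber. \<bar>f z - q z\<bar> < e"
proof -
  interpret function_ring_on multipliers chamber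
  proof
    show "compact chamber" by (rule compact_chamber)
    show "f \<in> multipliers \<Longrightarrow> continuous_on chamber f" for f
      unfolding multipliers_def using continuous_on_subset by blast
    show "(\<lambda>x. f x + g x) \<in> multipliers" if "f \<in> multipliers" "g \<in> multipliers" for f g
      using that unfolding multipliers_def by (auto intro!: continuous_intros mode_span_add simp: distrib_right)
    show "(\<lambda>x. f x * g x) \<in> multipliers" if "f \<in> multipliers" "g \<in> multipliers" for f g
      using that unfolding multipliers_def by (auto intro!: continuous_intros simp: mult.assoc)
    show "(\<lambda>_. c) \<in> multipliers" for c
      unfolding multipliers_def by (auto intro!: mode_span_cmult)
    show "\<exists>f\<in>multipliers. f z \<noteq> f w" if "z \<in> chamber" "w \<in> chamber" "z \<noteq> w" for z w
    proof (rule ccontr)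
      assume "\<not> ?thesis"
      then have "\<forall>f\<in>multipliers. f z = f w" by blast
      then have eq: "orbit_cos (real d) (fst z) (snd z) = orbit_cos (real d) (fst w) (snd w)" for d
        using orbit_cos_multiplier[of d] by (rule bspec)
      from eq[of 1] eq[of 2] show False
        using orbit_cos_separates_chamber[of "fst z" "snd z" "fst w" "snd w"] that by (simp add: prod_eq_iff)
    qed
  qed
  show ?thesis using Stone_Weierstrass_basic[OF assms] by blast
qed

section \<open>Coordinates on the triangle and approximation by modes\<close>

definition tri_coord :: "real \<times> real \<Rightarrow> real \<times> real" where
  "tri_coord z = (pi * fst z / sqrt 3, pi * (1 - snd z))"

abbreviation "tri_measure \<equiv> lebesgue_on hemi_triangle"

abbreviation "power_integral p f \<equiv> \<integral>z. \<bar>f z\<bar> powr p \<partial>tri_measure"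

lemma hemi_triangle_eq: "hemi_triangle = {z. 0 \<le> fst z \<and> 0 \<le> snd z \<and> sqrt 3 * fst z + snd z \<le> 1}"
proof (intro set_eqI iffI)
  fix z assume "z \<in> hemi_triangle"
  then show "z \<in> {z. 0 \<le> fst z \<and> 0 \<le> snd z \<and> sqrt 3 * fst z + snd z \<le> 1}"
    unfolding hemi_triangle_def convex_hull_3 by auto
next
  fix z :: "real \<times> real" assume z: "z \<in> {z. 0 \<le> fst z \<and> 0 \<le> snd z \<and> sqrt 3 * fst z + snd z \<le> 1}"
  define u v w where "u = 1 - sqrt 3 * fst z - snd z" and "v = sqrt 3 * fst z" and "w = snd z"
  have "0 \<le> u" "0 \<le> v" "0 \<le> w" "u + v + w = 1"
    using z by (auto simp: u_def v_def w_def)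
  moreover have "z = u *\<^sub>R (0, 0) + v *\<^sub>R (1 / sqrt 3, 0) + w *\<^sub>R (0, 1)"
    by (simp add: v_def w_def prod_eq_iff)
  ultimately show "z \<in> hemi_triangle"
    unfolding hemi_triangle_def convex_hull_3 by blast
qed

lemma tri_coord_chamber: "tri_coord z \<in> chamber \<longleftrightarrow> z \<in> hemi_triangle"
proof -
  have "3 * (pi * fst z / sqrt 3) = pi * (sqrt 3 * fst z)"
    by (simp add: field_simps)
  then have "3 * (pi * fst z / sqrt 3) \<le> pi * (1 - snd z) \<longleftrightarrow> sqrt 3 * fst z + snd z \<le> 1"
    by (simp only: mult_le_cancel_left_pos[OF pi_gt_zero] le_diff_eq)
  moreover have "0 \<le> pi * fst z / sqrt 3 \<longleftrightarrow> 0 \<le> fst z"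
    by (simp add: zero_le_divide_iff zero_le_mult_iff not_le[THEN iffD2, OF pi_gt_zero])
  moreover have "pi * (1 - snd z) \<le> pi \<longleftrightarrow> 0 \<le> snd z"
    using mult_le_cancel_left_pos[OF pi_gt_zero, of "1 - snd z" 1] by simp
  ultimately show ?thesis by (auto simp: chamber_def tri_coord_def hemi_triangle_eq)
qed

lemma continuous_on_tri_coord: "continuous_on S tri_coord"
  unfolding tri_coord_def by (intro continuous_intros) simp

lemma compact_hemi_triangle: "compact hemi_triangle"
  unfolding hemi_triangle_def by (intro finite_imp_compact_convex_hull) simp

lemma hemi_sets [measurable, simp]: "hemi_triangle \<in> sets lebesgue" "hemi_triangle \<in> sets borel"
  using compact_imp_closed[OF compact_hemi_triangle] by (auto intro: borel_closed)

lemma finite_measure_tri: "finite_measure tri_measure"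
  using lmeasurable_compact[OF compact_hemi_triangle] by (rule finite_measure_lebesgue_on)

lemma tri_measure_borel_measurable:
  "f \<in> borel_measurable borel \<Longrightarrow> f \<in> borel_measurable tri_measure"
  by (intro measurable_restrict_space1 measurable_completion) simp

lemma integral_tri_coord:
  assumes "continuous_on UNIV \<phi>"
  shows "(\<integral>z. \<phi> (tri_coord z) \<partial>tri_measure) = sqrt 3 / pi\<^sup>2 * (\<integral>w. indicator chamber w * \<phi> w \<partial>lborel)"
proof -
  have [measurable]: "\<phi> \<in> borel_measurable borel"
    using assms by (rule borel_measurable_continuous_onI)
  have [measurable]: "chamber \<in> sets borel"
    by (rule borel_closed[OF compact_imp_closed[OF compact_chamber]])
  have [measurable]: "tri_coord \<in> borel_measurable borel"
    by (rule borel_measurable_continuous_onI) (rule continuous_on_tri_coord)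
  have m: "(\<lambda>w. indicator chamber w * \<phi> w) \<in> borel_measurable borel" by measurable
  have m': "(\<lambda>z. indicator hemi_triangle z * \<phi> (tri_coord z)) \<in> borel_measurable lborel"
    by measurable
  have affine: "(pi / sqrt 3 * fst z + 0 * snd z + 0, 0 * fst z + - pi * snd z + pi) = tri_coord z" for z
    by (simp add: tri_coord_def algebra_simps)
  have ind: "indicator chamber (tri_coord z) = (indicator hemi_triangle z :: real)" for z
    by (simp add: indicator_def tri_coord_chamber)
  have "(\<integral>z. \<phi> (tri_coord z) \<partial>tri_measure) = (\<integral>z. indicator hemi_triangle z * \<phi> (tri_coord z) \<partial>lebesgue)"
    by (subst integral_restrict_space) auto
  also have "\<dots> = (\<integral>z. indicator hemi_triangle z * \<phi> (tri_coord z) \<partial>lborel)"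
    by (rule integral_completion[OF m'])
  finally have 1: "(\<integral>z. \<phi> (tri_coord z) \<partial>tri_measure) = (\<integral>z. indicator hemi_triangle z * \<phi> (tri_coord z) \<partial>lborel)" .
  have "(\<integral>w. indicator chamber w * \<phi> w \<partial>lborel) = pi\<^sup>2 / sqrt 3 * (\<integral>z. indicator hemi_triangle z * \<phi> (tri_coord z) \<partial>lborel)"
    using integral_affine_plane(1)[OF _ _ m, of "pi / sqrt 3" "- pi" 0 0 0 pi] unfolding affine ind
    by (simp add: power2_eq_square abs_mult)
  then show ?thesis unfolding 1 by (simp add: field_simps)
qed

lemma integral_tri_eq_cbox:
  fixes \<phi> :: "real \<times> real \<Rightarrow> real"
  assumes "continuous_on UNIV \<phi>"
    and "\<And>x y. \<phi> (2 * pi - x, y) = \<phi> (x, y)" "\<And>x y. \<phi> (x, 2 * pi - y) = \<phi> (x, y)"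
      "\<And>x y. \<phi> (pi - x, pi - y) = \<phi> (x, y)" "\<And>x y. \<phi> ((y - x) / 2, (3 * x + y) / 2) = \<phi> (x, y)"
  shows "(\<integral>z. \<phi> (tri_coord z) \<partial>tri_measure) = sqrt 3 / (24 * pi\<^sup>2) * integral (cbox (0, 0) (2*pi, 2*pi)) \<phi>"
  unfolding integral_tri_coord[OF assms(1)] integral_cbox_eq_chamber[OF assms] by simp

text \<open>The mode factors as 2 sin y (cos y - cos 3x). On the chamber, where 3x and y lie in
  [0, pi], it vanishes only for y = 0, y = pi or y = 3x, and these lines are null sets.\<close>

lemma AE_hemi_interior:
  "AE z in tri_measure. mode (0, 2) (tri_coord z) \<noteq> 0"
proof -
  have "AE z in lborel. z \<in> hemi_triangle \<longrightarrow> mode (0, 2) (tri_coord z) \<noteq> 0"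
    using AE_not_on_line[of 0 1 0, OF disjI2[OF one_neq_zero]] AE_not_on_line[of 0 1 1, OF disjI2[OF one_neq_zero]]
      AE_not_on_line[of "sqrt 3" 1 1, OF disjI2[OF one_neq_zero]]
  proof eventually_elim
    case (elim z)
    show ?case
    proof (intro impI)
      assume z: "z \<in> hemi_triangle"
      obtain x y where xy: "tri_coord z = (x, y)" by (cases "tri_coord z")
      have c: "0 \<le> x" "3 * x \<le> y" "y \<le> pi" using z tri_coord_chamber[of z] by (auto simp: xy chamber_def)
      have "y \<noteq> pi" "y \<noteq> 0" using elim xy by (auto simp: tri_coord_def)
      moreover have "3 * x \<noteq> y"
      proof
        assume "3 * x = y"
        then have "3 * (pi * fst z / sqrt 3) = pi * (1 - snd z)" using xy by (simp add: tri_coord_def)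
        moreover have "3 * (pi * fst z / sqrt 3) = pi * (sqrt 3 * fst z)" by (simp add: field_simps)
        ultimately have "sqrt 3 * fst z = 1 - snd z" by simp
        then show False using elim by simp
      qed
      ultimately have s: "sin y > 0" and "cos y < cos (3 * x)"
        using c by (auto intro!: sin_gt_zero cos_monotone_0_pi)
      moreover have "mode (0, 2) (x, y) = 2 * sin y * (cos y - cos (3 * x))"
        by (simp add: mode_def wave_def sin_double) (simp add: algebra_simps)
      ultimately show "mode (0, 2) (tri_coord z) \<noteq> 0" by (simp add: xy)
    qed
  qed
  then have "AE z in lebesgue. z \<in> hemi_triangle \<longrightarrow> mode (0, 2) (tri_coord z) \<noteq> 0"
    by (rule AE_completion)
  then show ?thesis by (subst AE_restrict_space_iff) auto
qed

lemma mode_bound: "\<bar>mode l z\<bar> \<le> 3"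
proof -
  have cs: "\<bar>cos u * sin v\<bar> \<le> 1" for u v :: real
    by (simp add: abs_mult mult_le_one)
  show ?thesis unfolding mode_def wave_def
    using cs[of "of_int (fst l) * fst z" "of_int (snd l) * snd z"]
      cs[of "(of_int (fst l) + 3 * of_int (snd l)) / 2 * fst z" "(of_int (fst l) - of_int (snd l)) / 2 * snd z"]
      cs[of "(3 * of_int (snd l) - of_int (fst l)) / 2 * fst z" "(of_int (fst l) + of_int (snd l)) / 2 * snd z"]
    by linarith
qed

text \<open>The function h is an a.e. limit of continuous functions, truncated at \<open>B\<close>.
  Dividing them by the mode \<open>b\<close> would be singular at its zeros, so a cut-off is
  inserted first; the quotient \<open>k n\<close> is then continuous on the chamber and uniformly
  close to a multiplier \<open>q n\<close>, and \<open>q n * b\<close> lies in the span.\<close>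

lemma mode_dense_bounded:
  assumes h: "h \<in> borel_measurable tri_measure" and B: "\<And>z. \<bar>h z\<bar> \<le> B"
  shows "\<exists>P. (\<forall>n. P n \<in> mode_span \<and> (\<forall>z\<in>hemi_triangle. \<bar>P n (tri_coord z)\<bar> \<le> B + 1)) \<and>
    (AE z in tri_measure. (\<lambda>n. P n (tri_coord z)) \<longlonglongrightarrow> h z)"
proof -
  have B0: "B \<ge> 0" using B[of 0] by linarith
  have "(\<lambda>z. if z \<in> hemi_triangle then h z else 0) \<in> borel_measurable lebesgue"
    using h by (simp add: borel_measurable_if)
  then have "(\<lambda>z. if z \<in> hemi_triangle then h z else 0) measurable_on UNIV"
    by (rule lebesgue_measurable_imp_measurable_on) simp
  then obtain Nn g where Nn: "negligible Nn" and g: "\<And>n. continuous_on UNIV (g n)"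
    and glim: "\<And>z. z \<notin> Nn \<Longrightarrow> (\<lambda>n. g n z) \<longlonglongrightarrow> (if z \<in> hemi_triangle then h z else 0)"
    unfolding measurable_on_def by auto
  define c where "c = (\<lambda>n z. max (- B) (min B (g n z :: real)))"
  define iv :: "real \<times> real \<Rightarrow> real \<times> real" where "iv = (\<lambda>w. (sqrt 3 * fst w / pi, 1 - snd w / pi))"
  have iv: "iv (tri_coord z) = z" for z
    by (simp add: iv_def tri_coord_def prod_eq_iff)
  define b where "b = mode (0, 2)"
  have b: "b \<in> mode_span" unfolding b_def by (rule mode_in_mode_span[of _ 2]) (simp add: tri_index_def)
  \<comment> \<open>A cut-off with values in [0, 1] that tends to 1 wherever \<open>b\<close> is
    nonzero and contains a factor \<open>b\<close>, so that dividing it by \<open>b\<close> leaves a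
    continuous function.\<close>
  define r where "r = (\<lambda>n::nat. \<lambda>t. real n * t\<^sup>2 / (1 + real n * t\<^sup>2))"
  have r: "0 \<le> r n t" "r n t \<le> 1" for n t
    unfolding r_def by (simp_all add: divide_le_eq add_pos_nonneg)
  define k where "k = (\<lambda>n w. c n (iv w) * (real n * b w / (1 + real n * (b w)\<^sup>2)))"
  have kb: "k n w * b w = c n (iv w) * r n (b w)" for n w
    by (simp add: k_def r_def power2_eq_square)
  have cont_k: "continuous_on chamber (k n)" for n
  proof -
    have "1 + real n * t\<^sup>2 \<noteq> 0" for t :: real
      by (metis add_pos_nonneg less_numeral_extra(3) mult_nonneg_nonneg of_nat_0_le_iff zero_le_power2 zero_less_one)
    moreover have "continuous_on chamber (\<lambda>w. g n (iv w))"
      unfolding iv_def by (rule continuous_on_compose2[OF g]) (auto intro!: continuous_intros)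
    ultimately show ?thesis
      unfolding k_def c_def b_def by (intro continuous_intros continuous_on_mode) auto
  qed
  \<comment> \<open>The 3 offsets the bound |b| <= 3, so the final error is at most 1 / (n + 1) <=
    1; this is the 1 in the bound \<open>B + 1\<close>.\<close>
  have "\<forall>n. \<exists>q. q \<in> multipliers \<and> (\<forall>w\<in>chamber. \<bar>k n w - q w\<bar> < 1 / (3 * real (Suc n)))"
    using multipliers_dense[OF cont_k] by (metis divide_pos_pos mult_pos_pos of_nat_0_less_iff zero_less_Suc zero_less_numeral zero_less_one)
  then obtain q where q: "\<And>n. q n \<in> multipliers" "\<And>n w. w \<in> chamber \<Longrightarrow> \<bar>k n w - q n w\<bar> < 1 / (3 * real (Suc n))"
    by metis
  define P where "P = (\<lambda>n w. q n w * b w)"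
  have P: "P n \<in> mode_span" for n
    using q(1)[of n] b unfolding P_def multipliers_def by blast
  have close: "\<bar>P n w - c n (iv w) * r n (b w)\<bar> \<le> 1 / real (Suc n)" if "w \<in> chamber" for n w
  proof -
    have "\<bar>P n w - c n (iv w) * r n (b w)\<bar> = \<bar>k n w - q n w\<bar> * \<bar>b w\<bar>"
      unfolding kb[symmetric] P_def abs_mult[symmetric] by (simp add: left_diff_distrib abs_minus_commute)
    also have "\<dots> \<le> 1 / (3 * real (Suc n)) * 3"
      using q(2)[OF that, of n] mode_bound by (intro mult_mono) (auto simp: b_def)
    also have "\<dots> = 1 / real (Suc n)" by (simp del: of_nat_Suc)
    finally show ?thesis .
  qed
  have cB: "\<bar>c n z\<bar> \<le> B" for n z using B0 by (auto simp: c_def)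
  have bound: "\<bar>P n (tri_coord z)\<bar> \<le> B + 1" if "z \<in> hemi_triangle" for n z
  proof -
    have "\<bar>P n (tri_coord z) - c n z * r n (b (tri_coord z))\<bar> \<le> 1 / real (Suc n)"
      using close[of "tri_coord z" n] that by (simp add: tri_coord_chamber iv)
    moreover have "1 / real (Suc n) \<le> 1" by simp
    moreover have "\<bar>c n z * r n (b (tri_coord z))\<bar> \<le> B * 1"
      unfolding abs_mult using r cB B0 by (intro mult_mono) auto
    ultimately show ?thesis by linarith
  qed
  have "AE z in tri_measure. z \<notin> Nn"
  proof -
    have "AE z in lebesgue. z \<notin> Nn"
      using Nn by (simp add: negligible_iff_null_sets AE_not_in)
    then show ?thesis by (subst AE_restrict_space_iff) auto
  qed
  moreover have "AE z in tri_measure. z \<in> hemi_triangle"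
    using AE_space[of tri_measure] by simp
  ultimately have "AE z in tri_measure. (\<lambda>n. P n (tri_coord z)) \<longlonglongrightarrow> h z"
    using AE_hemi_interior
  proof eventually_elim
    case (elim z)
    have "(\<lambda>n. g n z) \<longlonglongrightarrow> h z" using glim[OF elim(1)] elim(2) by simp
    then have "(\<lambda>n. c n z) \<longlonglongrightarrow> max (- B) (min B (h z))"
      unfolding c_def by (intro tendsto_intros)
    moreover have "max (- B) (min B (h z)) = h z" using B[of z] by (auto simp: max_def min_def)
    ultimately have c_lim: "(\<lambda>n. c n z) \<longlonglongrightarrow> h z" by simp
    define t where "t = (b (tri_coord z))\<^sup>2"
    have "t > 0" using elim(3) by (simp add: t_def b_def)
    have "(\<lambda>n. 1 - inverse (1 + real n * t)) \<longlonglongrightarrow> 1 - 0"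
    proof (intro tendsto_intros tendsto_inverse_0_at_top)
      show "filterlim (\<lambda>n. 1 + real n * t) at_top sequentially"
        by (intro filterlim_tendsto_add_at_top[OF tendsto_const]
             filterlim_at_top_mult_tendsto_pos[OF tendsto_const \<open>t > 0\<close>] filterlim_real_sequentially)
    qed
    moreover have "r n (b (tri_coord z)) = 1 - inverse (1 + real n * t)" for n
    proof -
      have "1 + real n * t > 0" using \<open>t > 0\<close> by (simp add: add_pos_nonneg)
      then show ?thesis unfolding r_def t_def[symmetric] by (simp add: field_simps)
    qed
    ultimately have "(\<lambda>n. r n (b (tri_coord z))) \<longlonglongrightarrow> 1" by simp
    from tendsto_mult[OF c_lim this]
    have "(\<lambda>n. c n z * r n (b (tri_coord z))) \<longlonglongrightarrow> h z" by simp
    moreover have "(\<lambda>n. P n (tri_coord z) - c n z * r n (b (tri_coord z))) \<longlonglongrightarrow> 0"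
    proof (rule Lim_null_comparison)
      show "\<forall>\<^sub>F n in sequentially. norm (P n (tri_coord z) - c n z * r n (b (tri_coord z))) \<le> 1 / real (Suc n)"
        using close[of "tri_coord z"] elim(2) by (auto simp: tri_coord_chamber iv)
      show "(\<lambda>n. 1 / real (Suc n)) \<longlonglongrightarrow> 0"
        using LIMSEQ_inverse_real_of_nat by (simp add: inverse_eq_divide)
    qed
    ultimately show ?case using tendsto_add by fastforce
  qed
  then show ?thesis using P bound by blast
qed

section \<open>Elementary L^p estimates and density in L^p\<close>

lemma abs_add_powr_le:
  assumes "p > 0"
  shows "\<bar>a + b\<bar> powr p \<le> 2 powr p * (\<bar>a\<bar> powr p + \<bar>b :: real\<bar> powr p)"
proof -
  have "\<bar>a + b\<bar> powr p \<le> (2 * max \<bar>a\<bar> \<bar>b\<bar>) powr p"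
    using assms by (intro powr_mono2) (auto simp: max_def)
  also have "\<dots> = 2 powr p * max \<bar>a\<bar> \<bar>b\<bar> powr p" by (simp add: powr_mult)
  also have "max \<bar>a\<bar> \<bar>b\<bar> powr p \<le> \<bar>a\<bar> powr p + \<bar>b\<bar> powr p" by (simp add: max_def)
  finally show ?thesis by simp
qed

lemma Lp_space_add:
  assumes "p > 0" "f \<in> Lp_space p M" "g \<in> Lp_space p M"
  shows "(\<lambda>x. f x + g x) \<in> Lp_space p M"
    "(\<integral>x. \<bar>f x + g x\<bar> powr p \<partial>M) \<le> 2 powr p * ((\<integral>x. \<bar>f x\<bar> powr p \<partial>M) + (\<integral>x. \<bar>g x\<bar> powr p \<partial>M))"
proof -
  have m[measurable]: "f \<in> borel_measurable M" "g \<in> borel_measurable M"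
    and i: "integrable M (\<lambda>x. \<bar>f x\<bar> powr p)" "integrable M (\<lambda>x. \<bar>g x\<bar> powr p)"
    using assms by (auto simp: Lp_space_def)
  have I: "integrable M (\<lambda>x. 2 powr p * (\<bar>f x\<bar> powr p + \<bar>g x\<bar> powr p))" using i by auto
  have J: "integrable M (\<lambda>x. \<bar>f x + g x\<bar> powr p)"
    by (rule Bochner_Integration.integrable_bound[OF I]) (auto simp: abs_add_powr_le[OF assms(1)])
  then show "(\<lambda>x. f x + g x) \<in> Lp_space p M" by (simp add: Lp_space_def)
  have "(\<integral>x. \<bar>f x + g x\<bar> powr p \<partial>M) \<le> (\<integral>x. 2 powr p * (\<bar>f x\<bar> powr p + \<bar>g x\<bar> powr p) \<partial>M)"
    by (rule integral_mono[OF J I]) (rule abs_add_powr_le[OF assms(1)])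
  also have "\<dots> = 2 powr p * ((\<integral>x. \<bar>f x\<bar> powr p \<partial>M) + (\<integral>x. \<bar>g x\<bar> powr p \<partial>M))" using i by simp
  finally show "(\<integral>x. \<bar>f x + g x\<bar> powr p \<partial>M) \<le> \<dots>" .
qed

lemma Lp_space_cmult:
  assumes "f \<in> Lp_space p M"
  shows "(\<lambda>x. c * f x) \<in> Lp_space p M"
  using assms by (auto simp: Lp_space_def abs_mult powr_mult)

lemma Lp_space_diff:
  assumes "p > 0" "f \<in> Lp_space p M" "g \<in> Lp_space p M"
  shows "(\<lambda>x. f x - g x) \<in> Lp_space p M"
  using Lp_space_add(1)[OF assms(1,2) Lp_space_cmult[OF assms(3), of "-1"]] by simp

lemma bounded_in_Lp_tri:
  assumes "f \<in> borel_measurable tri_measure" "\<And>z. z \<in> hemi_triangle \<Longrightarrow> \<bar>f z\<bar> \<le> B" "p > 0"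
  shows "f \<in> Lp_space p tri_measure"
proof -
  interpret finite_measure tri_measure by (rule finite_measure_tri)
  have "integrable tri_measure (\<lambda>x. \<bar>f x\<bar> powr p)"
    by (rule integrable_const_bound[of _ "B powr p"]) (use assms in \<open>auto intro!: AE_I2 powr_mono2\<close>)
  then show ?thesis using assms by (simp add: Lp_space_def)
qed

lemma continuous_on_mode_span: "P \<in> mode_span \<Longrightarrow> continuous_on S P"
  unfolding mode_span_def by (auto intro!: continuous_intros continuous_on_mode)

lemma tri_coord_measurable:
  assumes "continuous_on UNIV P"
  shows "(\<lambda>z. P (tri_coord z)) \<in> borel_measurable tri_measure"
  by (intro tri_measure_borel_measurable borel_measurable_continuous_onI
      continuous_on_compose2[OF assms continuous_on_tri_coord]) auto

lemma continuous_in_Lp_tri: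
  assumes "continuous_on UNIV P" "p > 0"
  shows "(\<lambda>z. P (tri_coord z)) \<in> Lp_space p tri_measure"
proof -
  have "compact ((\<lambda>z. P (tri_coord z)) ` hemi_triangle)"
    by (intro compact_continuous_image compact_hemi_triangle
        continuous_on_compose2[OF assms(1) continuous_on_tri_coord]) auto
  then obtain B where "\<And>z. z \<in> hemi_triangle \<Longrightarrow> \<bar>P (tri_coord z)\<bar> \<le> B"
    by (force dest!: compact_imp_bounded simp: bounded_iff)
  then show ?thesis using bounded_in_Lp_tri[OF tri_coord_measurable[OF assms(1)]] assms(2) by blast
qed

text \<open>Truncating f at height k reduces to the bounded case. Dominated convergence is used
  twice, with majorant |f|^p for the truncations and a constant for the approximants.\<close>

lemma mode_dense:
  assumes f: "f \<in> Lp_space p tri_measure" and p: "p > 0" and e: "e > 0"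
  shows "\<exists>P\<in>mode_span. (\<integral>z. \<bar>f z - P (tri_coord z)\<bar> powr p \<partial>tri_measure) < e"
proof -
  interpret finite_measure tri_measure by (rule finite_measure_tri)
  have [measurable]: "f \<in> borel_measurable tri_measure" and fi: "integrable tri_measure (\<lambda>z. \<bar>f z\<bar> powr p)"
    using f by (auto simp: Lp_space_def)
  define e' where "e' = e / (2 powr p * 2)"
  have e': "e' > 0" using e by (simp add: e'_def)
  define h where "h = (\<lambda>k::nat. \<lambda>z. max (- real k) (min (real k) (f z)))"
  have hm: "h k \<in> borel_measurable tri_measure" for k unfolding h_def by measurable
  have hB: "\<bar>h k z\<bar> \<le> real k" for k z by (auto simp: h_def)
  have "(\<lambda>k. \<integral>z. \<bar>f z - h k z\<bar> powr p \<partial>tri_measure) \<longlonglongrightarrow> (\<integral>z. 0 \<partial>tri_measure)"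
  proof (rule integral_dominated_convergence[OF _ _ fi])
    show "AE z in tri_measure. (\<lambda>k. \<bar>f z - h k z\<bar> powr p) \<longlonglongrightarrow> 0"
    proof (rule AE_I2)
      fix z
      obtain K where "\<bar>f z\<bar> \<le> real K" using real_arch_simple by blast
      then have "\<forall>\<^sub>F k in sequentially. \<bar>f z - h k z\<bar> powr p = 0"
        by (intro eventually_sequentiallyI[of K]) (auto simp: h_def)
      then show "(\<lambda>k. \<bar>f z - h k z\<bar> powr p) \<longlonglongrightarrow> 0" by (rule tendsto_eventually)
    qed
    show "AE z in tri_measure. norm (\<bar>f z - h k z\<bar> powr p) \<le> \<bar>f z\<bar> powr p" for k
      using p by (intro AE_I2) (auto intro!: powr_mono2 simp: h_def)
  qed (use hm in auto)
  then have "\<forall>\<^sub>F k in sequentially. (\<integral>z. \<bar>f z - h k z\<bar> powr p \<partial>tri_measure) < e'"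
    using e' by (simp add: order_tendsto_iff)
  then obtain k where k: "(\<integral>z. \<bar>f z - h k z\<bar> powr p \<partial>tri_measure) < e'"
    using eventually_happens trivial_limit_sequentially by blast
  obtain P where P: "\<And>n. P n \<in> mode_span" "\<And>n z. z \<in> hemi_triangle \<Longrightarrow> \<bar>P n (tri_coord z)\<bar> \<le> real k + 1"
    "AE z in tri_measure. (\<lambda>n. P n (tri_coord z)) \<longlonglongrightarrow> h k z"
    using mode_dense_bounded[OF hm hB] by blast
  have Pm: "(\<lambda>z. P n (tri_coord z)) \<in> borel_measurable tri_measure" for n
    by (rule tri_coord_measurable) (rule continuous_on_mode_span[OF P(1)])
  have "(\<lambda>n. \<integral>z. \<bar>h k z - P n (tri_coord z)\<bar> powr p \<partial>tri_measure) \<longlonglongrightarrow> (\<integral>z. 0 \<partial>tri_measure)"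
  proof (rule integral_dominated_convergence)
    \<comment> \<open>k bounds the truncated function and k + 1 its approximants.\<close>
    show "integrable tri_measure (\<lambda>z. (2 * real k + 1) powr p)" by simp
    show "AE z in tri_measure. (\<lambda>n. \<bar>h k z - P n (tri_coord z)\<bar> powr p) \<longlonglongrightarrow> 0"
      using P(3)
    proof eventually_elim
      case (elim z)
      have "(\<lambda>n. \<bar>h k z - P n (tri_coord z)\<bar>) \<longlonglongrightarrow> \<bar>h k z - h k z\<bar>"
        by (intro tendsto_intros elim)
      then have "(\<lambda>n. \<bar>h k z - P n (tri_coord z)\<bar>) \<longlonglongrightarrow> 0" by simp
      from tendsto_powr'[OF this tendsto_const[of p]] p
      show ?case by simp
    qed
    show "AE z in tri_measure. norm (\<bar>h k z - P n (tri_coord z)\<bar> powr p) \<le> (2 * real k + 1) powr p" for n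
    proof (rule AE_I2)
      fix z assume "z \<in> space tri_measure"
      then have "\<bar>h k z - P n (tri_coord z)\<bar> \<le> 2 * real k + 1"
        using P(2)[of z n] hB[of k z] by simp
      then show "norm (\<bar>h k z - P n (tri_coord z)\<bar> powr p) \<le> (2 * real k + 1) powr p"
        using p by (simp add: powr_mono2)
    qed
  qed (use hm Pm in auto)
  then have "\<forall>\<^sub>F n in sequentially. (\<integral>z. \<bar>h k z - P n (tri_coord z)\<bar> powr p \<partial>tri_measure) < e'"
    using e' by (simp add: order_tendsto_iff)
  then obtain n where n: "(\<integral>z. \<bar>h k z - P n (tri_coord z)\<bar> powr p \<partial>tri_measure) < e'"
    using eventually_happens trivial_limit_sequentially by blast
  have hL: "h k \<in> Lp_space p tri_measure" using bounded_in_Lp_tri[OF hm hB p] .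
  have PL: "(\<lambda>z. P n (tri_coord z)) \<in> Lp_space p tri_measure"
    using bounded_in_Lp_tri[OF Pm P(2) p] .
  have "(\<integral>z. \<bar>(f z - h k z) + (h k z - P n (tri_coord z))\<bar> powr p \<partial>tri_measure)
    \<le> 2 powr p * ((\<integral>z. \<bar>f z - h k z\<bar> powr p \<partial>tri_measure) + (\<integral>z. \<bar>h k z - P n (tri_coord z)\<bar> powr p \<partial>tri_measure))"
    by (intro Lp_space_add(2) Lp_space_diff p f hL PL)
  also have "\<dots> < 2 powr p * (e' + e')" using k n by (intro mult_strict_left_mono add_strict_mono) auto
  also have "\<dots> = e" by (simp add: e'_def)
  finally show ?thesis using P(1)[of n] by auto
qed

section \<open>Partial sums\<close>

lemma of_real_cos_sin: "complex_of_real (cos u * sin v) =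
  (cis (u + v) - cis (u - v) + cis (- u + v) - cis (- u - v)) / (4 * \<i>)"
  by (simp add: complex_eq_iff cos_add cos_diff sin_add sin_diff)

text \<open>The three frequency pairs of \<open>wave_eq_cos_sin\<close>; the last component is the
  sign with which the product enters the wave.\<close>

definition freqs :: "int \<times> int \<Rightarrow> nat \<Rightarrow> int \<times> int \<times> int" where
  "freqs l j = (let n = snd l; k = (fst l - n) div 2 in [(fst l, n, 1), (2 * n + k, k, 1), (n - k, n + k, -1)] ! j)"

text \<open>A branch \<open>(j, s, t)\<close> picks the \<open>j\<close>-th product of a cosine and a sine in a wave and the signs of the two
  frequencies in its expansion into exponentials.\<close>

definition branches :: "(nat \<times> int \<times> int) set" where
  "branches = {0, 1, 2} \<times> {1, -1} \<times> {1, -1}"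

definition frequency1 :: "(int \<times> int) \<times> nat \<times> int \<times> int \<Rightarrow> int" where
  "frequency1 = (\<lambda>(l, j, s, t). s * fst (freqs l j))"

definition frequency2 :: "(int \<times> int) \<times> nat \<times> int \<times> int \<Rightarrow> int" where
  "frequency2 = (\<lambda>(l, j, s, t). t * fst (snd (freqs l j)))"

definition branch_coeff :: "(int \<times> int \<Rightarrow> real) \<Rightarrow> (int \<times> int) \<times> nat \<times> int \<times> int \<Rightarrow> complex" where
  "branch_coeff a = (\<lambda>(l, j, s, t). of_real (a l) * of_int (snd (snd (freqs l j))) * of_int t / (4 * \<i>))"

lemma trig_poly2_mode:
  assumes "finite L" and par: "\<And>l. l \<in> L \<Longrightarrow> fst l mod 2 = snd l mod 2"
  shows "trig_poly2 (L \<times> branches) (branch_coeff a) frequency1 frequency2 x y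
    = of_real (\<Sum>l\<in>L. a l * mode l (x, y))"
proof -
  have product: "of_real (cos_sin \<alpha> \<beta> (x, y)) = (\<Sum>(s, t)\<in>{1, -1} \<times> {1, -1 :: int}.
      of_int t / (4 * \<i>) * cis (of_int (s * \<alpha>) * x + of_int (t * \<beta>) * y))" for \<alpha> \<beta> :: int
    unfolding cos_sin_def fst_conv snd_conv of_real_cos_sin sum.cartesian_product[symmetric]
    by (simp add: field_simps)
  have branch: "of_real (a l * mode l (x, y)) = (\<Sum>b\<in>branches. branch_coeff a (l, b) *
     cis (of_int (frequency1 (l, b)) * x + of_int (frequency2 (l, b)) * y))" if lL: "l \<in> L" for l
  proof -
    obtain k where k: "fst l = snd l + 2 * k" "\<And>x y. wave (of_int (fst l)) (of_int (snd l)) x y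
        = cos_sin (fst l) (snd l) (x, y) + cos_sin (2 * snd l + k) k (x, y) - cos_sin (snd l - k) (snd l + k) (x, y)"
      using wave_eq_cos_sin[OF par[OF lL]] by blast
    have fr: "freqs l 0 = (fst l, snd l, 1)" "freqs l (Suc 0) = (2 * snd l + k, k, 1)"
      "freqs l 2 = (snd l - k, snd l + k, -1)"
      using k(1) by (simp_all add: freqs_def Let_def)
    define h where "h = (\<lambda>b. branch_coeff a (l, b) *
     cis (of_int (frequency1 (l, b)) * x + of_int (frequency2 (l, b)) * y))"
    have H: "(\<Sum>st\<in>{1, -1} \<times> {1, -1}. h (j, st)) = of_real (a l) * of_int (snd (snd (freqs l j)))
       * of_real (cos_sin (fst (freqs l j)) (fst (snd (freqs l j))) (x, y))" for j
      unfolding product sum_distrib_left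
      by (intro sum.cong) (auto simp: h_def branch_coeff_def frequency1_def frequency2_def)
    have "(\<Sum>b\<in>branches. h b) = (\<Sum>j\<in>{0, 1, 2}. \<Sum>st\<in>{1, -1} \<times> {1, -1}. h (j, st))"
      unfolding branches_def by (simp only: sum.cartesian_product case_prod_unfold prod.collapse)
    also have "\<dots> = of_real (a l * mode l (x, y))"
      unfolding H by (simp add: fr mode_def k(2) algebra_simps)
    finally show ?thesis by (simp add: h_def)
  qed
  have "trig_poly2 (L \<times> branches) (branch_coeff a) frequency1 frequency2 x y =
    (\<Sum>l\<in>L. \<Sum>b\<in>branches. branch_coeff a (l, b) *
     cis (of_int (frequency1 (l, b)) * x + of_int (frequency2 (l, b)) * y))"
    unfolding trig_poly2_def by (simp only: sum.cartesian_product case_prod_unfold prod.collapse)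
  also have "\<dots> = of_real (\<Sum>l\<in>L. a l * mode l (x, y))"
    unfolding of_real_sum by (intro sum.cong refl branch[symmetric])
  finally show ?thesis .
qed

text \<open>A pair (a, b) and its sign changes lie in the hexagon iff max |b| ((|a| + |b|) / 2) <=
  N. For each of the three pairs of a mode with index (m, n) in the chamber this maximum equals n:
  the hexagon is invariant under the group and keeps or drops a mode as a whole.\<close>

lemma branches_hexagon:
  fixes N :: int
  shows "{i \<in> tri_index M \<times> branches. \<bar>frequency2 i\<bar> \<le> N \<and> \<bar>frequency1 i + frequency2 i\<bar> \<le> 2 * N
    \<and> \<bar>frequency1 i - frequency2 i\<bar> \<le> 2 * N} = {l \<in> tri_index M. snd l \<le> N} \<times> branches"
proof -
  have key: "(\<bar>frequency2 (l, b)\<bar> \<le> N \<and> \<bar>frequency1 (l, b) + frequency2 (l, b)\<bar> \<le> 2 * N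
    \<and> \<bar>frequency1 (l, b) - frequency2 (l, b)\<bar> \<le> 2 * N) \<longleftrightarrow> snd l \<le> N"
    if l: "l \<in> tri_index M" and b: "b \<in> branches" for l b
  proof -
    obtain m n where mn: "l = (m, n)" by (cases l)
    then have l2: "snd l = n" by simp
    obtain j s t where jst: "b = (j, s, t)" by (cases b)
    have c: "0 \<le> m" "m < n" "m mod 2 = n mod 2" using l by (auto simp: mn tri_index_def)
    define k where "k = (m - n) div 2"
    have k: "m = n + 2 * k" using c(3) unfolding k_def by presburger
    have fr: "freqs l 0 = (n + 2 * k, n, 1)" "freqs l (Suc 0) = (2 * n + k, k, 1)"
      "freqs l 2 = (n - k, n + k, -1)"
      unfolding freqs_def Let_def mn fst_conv snd_conv k_def[symmetric] k[symmetric] by simp_all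
    have nk: "k < 0" "0 \<le> n + 2 * k" using c k by auto
    have "s = 1 \<or> s = -1" "t = 1 \<or> t = -1" and j: "j = 0 \<or> j = Suc 0 \<or> j = 2"
      using b unfolding branches_def jst by auto
    then have h: "(\<bar>t * y\<bar> \<le> N \<and> \<bar>s * x + t * y\<bar> \<le> 2 * N \<and> \<bar>s * x - t * y\<bar> \<le> 2 * N)
        \<longleftrightarrow> \<bar>y\<bar> \<le> N \<and> \<bar>x\<bar> + \<bar>y\<bar> \<le> 2 * N" for x y
      by (elim disjE; simp; linarith)
    have "\<bar>n\<bar> \<le> N \<and> \<bar>n + 2 * k\<bar> + \<bar>n\<bar> \<le> 2 * N \<longleftrightarrow> n \<le> N"
      "\<bar>k\<bar> \<le> N \<and> \<bar>2 * n + k\<bar> + \<bar>k\<bar> \<le> 2 * N \<longleftrightarrow> n \<le> N"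
      "\<bar>n + k\<bar> \<le> N \<and> \<bar>n - k\<bar> + \<bar>n + k\<bar> \<le> 2 * N \<longleftrightarrow> n \<le> N"
      using nk by linarith+
    with j show ?thesis
      unfolding jst frequency1_def frequency2_def case_prod_conv h
      by (elim disjE; simp only: fr fst_conv snd_conv l2)
  qed
  show ?thesis
  proof (rule set_eqI)
    fix i :: "(int \<times> int) \<times> nat \<times> int \<times> int"
    obtain l b where i: "i = (l, b)" by (cases i)
    show "i \<in> {i \<in> tri_index M \<times> branches. \<bar>frequency2 i\<bar> \<le> N \<and> \<bar>frequency1 i + frequency2 i\<bar> \<le> 2 * N
      \<and> \<bar>frequency1 i - frequency2 i\<bar> \<le> 2 * N} \<longleftrightarrow> i \<in> {l \<in> tri_index M. snd l \<le> N} \<times> branches"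
      using key[of l b] unfolding i mem_Collect_eq mem_Sigma_iff by blast
  qed
qed

lemma mode_sum_symmetries:
  fixes P :: "real \<times> real \<Rightarrow> real"
  assumes P: "P = (\<lambda>z. \<Sum>l\<in>L. a l * mode l z)" and L: "L \<subseteq> tri_index M"
  shows "P (2 * pi - x, y) = P (x, y)" "P (x, 2 * pi - y) = - P (x, y)"
    "P (pi - x, pi - y) = - P (x, y)" "P ((y - x) / 2, (3 * x + y) / 2) = - P (x, y)"
proof -
  have par: "fst l mod 2 = snd l mod 2" if "l \<in> L" for l
    using that L by (auto simp: tri_index_def)
  show "P (2 * pi - x, y) = P (x, y)" "P (x, 2 * pi - y) = - P (x, y)"
    "P (pi - x, pi - y) = - P (x, y)" "P ((y - x) / 2, (3 * x + y) / 2) = - P (x, y)"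
    unfolding P mode_def fst_conv snd_conv sum_negf[symmetric]
    by (intro sum.cong refl; simp add: wave_periodic[OF par] wave_point_symmetries)+
qed

text \<open>A sum of modes changes sign under some of the reflections, but its absolute value is
  invariant, so the integral over the triangle unfolds to the torus.\<close>

lemma integral_powr_mode_sum:
  fixes a :: "int \<times> int \<Rightarrow> real"
  assumes p: "p > 0" and L: "L \<subseteq> tri_index M"
  shows "(\<integral>z. \<bar>\<Sum>l\<in>L. a l * mode l (tri_coord z)\<bar> powr p \<partial>tri_measure) = sqrt 3 / (24 * pi\<^sup>2) *
    powr_int2 p (trig_poly2 (L \<times> branches) (branch_coeff a) frequency1 frequency2)"
proof -
  define P where "P = (\<lambda>z. \<Sum>l\<in>L. a l * mode l z)"
  have fin: "finite L" using L finite_tri_index finite_subset by blast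
  have par: "fst l mod 2 = snd l mod 2" if "l \<in> L" for l
    using that L by (auto simp: tri_index_def)
  have contP: "continuous_on S P" for S
    unfolding P_def by (intro continuous_intros continuous_on_mode)
  have cont: "continuous_on S (\<lambda>z. \<bar>P z\<bar> powr p)" for S
    using continuous_on_norm_powr[OF contP p] by simp
  have "(\<integral>z. \<bar>P (tri_coord z)\<bar> powr p \<partial>tri_measure) = sqrt 3 / (24 * pi\<^sup>2) *
    integral (cbox (0, 0) (2*pi, 2*pi)) (\<lambda>z. \<bar>P z\<bar> powr p)"
    by (rule integral_tri_eq_cbox[OF cont]) (simp_all add: mode_sum_symmetries[OF P_def L])
  also have "integral (cbox (0, 0) (2*pi, 2*pi)) (\<lambda>z. \<bar>P z\<bar> powr p)
     = powr_int2 p (trig_poly2 (L \<times> branches) (branch_coeff a) frequency1 frequency2)"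
    unfolding integral_prod_continuous[OF cont]
    by (simp add: powr_int2_def powr_int_def trig_poly2_mode[OF fin par] P_def del: of_real_sum of_real_mult)
  finally show ?thesis by (simp add: P_def)
qed

lemma mode_truncation_bound:
  assumes p: "1 < (p :: real)"
  shows "\<exists>C\<ge>0. \<forall>a M N. (\<integral>z. \<bar>\<Sum>l\<in>{l \<in> tri_index M. snd l \<le> int N}. a l * mode l (tri_coord z)\<bar> powr p \<partial>tri_measure)
    \<le> C * (\<integral>z. \<bar>\<Sum>l\<in>tri_index M. a l * mode l (tri_coord z)\<bar> powr p \<partial>tri_measure)"
proof -
  from riesz_hexagon[OF p] obtain C where C: "C \<ge> 0"
    and R: "\<And>(I :: ((int \<times> int) \<times> nat \<times> int \<times> int) set) c m n (N :: int). finite I \<Longrightarrow>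
    powr_int2 p (trig_poly2 {i\<in>I. \<bar>n i\<bar> \<le> N \<and> \<bar>m i + n i\<bar> \<le> 2 * N \<and> \<bar>m i - n i\<bar> \<le> 2 * N} c m n)
      \<le> C * powr_int2 p (trig_poly2 I c m n)" by blast
  have p0: "p > 0" using p by simp
  show ?thesis
  proof (intro exI[of _ C] conjI C allI)
    fix a :: "int \<times> int \<Rightarrow> real" and M N
    let ?L = "{l \<in> tri_index M. snd l \<le> int N}"
    have fin: "finite (tri_index M \<times> branches)"
      by (simp add: finite_tri_index branches_def)
    have "powr_int2 p (trig_poly2 (?L \<times> branches) (branch_coeff a) frequency1 frequency2)
       \<le> C * powr_int2 p (trig_poly2 (tri_index M \<times> branches) (branch_coeff a) frequency1 frequency2)"
      using R[OF fin, of frequency2 "int N" frequency1 "branch_coeff a"] unfolding branches_hexagon .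
    then have "sqrt 3 / (24 * pi\<^sup>2) * powr_int2 p (trig_poly2 (?L \<times> branches) (branch_coeff a) frequency1 frequency2)
       \<le> sqrt 3 / (24 * pi\<^sup>2) * (C * powr_int2 p (trig_poly2 (tri_index M \<times> branches) (branch_coeff a) frequency1 frequency2))"
      by (intro mult_left_mono) auto
    then show "(\<integral>z. \<bar>\<Sum>l\<in>?L. a l * mode l (tri_coord z)\<bar> powr p \<partial>tri_measure)
    \<le> C * (\<integral>z. \<bar>\<Sum>l\<in>tri_index M. a l * mode l (tri_coord z)\<bar> powr p \<partial>tri_measure)"
      unfolding integral_powr_mode_sum[OF p0 subset_refl]
      by (subst integral_powr_mode_sum[OF p0, of ?L M]) (auto simp: mult_ac)
  qed
qed

section \<open>Coefficients, orthogonality and continuity of a single partial sum\<close>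

lemma mode_orthogonal_tri:
  assumes "l \<in> tri_index M" "l' \<in> tri_index M'" "l \<noteq> l'"
  shows "(\<integral>z. mode l (tri_coord z) * mode l' (tri_coord z) \<partial>tri_measure) = 0"
proof -
  have s: "mode l = (\<lambda>z. \<Sum>l\<in>{l}. 1 * mode l z)" for l by simp
  have sub: "{l} \<subseteq> tri_index M" "{l'} \<subseteq> tri_index M'" using assms by auto
  note sym = mode_sum_symmetries[OF s sub(1)] mode_sum_symmetries[OF s sub(2)]
  have "(\<integral>z. mode l (tri_coord z) * mode l' (tri_coord z) \<partial>tri_measure) = sqrt 3 / (24 * pi\<^sup>2) *
    integral (cbox (0, 0) (2*pi, 2*pi)) (\<lambda>z. mode l z * mode l' z)"
    by (rule integral_tri_eq_cbox) (simp_all add: sym continuous_on_mult continuous_on_mode)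
  also have "integral (cbox (0, 0) (2*pi, 2*pi)) (\<lambda>z. mode l z * mode l' z) = 0"
    unfolding mode_def by (rule wave_orthogonal) (use assms in \<open>auto simp: tri_index_def prod_eq_iff\<close>)
  finally show ?thesis by simp
qed

text \<open>A substitute for Hoelder's inequality on a finite measure space: for |x| > \<delta>
  write |x| = |x|^(1-p) |x|^p, where the exponent 1 - p is nonpositive.\<close>

lemma abs_le_powr_split: "\<bar>x\<bar> \<le> \<delta> + \<delta> powr (1 - p) * \<bar>x\<bar> powr p" if "p \<ge> 1" "\<delta> > 0" for x :: real
proof (cases "\<bar>x\<bar> \<le> \<delta>")
  case True
  then show ?thesis by (simp add: add_increasing2)
next
  case False
  have "\<bar>x\<bar> = \<bar>x\<bar> powr (1 - p) * \<bar>x\<bar> powr p" using False that by (simp add: powr_add[symmetric])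
  also have "\<dots> \<le> \<delta> powr (1 - p) * \<bar>x\<bar> powr p"
    using False that by (intro mult_right_mono powr_mono2') auto
  finally show ?thesis using that by simp
qed

lemma Lp_imp_integrable:
  assumes "f \<in> Lp_space p tri_measure" "p \<ge> 1"
  shows "integrable tri_measure f"
proof -
  interpret finite_measure tri_measure by (rule finite_measure_tri)
  have f: "f \<in> borel_measurable tri_measure" and i: "integrable tri_measure (\<lambda>z. \<bar>f z\<bar> powr p)"
    using assms by (auto simp: Lp_space_def)
  have "integrable tri_measure (\<lambda>z. 1 + 1 powr (1 - p) * \<bar>f z\<bar> powr p)" using i by auto
  then show ?thesis
    by (rule Bochner_Integration.integrable_bound[OF _ f])
       (intro AE_I2, use abs_le_powr_split[OF assms(2), of 1 "f _"] in \<open>simp add: abs_of_nonneg\<close>)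
qed

lemma L1_small:
  assumes "p \<ge> 1" "\<eta> > 0"
  shows "\<exists>\<epsilon>>0. \<forall>u\<in>Lp_space p tri_measure. power_integral p u < \<epsilon> \<longrightarrow> (\<integral>z. \<bar>u z\<bar> \<partial>tri_measure) < \<eta>"
proof -
  interpret finite_measure tri_measure by (rule finite_measure_tri)
  define \<mu> where "\<mu> = measure tri_measure (space tri_measure)"
  have \<mu>: "\<mu> \<ge> 0" by (simp add: \<mu>_def)
  \<comment> \<open>\<delta> uses up half of \<eta> and \<epsilon> the other half;
    \<open>\<mu> + 1\<close> keeps the denominator positive.\<close>
  define \<delta> where "\<delta> = \<eta> / (2 * (\<mu> + 1))"
  have \<delta>: "\<delta> > 0" using assms \<mu> by (simp add: \<delta>_def)
  define \<epsilon> where "\<epsilon> = \<eta> / (2 * \<delta> powr (1 - p))"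
  have \<epsilon>: "\<epsilon> > 0" using assms \<delta> by (simp add: \<epsilon>_def)
  have "(\<integral>z. \<bar>u z\<bar> \<partial>tri_measure) < \<eta>" if u: "u \<in> Lp_space p tri_measure"
    and s: "power_integral p u < \<epsilon>" for u
  proof -
    have i: "integrable tri_measure (\<lambda>z. \<bar>u z\<bar> powr p)" using u by (simp add: Lp_space_def)
    have "(\<integral>z. \<bar>u z\<bar> \<partial>tri_measure) \<le> (\<integral>z. \<delta> + \<delta> powr (1 - p) * \<bar>u z\<bar> powr p \<partial>tri_measure)"
      using i Lp_imp_integrable[OF u assms(1)] abs_le_powr_split[OF assms(1) \<delta>] by (intro integral_mono) auto
    also have "\<dots> = \<delta> * \<mu> + \<delta> powr (1 - p) * power_integral p u"
      using i by (simp add: \<mu>_def mult.commute)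
    also have "\<dots> < \<delta> * \<mu> + \<delta> powr (1 - p) * \<epsilon>"
      using s \<delta> by (intro add_strict_left_mono mult_strict_left_mono) auto
    also have "\<delta> powr (1 - p) * \<epsilon> = \<eta> / 2" using \<delta> by (simp add: \<epsilon>_def)
    also have "\<delta> * \<mu> + \<eta> / 2 \<le> \<eta>"
    proof -
      have "\<delta> * \<mu> \<le> \<delta> * (\<mu> + 1)" using \<delta> by (intro mult_left_mono) auto
      also have "\<dots> = \<eta> / 2" using \<mu> by (simp add: \<delta>_def field_simps)
      finally show ?thesis by simp
    qed
    finally show ?thesis .
  qed
  then show ?thesis using \<epsilon> by blast
qed

definition mode_coeff :: "(real \<times> real \<Rightarrow> real) \<Rightarrow> int \<times> int \<Rightarrow> real" where
  "mode_coeff g l = (\<integral>z. g z * mode l (tri_coord z) \<partial>tri_measure) / (\<integral>z. (mode l (tri_coord z))\<^sup>2 \<partial>tri_measure)"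

text \<open>The factor between eigenfunction and mode occurs twice in the numerator, in the integral
  and in the function, and twice in the squared norm, so it cancels.\<close>

lemma tri_partial_sum_mode: "tri_partial_sum N g z = (\<Sum>l\<in>tri_index N. mode_coeff g l * mode l (tri_coord z))"
proof -
  have "tri_coeff g m n * tri_eigfun m n z = mode_coeff g (m, n) * mode (m, n) (tri_coord z)"
    if "(m, n) \<in> tri_index N" for m n
  proof -
    define s :: real where "s = - 2 * (-1) powi n"
    have s: "s \<noteq> 0" by (simp add: s_def)
    have par: "m mod 2 = n mod 2" using that by (simp add: tri_index_def)
    have e: "tri_eigfun m n z = s * mode (m, n) (tri_coord z)" for z
      using tri_eigfun_wave[OF par, of "fst z" "snd z"] by (simp add: s_def mode_def tri_coord_def)
    have "(Lp_norm 2 tri_measure (tri_eigfun m n))\<^sup>2 = (\<integral>z. \<bar>tri_eigfun m n z\<bar> powr 2 \<partial>tri_measure)"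
      unfolding Lp_norm_def by (subst powr_half_sqrt) (auto intro: integral_nonneg_AE)
    also have "\<dots> = s\<^sup>2 * (\<integral>z. (mode (m, n) (tri_coord z))\<^sup>2 \<partial>tri_measure)"
      by (simp add: e powr_numeral power_mult_distrib)
    finally have n: "(Lp_norm 2 tri_measure (tri_eigfun m n))\<^sup>2 = s\<^sup>2 * (\<integral>z. (mode (m, n) (tri_coord z))\<^sup>2 \<partial>tri_measure)" .
    have i: "(\<integral>z. g z * tri_eigfun m n z \<partial>tri_measure) = s * (\<integral>z. g z * mode (m, n) (tri_coord z) \<partial>tri_measure)"
      unfolding e by (simp add: mult.left_commute)
    show ?thesis unfolding tri_coeff_def n i unfolding e mode_coeff_def using s by (simp add: power2_eq_square)
  qed
  then show ?thesis
    unfolding tri_partial_sum_def by (intro sum.cong) (auto simp: case_prod_unfold)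
qed

lemma integrable_times_mode:
  assumes "integrable tri_measure g"
  shows "integrable tri_measure (\<lambda>z. g z * mode l (tri_coord z))"
proof (rule Bochner_Integration.integrable_bound)
  show "integrable tri_measure (\<lambda>z. 3 * g z)" using assms by simp
  show "(\<lambda>z. g z * mode l (tri_coord z)) \<in> borel_measurable tri_measure"
    using assms tri_coord_measurable[OF continuous_on_mode[of UNIV l]] by (intro borel_measurable_times) auto
  have "\<bar>g z\<bar> * \<bar>mode l w\<bar> \<le> \<bar>g z\<bar> * 3" for z w
    using mode_bound by (intro mult_left_mono) auto
  then show "AE z in tri_measure. norm (g z * mode l (tri_coord z)) \<le> norm (3 * g z)"
    by (intro AE_I2) (simp add: abs_mult mult.commute)
qed

lemma mode_in_Lp: "p > 0 \<Longrightarrow> (\<lambda>z. mode l (tri_coord z)) \<in> Lp_space p tri_measure"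
  by (rule continuous_in_Lp_tri[OF continuous_on_mode])

lemma mode_coeff_add:
  assumes "integrable tri_measure f" "integrable tri_measure g"
  shows "mode_coeff (\<lambda>z. f z + g z) l = mode_coeff f l + mode_coeff g l"
  using integrable_times_mode[OF assms(1), of l] integrable_times_mode[OF assms(2), of l]
  by (simp add: mode_coeff_def distrib_right add_divide_distrib)

text \<open>The equality is only claimed almost everywhere, so that the norms of the eigenfunctions need not be
  computed: a mode of norm 0 vanishes almost everywhere.\<close>

lemma mode_coeff_sum:
  assumes l: "l \<in> tri_index N"
  shows "AE z in tri_measure. mode_coeff (\<lambda>z. \<Sum>l\<in>tri_index M. a l * mode l (tri_coord z)) l * mode l (tri_coord z)
    = (if l \<in> tri_index M then a l else 0) * mode l (tri_coord z)"
proof -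
  define D where "D = (\<integral>z. (mode l (tri_coord z))\<^sup>2 \<partial>tri_measure)"
  have int: "integrable tri_measure (\<lambda>z. mode l' (tri_coord z) * mode l (tri_coord z))" for l'
    by (intro integrable_times_mode Lp_imp_integrable[OF mode_in_Lp[of 1]]) auto
  have "(\<integral>z. (\<Sum>l\<in>tri_index M. a l * mode l (tri_coord z)) * mode l (tri_coord z) \<partial>tri_measure)
    = (\<integral>z. (\<Sum>l'\<in>tri_index M. a l' * (mode l' (tri_coord z) * mode l (tri_coord z))) \<partial>tri_measure)"
    by (simp add: sum_distrib_right mult.assoc)
  also have "\<dots> = (\<Sum>l'\<in>tri_index M. a l' * (\<integral>z. mode l' (tri_coord z) * mode l (tri_coord z) \<partial>tri_measure))"
    using int by (subst Bochner_Integration.integral_sum) auto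
  also have "\<dots> = (\<Sum>l'\<in>tri_index M. if l' = l then a l * D else 0)"
    using mode_orthogonal_tri[OF _ l] by (intro sum.cong) (auto simp: D_def power2_eq_square)
  also have "\<dots> = (if l \<in> tri_index M then a l else 0) * D"
    using finite_tri_index by simp
  finally have c: "mode_coeff (\<lambda>z. \<Sum>l\<in>tri_index M. a l * mode l (tri_coord z)) l = (if l \<in> tri_index M then a l else 0) * D / D"
    by (simp add: mode_coeff_def D_def)
  show ?thesis
  proof (cases "D = 0")
    case False
    then show ?thesis unfolding c by simp
  next
    case True
    have "AE z in tri_measure. (mode l (tri_coord z))\<^sup>2 = 0"
      using int[of l] True unfolding D_def
      by (subst integral_nonneg_eq_0_iff_AE[symmetric]) (auto simp: power2_eq_square)
    then show ?thesis by eventually_elim simp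
  qed
qed

lemma tri_partial_sum_span:
  "AE z in tri_measure. tri_partial_sum N (\<lambda>z. \<Sum>l\<in>tri_index M. a l * mode l (tri_coord z)) z
    = (\<Sum>l\<in>{l \<in> tri_index M. snd l \<le> int N}. a l * mode l (tri_coord z))"
proof -
  have "AE z in tri_measure. \<forall>l\<in>tri_index N. mode_coeff (\<lambda>z. \<Sum>l\<in>tri_index M. a l * mode l (tri_coord z)) l * mode l (tri_coord z)
    = (if l \<in> tri_index M then a l else 0) * mode l (tri_coord z)"
    using mode_coeff_sum by (intro AE_finite_allI finite_tri_index) auto
  then show ?thesis
  proof eventually_elim
    case (elim z)
    have "{l \<in> tri_index M. snd l \<le> int N} = {l \<in> tri_index N. l \<in> tri_index M}"
      by (auto simp: tri_index_def)
    then show ?case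
      unfolding tri_partial_sum_mode using elim
      by (simp add: sum.inter_filter finite_tri_index if_distrib[of "\<lambda>x. x * _"] cong: if_cong sum.cong)
  qed
qed

lemma tri_partial_sum_in_Lp: "p > 0 \<Longrightarrow> tri_partial_sum N g \<in> Lp_space p tri_measure"
  using continuous_in_Lp_tri[of "\<lambda>z. \<Sum>l\<in>tri_index N. mode_coeff g l * mode l z" p]
  by (simp add: tri_partial_sum_mode[abs_def] continuous_on_sum continuous_on_mult_left continuous_on_mode)

lemma tri_partial_sum_add:
  assumes "integrable tri_measure f" "integrable tri_measure g"
  shows "tri_partial_sum N (\<lambda>z. f z + g z) z = tri_partial_sum N f z + tri_partial_sum N g z"
  by (simp add: tri_partial_sum_mode mode_coeff_add[OF assms] distrib_right sum.distrib)

lemma tri_partial_sum_L1_bound: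
  "\<exists>K\<ge>0. \<forall>g. integrable tri_measure g \<longrightarrow> (\<forall>z. \<bar>tri_partial_sum N g z\<bar> \<le> K * (\<integral>z. \<bar>g z\<bar> \<partial>tri_measure))"
proof -
  define D where "D = (\<lambda>l. (\<integral>z. (mode l (tri_coord z))\<^sup>2 \<partial>tri_measure))"
  have D: "D l \<ge> 0" for l by (simp add: D_def)
  \<comment> \<open>9 is the square of the bound 3 for a mode, used in the coefficient and in the
    function. If \<open>D l = 0\<close>, division by zero gives 0 both here and in
    \<open>mode_coeff\<close>, so the estimate stays valid.\<close>
  define K where "K = (\<Sum>l\<in>tri_index N. 9 / D l)"
  have K: "K \<ge> 0" unfolding K_def using D by (intro sum_nonneg) auto
  have "\<bar>tri_partial_sum N g z\<bar> \<le> K * (\<integral>z. \<bar>g z\<bar> \<partial>tri_measure)" if g: "integrable tri_measure g" for g z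
  proof -
    have i: "integrable tri_measure (\<lambda>z. \<bar>g z\<bar>)" using g by simp
    have c: "\<bar>mode_coeff g l\<bar> \<le> 3 * (\<integral>z. \<bar>g z\<bar> \<partial>tri_measure) / D l" for l
    proof -
      have "\<bar>\<integral>z. g z * mode l (tri_coord z) \<partial>tri_measure\<bar> \<le> (\<integral>z. \<bar>g z * mode l (tri_coord z)\<bar> \<partial>tri_measure)"
        by (rule integral_abs_bound)
      also have "\<dots> \<le> (\<integral>z. 3 * \<bar>g z\<bar> \<partial>tri_measure)"
      proof (rule integral_mono)
        show "\<bar>g z * mode l (tri_coord z)\<bar> \<le> 3 * \<bar>g z\<bar>" for z
          using mult_left_mono[OF mode_bound, of "\<bar>g z\<bar>"] by (simp add: abs_mult mult.commute)
      qed (use integrable_times_mode[OF g] i in auto)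
      finally have "\<bar>\<integral>z. g z * mode l (tri_coord z) \<partial>tri_measure\<bar> \<le> 3 * (\<integral>z. \<bar>g z\<bar> \<partial>tri_measure)" by simp
      from divide_right_mono[OF this D[of l]] show ?thesis
        using D[of l] by (simp add: mode_coeff_def D_def abs_divide)
    qed
    have "\<bar>tri_partial_sum N g z\<bar> \<le> (\<Sum>l\<in>tri_index N. \<bar>mode_coeff g l\<bar> * \<bar>mode l (tri_coord z)\<bar>)"
      unfolding tri_partial_sum_mode abs_mult[symmetric] by (rule sum_abs)
    also have "\<dots> \<le> (\<Sum>l\<in>tri_index N. 3 * (\<integral>z. \<bar>g z\<bar> \<partial>tri_measure) / D l * 3)"
      using D by (intro sum_mono mult_mono c mode_bound) auto
    also have "\<dots> = K * (\<integral>z. \<bar>g z\<bar> \<partial>tri_measure)"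
      unfolding K_def sum_distrib_right by (intro sum.cong) auto
    finally show ?thesis .
  qed
  then show ?thesis using K by blast
qed

text \<open>Continuity at 0 for one fixed \<open>N\<close>, with \<open>d\<close> depending on
  \<open>N\<close>. It follows from the pointwise bound by the L^1 norm, which is small when the
  power integral is small.\<close>

lemma tri_partial_sum_small:
  assumes p: "p \<ge> 1" and e: "e > 0"
  shows "\<exists>d>0. \<forall>u\<in>Lp_space p tri_measure. power_integral p u < d \<longrightarrow>
    power_integral p (tri_partial_sum N u) \<le> e"
proof -
  interpret finite_measure tri_measure by (rule finite_measure_tri)
  define \<mu> where "\<mu> = measure tri_measure (space tri_measure)"
  have \<mu>: "\<mu> \<ge> 0" by (simp add: \<mu>_def)
  from tri_partial_sum_L1_bound[of N] obtain K where K1: "K \<ge> 0"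
    and K2: "\<forall>g. integrable tri_measure g \<longrightarrow> (\<forall>z. \<bar>tri_partial_sum N g z\<bar> \<le> K * (\<integral>z. \<bar>g z\<bar> \<partial>tri_measure))"
    by (elim exE conjE)
  note K = K1 K2[rule_format]
  define \<eta> where "\<eta> = (e / (\<mu> + 1)) powr (1 / p) / (K + 1)"
  have \<eta>: "\<eta> > 0" using e \<mu> K by (simp add: \<eta>_def)
  from L1_small[OF p \<eta>] obtain d where d1: "d > 0"
    and d2: "\<forall>u\<in>Lp_space p tri_measure. power_integral p u < d \<longrightarrow> (\<integral>z. \<bar>u z\<bar> \<partial>tri_measure) < \<eta>"
    by (elim exE conjE)
  note d = d1 d2[rule_format]
  have "power_integral p (tri_partial_sum N u) \<le> e"
    if u: "u \<in> Lp_space p tri_measure" and s: "power_integral p u < d" for u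
  proof -
    have "\<bar>tri_partial_sum N u z\<bar> powr p \<le> e / (\<mu> + 1)" for z
    proof -
      have "\<bar>tri_partial_sum N u z\<bar> \<le> K * (\<integral>z. \<bar>u z\<bar> \<partial>tri_measure)"
        by (rule K(2)[OF Lp_imp_integrable[OF u p]])
      also have "\<dots> \<le> K * \<eta>" using d(2)[OF u s] K(1) by (intro mult_left_mono) auto
      also have "\<dots> \<le> (K + 1) * \<eta>" using \<eta> by (intro mult_right_mono) auto
      also have "\<dots> = (e / (\<mu> + 1)) powr (1 / p)" using K(1) by (simp add: \<eta>_def)
      finally have "\<bar>tri_partial_sum N u z\<bar> powr p \<le> ((e / (\<mu> + 1)) powr (1 / p)) powr p"
        using p by (intro powr_mono2) auto
      also have "\<dots> = e / (\<mu> + 1)" using p e \<mu> by (simp add: powr_powr)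
      finally show ?thesis .
    qed
    then have "power_integral p (tri_partial_sum N u) \<le> (\<integral>z. e / (\<mu> + 1) \<partial>tri_measure)"
      using tri_partial_sum_in_Lp[of p N u] p by (intro integral_mono) (auto simp: Lp_space_def)
    also have "\<dots> = e * (\<mu> / (\<mu> + 1))" by (simp add: \<mu>_def)
    also have "\<dots> \<le> e * 1" using e \<mu> by (intro mult_left_mono) auto
    finally show ?thesis by simp
  qed
  then show ?thesis using d(1) by blast
qed

section \<open>Uniform boundedness and convergence\<close>

lemma mode_spanE:
  assumes "P \<in> mode_span"
  obtains M a where "P = (\<lambda>z. \<Sum>l\<in>tri_index M. a l * mode l z)"
  using assms unfolding mode_span_def by blast

lemma tri_partial_sum_span_bound:
  assumes p: "1 < (p :: real)"
  shows "\<exists>C\<ge>0. \<forall>N. \<forall>P\<in>mode_span. (\<integral>z. \<bar>tri_partial_sum N (\<lambda>z. P (tri_coord z)) z\<bar> powr p \<partial>tri_measure)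
    \<le> C * (\<integral>z. \<bar>P (tri_coord z)\<bar> powr p \<partial>tri_measure)"
proof -
  from mode_truncation_bound[OF p] obtain C where C: "C \<ge> 0"
    "\<And>a M N. (\<integral>z. \<bar>\<Sum>l\<in>{l \<in> tri_index M. snd l \<le> int N}. a l * mode l (tri_coord z)\<bar> powr p \<partial>tri_measure)
    \<le> C * (\<integral>z. \<bar>\<Sum>l\<in>tri_index M. a l * mode l (tri_coord z)\<bar> powr p \<partial>tri_measure)" by blast
  have "(\<integral>z. \<bar>tri_partial_sum N (\<lambda>z. P (tri_coord z)) z\<bar> powr p \<partial>tri_measure)
    \<le> C * (\<integral>z. \<bar>P (tri_coord z)\<bar> powr p \<partial>tri_measure)" if "P \<in> mode_span" for N P
  proof -
    obtain M a where P: "P = (\<lambda>z. \<Sum>l\<in>tri_index M. a l * mode l z)"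
      using mode_spanE[OF \<open>P \<in> mode_span\<close>] by blast
    let ?Q = "\<lambda>z. \<Sum>l\<in>{l \<in> tri_index M. snd l \<le> int N}. a l * mode l z"
    have Qm: "(\<lambda>z. ?Q (tri_coord z)) \<in> borel_measurable tri_measure"
      by (rule tri_coord_measurable) (intro continuous_intros continuous_on_mode)
    have Sm: "tri_partial_sum N (\<lambda>z. P (tri_coord z)) \<in> borel_measurable tri_measure"
      using tri_partial_sum_in_Lp[of 1] by (simp add: Lp_space_def)
    have "(\<integral>z. \<bar>tri_partial_sum N (\<lambda>z. P (tri_coord z)) z\<bar> powr p \<partial>tri_measure) = (\<integral>z. \<bar>?Q (tri_coord z)\<bar> powr p \<partial>tri_measure)"
    proof (rule integral_cong_AE)
      show "AE z in tri_measure. \<bar>tri_partial_sum N (\<lambda>z. P (tri_coord z)) z\<bar> powr p = \<bar>?Q (tri_coord z)\<bar> powr p"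
        using tri_partial_sum_span[of N a M] unfolding P by eventually_elim simp
    qed (use Qm Sm in measurable)
    with C(2)[of a M N] show ?thesis by (simp add: P)
  qed
  then show ?thesis using C(1) by blast
qed

text \<open>Split h into P in the span and a remainder so small that its partial sum is negligible
  for the given \<open>N\<close>. The factor c = 2^p arises twice, from splitting the partial sum of
  h and from estimating P by h; the remaining error is arbitrary, so the constant does not depend on
  \<open>N\<close>.\<close>

lemma tri_partial_sum_bound:
  assumes p: "1 < (p :: real)"
  shows "\<exists>C\<ge>0. \<forall>N. \<forall>h\<in>Lp_space p tri_measure. power_integral p (tri_partial_sum N h)
    \<le> C * power_integral p h"
proof -
  obtain C where C: "C \<ge> 0" and S: "\<And>N P. P \<in> mode_span \<Longrightarrow>
    (\<integral>z. \<bar>tri_partial_sum N (\<lambda>z. P (tri_coord z)) z\<bar> powr p \<partial>tri_measure) \<le> C * (\<integral>z. \<bar>P (tri_coord z)\<bar> powr p \<partial>tri_measure)"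
    using tri_partial_sum_span_bound[OF p] by blast
  define c where "c = (2 powr p :: real)"
  have c: "c \<ge> 0" by (simp add: c_def)
  have p0: "p > 0" and p1: "p \<ge> 1" using p by auto
  have "power_integral p (tri_partial_sum N h) \<le> c * C * c * power_integral p h"
    if h: "h \<in> Lp_space p tri_measure" for N h
  proof (rule field_le_epsilon)
    fix e :: real assume e: "e > 0"
    define I where "I = power_integral p h"
    \<comment> \<open>The error terms collected below add up to
      \<open>c * (1 + C * c) * e'\<close>.\<close>
    define e' where "e' = e / (c * (1 + C * c) + 1)"
    have pos: "c * (1 + C * c) + 1 > 0" using c C by (simp add: add_nonneg_pos)
    have e': "e' > 0" using e pos by (simp add: e'_def)
    obtain d where d: "d > 0" "\<And>u. u \<in> Lp_space p tri_measure \<Longrightarrow> power_integral p u < d \<Longrightarrow>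
      power_integral p (tri_partial_sum N u) \<le> e'"
      using tri_partial_sum_small[OF p1 e'] by blast
    \<comment> \<open>\<open>d\<close> makes the partial sum of the remainder small,
      \<open>e'\<close> controls the return from P to h.\<close>
    obtain P where P: "P \<in> mode_span" "(\<integral>z. \<bar>h z - P (tri_coord z)\<bar> powr p \<partial>tri_measure) < min d e'"
      using mode_dense[OF h p0, of "min d e'"] d e' by auto
    let ?P = "\<lambda>z. P (tri_coord z)" and ?u = "\<lambda>z. h z - P (tri_coord z)"
    have PL: "?P \<in> Lp_space p tri_measure"
      by (rule continuous_in_Lp_tri[OF continuous_on_mode_span[OF P(1)] p0])
    have uL: "?u \<in> Lp_space p tri_measure" by (rule Lp_space_diff[OF p0 h PL])
    have split: "tri_partial_sum N h = (\<lambda>z. tri_partial_sum N ?u z + tri_partial_sum N ?P z)"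
      using tri_partial_sum_add[OF Lp_imp_integrable[OF uL p1] Lp_imp_integrable[OF PL p1]] by auto
    have 1: "power_integral p (tri_partial_sum N h)
      \<le> c * (power_integral p (tri_partial_sum N ?u) + power_integral p (tri_partial_sum N ?P))"
      unfolding split c_def by (intro Lp_space_add(2) tri_partial_sum_in_Lp p0)
    have 2: "power_integral p (tri_partial_sum N ?u) \<le> e'"
      by (rule d(2)[OF uL]) (use P(2) in simp)
    have "power_integral p ?P = (\<integral>z. \<bar>h z + - 1 * ?u z\<bar> powr p \<partial>tri_measure)" by simp
    also have "\<dots> \<le> c * (I + (\<integral>z. \<bar>- 1 * ?u z\<bar> powr p \<partial>tri_measure))"
      unfolding c_def I_def by (intro Lp_space_add(2) Lp_space_cmult p0 h uL)
    also have "\<dots> \<le> c * (I + e')" using P(2) c by (intro mult_left_mono) (auto simp: abs_minus_commute)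
    finally have 3: "power_integral p ?P \<le> c * (I + e')" .
    have "power_integral p (tri_partial_sum N ?P) \<le> C * (c * (I + e'))"
      using S[OF P(1), of N] mult_left_mono[OF 3 C] by linarith
    with 2 have "power_integral p (tri_partial_sum N ?u) + power_integral p (tri_partial_sum N ?P)
      \<le> e' + C * (c * (I + e'))" by linarith
    from mult_left_mono[OF this c] 1
    have "power_integral p (tri_partial_sum N h) \<le> c * (e' + C * (c * (I + e')))" by linarith
    also have "\<dots> = c * C * c * I + (c * (1 + C * c)) * e'" by (simp add: algebra_simps)
    also have "(c * (1 + C * c)) * e' \<le> (c * (1 + C * c) + 1) * e'" using e' by (intro mult_right_mono) auto
    also have "\<dots> = e" using pos by (simp add: e'_def)
    finally show "power_integral p (tri_partial_sum N h) \<le> c * C * c * power_integral p h + e"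
      by (simp add: I_def)
  qed
  moreover have "c * C * c \<ge> 0" using c C by simp
  ultimately show ?thesis by blast
qed

text \<open>For \<open>N >= M\<close> the partial sum reproduces P almost everywhere, so with u = f
  - P the error is the partial sum of u minus u, which the uniform bound controls by the power
  integral of u alone.\<close>

lemma tri_partial_sum_tendsto:
  assumes p: "1 < (p :: real)" and f: "f \<in> Lp_space p tri_measure"
  shows "(\<lambda>N. \<integral>z. \<bar>tri_partial_sum N f z - f z\<bar> powr p \<partial>tri_measure) \<longlonglongrightarrow> 0"
proof (rule LIMSEQ_I)
  fix r :: real assume r: "r > 0"
  obtain C where C: "C \<ge> 0" and S: "\<And>N h. h \<in> Lp_space p tri_measure \<Longrightarrow>
    power_integral p (tri_partial_sum N h) \<le> C * power_integral p h"
    using tri_partial_sum_bound[OF p] by blast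
  have p0: "p > 0" and p1: "p \<ge> 1" using p by auto
  define e where "e = r / (2 powr p * (C + 1))"
  have e: "e > 0" using r C by (simp add: e_def)
  obtain P where P: "P \<in> mode_span" "(\<integral>z. \<bar>f z - P (tri_coord z)\<bar> powr p \<partial>tri_measure) < e"
    using mode_dense[OF f p0 e] by auto
  obtain M a where Pa: "P = (\<lambda>z. \<Sum>l\<in>tri_index M. a l * mode l z)"
    using mode_spanE[OF P(1)] by blast
  let ?P = "\<lambda>z. P (tri_coord z)" and ?u = "\<lambda>z. f z - P (tri_coord z)"
  have PL: "?P \<in> Lp_space p tri_measure"
    by (rule continuous_in_Lp_tri[OF continuous_on_mode_span[OF P(1)] p0])
  have uL: "?u \<in> Lp_space p tri_measure" by (rule Lp_space_diff[OF p0 f PL])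
  have "(\<integral>z. \<bar>tri_partial_sum N f z - f z\<bar> powr p \<partial>tri_measure) < r" if N: "N \<ge> M" for N
  proof -
    have "{l \<in> tri_index M. snd l \<le> int N} = tri_index M" using N by (auto simp: tri_index_def)
    then have id: "AE z in tri_measure. tri_partial_sum N ?P z = ?P z"
      using tri_partial_sum_span[of N a M] by (simp add: Pa)
    have m: "f \<in> borel_measurable tri_measure" "tri_partial_sum N g \<in> borel_measurable tri_measure"
      "?u \<in> borel_measurable tri_measure" for g
      using f uL tri_partial_sum_in_Lp[OF p0, of N g] by (auto simp: Lp_space_def)
    have "(\<integral>z. \<bar>tri_partial_sum N f z - f z\<bar> powr p \<partial>tri_measure)
      = (\<integral>z. \<bar>tri_partial_sum N ?u z + -1 * ?u z\<bar> powr p \<partial>tri_measure)"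
    proof (rule integral_cong_AE)
      show "AE z in tri_measure. \<bar>tri_partial_sum N f z - f z\<bar> powr p = \<bar>tri_partial_sum N ?u z + -1 * ?u z\<bar> powr p"
        using id
      proof eventually_elim
        case (elim z)
        have "tri_partial_sum N f z = tri_partial_sum N ?u z + tri_partial_sum N ?P z"
          using tri_partial_sum_add[OF Lp_imp_integrable[OF uL p1] Lp_imp_integrable[OF PL p1], of N z] by simp
        then have "tri_partial_sum N f z - f z = tri_partial_sum N ?u z + -1 * ?u z" using elim by simp
        then show ?case by (simp only:)
      qed
      have "(\<lambda>z. tri_partial_sum N f z - f z) \<in> borel_measurable tri_measure"
        by (intro borel_measurable_diff m)
      then show "(\<lambda>z. \<bar>tri_partial_sum N f z - f z\<bar> powr p) \<in> borel_measurable tri_measure"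
        by measurable
      have "(\<lambda>z. tri_partial_sum N ?u z + -1 * ?u z) \<in> borel_measurable tri_measure"
        by (intro borel_measurable_add borel_measurable_times borel_measurable_const m)
      then show "(\<lambda>z. \<bar>tri_partial_sum N ?u z + -1 * ?u z\<bar> powr p) \<in> borel_measurable tri_measure"
        by measurable
    qed
    also have "\<dots> \<le> 2 powr p * (power_integral p (tri_partial_sum N ?u) + (\<integral>z. \<bar>-1 * ?u z\<bar> powr p \<partial>tri_measure))"
      by (intro Lp_space_add(2) tri_partial_sum_in_Lp Lp_space_cmult p0 uL)
    also have "\<dots> \<le> 2 powr p * (C * power_integral p ?u + power_integral p ?u)"
      using S[OF uL, of N] by (intro mult_left_mono add_mono) (auto simp: abs_minus_commute)
    also have "\<dots> = 2 powr p * (C + 1) * power_integral p ?u" by (simp add: algebra_simps)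
    also have "\<dots> < 2 powr p * (C + 1) * e" using P(2) C by (intro mult_strict_left_mono) auto
    also have "\<dots> = r" using C by (simp add: e_def)
    finally show ?thesis .
  qed
  then show "\<exists>no. \<forall>N\<ge>no. norm ((\<integral>z. \<bar>tri_partial_sum N f z - f z\<bar> powr p \<partial>tri_measure) - 0) < r"
    by (intro exI[of _ M]) simp
qed

section \<open>Reflection and the symmetric part\<close>

lemma reflect_lebesgue:
  defines "\<rho> \<equiv> \<lambda>z :: real \<times> real. (- fst z, snd z)"
  shows "\<rho> \<in> lebesgue \<rightarrow>\<^sub>M lebesgue" and "lebesgue = distr lebesgue lebesgue \<rho>"
proof -
  define c :: "real \<times> real \<Rightarrow> real" where "c = (\<lambda>j. if j = (1, 0) then -1 else 1)"
  have c: "c j \<noteq> 0" for j by (simp add: c_def)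
  have \<rho>: "\<rho> = (\<lambda>x. 0 + (\<Sum>j\<in>Basis. (c j * (x \<bullet> j)) *\<^sub>R j))"
    by (auto simp: \<rho>_def fun_eq_iff sum_Basis_prod_eq c_def)
  show "\<rho> \<in> lebesgue \<rightarrow>\<^sub>M lebesgue"
    unfolding \<rho> by (rule lebesgue_affine_measurable) (rule c)
  have "(\<Prod>j\<in>Basis. \<bar>c j\<bar>) = 1" by (intro prod.neutral) (auto simp: c_def)
  then show "lebesgue = distr lebesgue lebesgue \<rho>"
    using lebesgue_affine_euclidean[of c 0, OF c] unfolding \<rho> by (simp add: density_1)
qed

lemma equi_triangle_eq: "equi_triangle = {z. 0 \<le> snd z \<and> sqrt 3 * \<bar>fst z\<bar> + snd z \<le> 1}"
proof (intro set_eqI iffI)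
  fix z assume "z \<in> equi_triangle"
  then obtain u v w where z: "z = u *\<^sub>R (- 1 / sqrt 3, 0) + v *\<^sub>R (1 / sqrt 3, 0) + w *\<^sub>R (0, 1)"
    and uvw: "0 \<le> u" "0 \<le> v" "0 \<le> w" "u + v + w = 1"
    unfolding equi_triangle_def convex_hull_3 by blast
  have "sqrt 3 * \<bar>fst z\<bar> = \<bar>sqrt 3 * fst z\<bar>" by (simp add: abs_mult)
  also have "sqrt 3 * fst z = v - u" by (simp add: z field_simps)
  finally show "z \<in> {z. 0 \<le> snd z \<and> sqrt 3 * \<bar>fst z\<bar> + snd z \<le> 1}"
    using uvw by (auto simp: z)
next
  fix z :: "real \<times> real" assume z: "z \<in> {z. 0 \<le> snd z \<and> sqrt 3 * \<bar>fst z\<bar> + snd z \<le> 1}"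
  define X where "X = sqrt 3 * fst z"
  have X: "\<bar>X\<bar> + snd z \<le> 1" "snd z \<ge> 0" using z by (auto simp: X_def abs_mult)
  define u v where "u = (1 - snd z - X) / 2" and "v = (1 - snd z + X) / 2"
  have "0 \<le> u" "0 \<le> v" "0 \<le> snd z" "u + v + snd z = 1"
    using X by (auto simp: u_def v_def field_simps)
  moreover have "z = u *\<^sub>R (- 1 / sqrt 3, 0) + v *\<^sub>R (1 / sqrt 3, 0) + snd z *\<^sub>R (0, 1)"
  proof -
    have "v - u = X" by (simp add: u_def v_def field_simps)
    then have "fst z = (v - u) / sqrt 3" by (simp add: X_def)
    then show ?thesis by (simp add: prod_eq_iff diff_divide_distrib)
  qed
  ultimately show "z \<in> equi_triangle"
    unfolding equi_triangle_def convex_hull_3 by blast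
qed

text \<open>Extending f by 0 outside the large triangle discards its arbitrary values there and
  turns reflection into a measure-preserving map of the whole plane. On the half triangle both
  points entering \<open>sym_part\<close> lie in the large one, so nothing changes there.\<close>

lemma sym_part_in_Lp:
  assumes p: "p > 0" and f: "f \<in> Lp_space p (lebesgue_on equi_triangle)"
  shows "sym_part f \<in> Lp_space p (lebesgue_on hemi_triangle)"
proof -
  have "compact equi_triangle"
    unfolding equi_triangle_def by (intro finite_imp_compact_convex_hull) simp
  then have meas: "equi_triangle \<in> sets lebesgue"
    by (auto intro: borel_closed dest: compact_imp_closed)
  define F where "F = (\<lambda>z. if z \<in> equi_triangle then f z else 0)"
  define \<rho> where "\<rho> = (\<lambda>z :: real \<times> real. (- fst z, snd z))"
  note r = reflect_lebesgue[folded \<rho>_def]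
  have Fm: "F \<in> borel_measurable lebesgue"
    using f meas unfolding F_def Lp_space_def by (simp add: borel_measurable_if)
  have Fi: "integrable lebesgue (\<lambda>z. \<bar>F z\<bar> powr p)"
  proof -
    have "integrable (lebesgue_on equi_triangle) (\<lambda>z. \<bar>f z\<bar> powr p)" using f by (simp add: Lp_space_def)
    then have "integrable lebesgue (\<lambda>z. indicator equi_triangle z *\<^sub>R \<bar>f z\<bar> powr p)"
      using meas by (subst (asm) integrable_restrict_space) auto
    then show ?thesis
      by (rule Bochner_Integration.integrable_cong[THEN iffD1, rotated 2]) (auto simp: F_def indicator_def)
  qed
  have FL: "F \<in> Lp_space p lebesgue" using Fm Fi by (simp add: Lp_space_def)
  have FrL: "(\<lambda>z. F (\<rho> z)) \<in> Lp_space p lebesgue"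
  proof -
    have "(\<lambda>z. F (\<rho> z)) \<in> borel_measurable lebesgue" using r(1) Fm by (rule measurable_compose)
    moreover have "integrable lebesgue (\<lambda>z. \<bar>F (\<rho> z)\<bar> powr p)"
      using Fi by (subst (asm) r(2)) (subst (asm) integrable_distr_eq[OF r(1)], use Fm in auto)
    ultimately show ?thesis by (simp add: Lp_space_def)
  qed
  have L: "(\<lambda>z. 1 / 2 * (F z + F (\<rho> z))) \<in> Lp_space p lebesgue"
    by (intro Lp_space_cmult Lp_space_add p FL FrL)
  have eq: "sym_part f z = 1 / 2 * (F z + F (\<rho> z))" if "z \<in> hemi_triangle" for z
    using that by (cases z) (auto simp: sym_part_def F_def \<rho>_def hemi_triangle_eq equi_triangle_eq)
  have R: "(\<lambda>z. 1 / 2 * (F z + F (\<rho> z))) \<in> Lp_space p tri_measure"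
  proof -
    have "integrable lebesgue (\<lambda>z. \<bar>1 / 2 * (F z + F (\<rho> z))\<bar> powr p)" using L by (simp add: Lp_space_def)
    from integrable_mult_indicator[OF hemi_sets(1) this]
    have "integrable tri_measure (\<lambda>z. \<bar>1 / 2 * (F z + F (\<rho> z))\<bar> powr p)"
      by (subst integrable_restrict_space) auto
    moreover have "(\<lambda>z. 1 / 2 * (F z + F (\<rho> z))) \<in> borel_measurable tri_measure"
      using L by (intro measurable_restrict_space1) (simp add: Lp_space_def)
    ultimately show ?thesis unfolding Lp_space_def by blast
  qed
  have "sym_part f \<in> borel_measurable tri_measure \<longleftrightarrow> (\<lambda>z. 1 / 2 * (F z + F (\<rho> z))) \<in> borel_measurable tri_measure"
    by (rule measurable_cong) (simp add: eq)
  moreover have "integrable tri_measure (\<lambda>z. \<bar>sym_part f z\<bar> powr p) \<longleftrightarrow>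
    integrable tri_measure (\<lambda>z. \<bar>1 / 2 * (F z + F (\<rho> z))\<bar> powr p)"
    by (rule Bochner_Integration.integrable_cong) (simp_all add: eq)
  ultimately show ?thesis using R unfolding Lp_space_def mem_Collect_eq by blast
qed

theorem theorem12:
  fixes p :: real and f :: "real \<times> real \<Rightarrow> real"
  assumes "1 < p"
    and "f \<in> Lp_space p (lebesgue_on equi_triangle)"
  shows "sym_part f \<in> Lp_space p (lebesgue_on hemi_triangle) \<and>
    Lp_converges p (lebesgue_on hemi_triangle) (\<lambda>N. tri_partial_sum N (sym_part f)) (sym_part f)"
proof
  have p0: "p > 0" using assms(1) by simp
  show L: "sym_part f \<in> Lp_space p (lebesgue_on hemi_triangle)"
    by (rule sym_part_in_Lp[OF p0 assms(2)])
  have "(\<lambda>N. (\<integral>z. \<bar>tri_partial_sum N (sym_part f) z - sym_part f z\<bar> powr p \<partial>tri_measure) powr (1 / p)) \<longlonglongrightarrow> 0 powr (1 / p)"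
    by (rule tendsto_powr'[OF tri_partial_sum_tendsto[OF assms(1) L] tendsto_const]) (use p0 in auto)
  then show "Lp_converges p (lebesgue_on hemi_triangle) (\<lambda>N. tri_partial_sum N (sym_part f)) (sym_part f)"
    using L tri_partial_sum_in_Lp[OF p0] by (simp add: Lp_converges_def Lp_norm_def)
qed

end
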